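(* Let $G_{v_0}$ be a forest with integer weights on all vertices except one unweighted vertex $v_0$, let $G=G_{v_0}\setminus\{v_0\}$, and let $n\in\mathbb Z$ be such that $G_{v_0}(n)$ (the graph $G_{v_0}$ with $v_0$ given weight $n$) is negative definite. Let $r=\Sigma^2=n-\Sigma_0^2$ be the corresponding Seifert framing. For every $[\mathfrak t,i]\in \mathrm{Spin}^c(Y_{G_{v_0}(n)})$, the diagram $\mathbb{TB}^{[\mathfrak t,i]}$ of filtered simplicial sets on $\mathcal I_{[\mathfrak t,i]}$ is isomorphic, via a natural transformation $\Phi$, to the diagram $\mathbb{XD}_{r}^{[\mathfrak t,i]}(\mathbb{CFK}^\natural(G_{v_0}))$, and therefore the homotopy colimit of $\mathbb{XD}_{r}^{[\mathfrak t,i]}(\mathbb{CFK}^\natural(G_{v_0}))$ is isomorphic to $\mathbb{CF}^\natural(G_{v_0}(n),[\mathfrak t,i])$.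
   Context: **Plumbings.** For a weighted forest $H$, $X_H$ is the plumbing 4-manifold and $Y_H=\partial X_H$; vertices are identified with classes in $H_2(X_H;\mathbb Z)$. $\mathrm{Char}(H)\subset H^2(X_H;\mathbb Z)$ is the set of characteristic classes; classes $S\in H_2(X_H,Y_H;\mathbb Z)$ act by $k+S:=k+2PD[S]$. Orbits of $\mathrm{Char}(H)$ under $H_2(X_H;\mathbb Z)$ correspond to $\mathrm{Spin}^c(Y_H)$; $\mathrm{Char}(H,\mathfrak t)$ is the orbit of $\mathfrak t$. An unweighted vertex $v_0$ defines a class in $H_2(X_G,Y_G;\mathbb Z)$ (boundary connected sum of disk fibers over the vertices adjacent to $v_0$), with boundary the knot $K=K_{G_{v_0}}\subset Y_G$; it acts on $\mathrm{Char}(G)$ by $k+v_0=k+2PD[v_0]$ and takes $\mathrm{Char}(G,\mathfrak t)$ to $\mathrm{Char}(G,\mathfrak t+[K])$. **Lattice simplicial sets.** For $H$ negative definite, the cube $[k,E]$ ($k\in\mathrm{Char}(H,\mathfrak t)$, $E$ a set of vertices) is the convex hull of $\{k+\sum_{v\in I}v: I\subseteq E\}$; $h_U(k)=\frac{k^2+|V(H)|}{4}$ and $h_U([k,E])$ is the minimum of $h_U$ over the vertices of the cube. $D_{H,\mathfrak t}$ is the category whose objects are these cubes, with a morphism $[k,E]\to[k',E']$ when $[k',E']$ is a face of $[k,E]$. $\mathbb{CF}^\natural(H,\mathfrak t)$ is the homotopy colimit over $D_{H,\mathfrak t}$ of the diagram $\mathbb{CFD}$ sending $[k,E]$ to a single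 filtered point of height $h_U([k,E])$. With an unweighted vertex $v_0$, put $h_V([k,E])=h_U([k+v_0,E])$; $\mathbb{CFK}^\natural(G_{v_0},\mathfrak t)$ is the homotopy colimit over $D_{G,\mathfrak t}$ of the points of double height $(h_U,h_V)$, and the flip map $\Gamma\colon p_{2,!}\mathbb{CFK}^\natural(G_{v_0},\mathfrak t)\to p_{1,!}\mathbb{CFK}^\natural(G_{v_0},\mathfrak t+[K])$ is induced by $[k,E]\mapsto[k+v_0,E]$. $\mathbb{CFK}^\natural(G_{v_0})$ is the collection over all $\mathfrak t$ with $\Gamma$. Homotopy colimits are given by the usual Bousfield–Kan (simplicial bar) formula. **Surgery indexing.** $\Sigma_0\in H_2(X_G;\mathbb Q)$ is the class with $\Sigma_0\cdot v=v_0\cdot v$ for all vertices $v$ of $G$; $\Sigma=v_0-\Sigma_0\in H_2(X_{G_{v_0}(n)};\mathbb Q)$, $r=\Sigma^2=n-\Sigma_0^2<0$. For $L\in\mathrm{Char}(G_{v_0}(n))$ let $\hat A(L)=\frac{L(\Sigma)+r}{2}$. Let $\mathcal A$ be the set of pairs $(\mathfrak t,i)$, $\mathfrak t\in\mathrm{Spin}^c(Y_G)$, $i\in\mathbb Q$, for which some $L\in\mathrm{Char}(G_{v_0}(n))$ has $L|_G\in\mathrm{Char}(G,\mathfrak t)$ and $\hat A(L)=i$. $\mathrm{Spin}^c(Y_{G_{v_0}(n)})$ is $\mathcal A$ modulo $(\mathfrak t,i)\sim(\mathfrak t+[K],i+r)$, with classes $[\mathfrak t,i]$. $\mathcal I_{[\mathfrak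 t,i]}$ is the category with objects $(\mathfrak t',i',a),(\mathfrak t',i',b)$ for $(\mathfrak t',i')$ in the class $[\mathfrak t,i]$ and non-identity morphisms $\lambda_{\mathfrak t',i'}\colon(\mathfrak t',i',a)\to(\mathfrak t',i',b)$ and $\rho_{\mathfrak t',i'}\colon(\mathfrak t',i',a)\to(\mathfrak t'+[K],i'+r,b)$. **The diagram $\mathbb{TB}^{[\mathfrak t,i]}$.** At $(\mathfrak t',i',b)$ it is $\mathbb B_{i'}^\natural(\mathfrak t')$, the homotopy colimit of $\mathbb{CFD}$ over the full subcategory of $D_{G_{v_0}(n),[\mathfrak t,i]}$ of cubes $[L,E]$ with $v_0\notin E$, $L|_G\in\mathrm{Char}(G,\mathfrak t')$, $\hat A(L)=i'$; at $(\mathfrak t',i',a)$ it is $\mathbb T_{i'}^\natural(\mathfrak t')$, defined in the same way with cubes such that $v_0\in E$. The maps $\lambda$ and $\rho$ are induced by $[L,E\cup\{v_0\}]\mapsto[L,E]$ and $[L,E\cup\{v_0\}]\mapsto[L+v_0,E]$ respectively. The homotopy colimit of $\mathbb{TB}^{[\mathfrak t,i]}$ is $\mathbb{CF}^\natural(G_{v_0}(n),[\mathfrak t,i])$. **The diagram $\mathbb{XD}$.** A (doubly) filtered simplicial set is a simplicial set with a height function (pair of height functions) on simplices such that faces have height at least that of the simplex. For a doubly filtered simplicial set $X$ with heights $(h_1,h_2)$, $p_{1,!}X$, $p_{2,!}X$ remember only $h_1$, respectively $h_2$; $A_i^*X$ has height $\min\{h_1,h_2+2i\}$; $[q]$ adds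 $q$ to the height; $\eta_1\colon A_i^*X\to p_{1,!}X$ and $\eta_2\colon A_i^*X\to p_{2,!}X[2i]$ are the identity on underlying simplicial sets. With $\mathrm{gr}_r(i)=\frac{(2i-r)^2+r}{4r}$ and $X=\mathbb{CFK}^\natural(G_{v_0})$, $X^{\mathfrak t}=\mathbb{CFK}^\natural(G_{v_0},\mathfrak t)$: $\mathbb{XD}_r^{[\mathfrak t,i]}(X)$ sends $(\mathfrak t',i',a)\mapsto A_{i'}^*(X^{\mathfrak t'})[\mathrm{gr}_r(i')]$, $(\mathfrak t',i',b)\mapsto p_{1,!}(X^{\mathfrak t'})[\mathrm{gr}_r(i')]$, $\lambda_{\mathfrak t',i'}\mapsto\eta_1$, $\rho_{\mathfrak t',i'}\mapsto\Gamma\circ\eta_2$ (shifted by $\mathrm{gr}_r(i')$). *)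

theory Defs
  imports Complex_Main "HOL-Library.Product_Order"
begin

section \<open>Forests\<close>

text \<open>Finite simple graphs whose vertices may carry an integer weight; the vertices outside the
  domain of \<open>wt\<close> are the unweighted ones.\<close>

record 'v wgraph =
  verts :: "'v set"
  edges :: "'v set set"
  wt :: "'v \<rightharpoonup> int"

definition is_cycle :: "'v wgraph \<Rightarrow> 'v list \<Rightarrow> bool" where
  "is_cycle G vs \<longleftrightarrow> length vs \<ge> 3 \<and> distinct vs \<and>
     (\<forall>i<length vs. {vs ! i, vs ! (Suc i mod length vs)} \<in> edges G)"

definition forest :: "'v wgraph \<Rightarrow> bool" where
  "forest G \<longleftrightarrow> finite (verts G) \<and>
     (\<forall>e\<in>edges G. \<exists>u\<in>verts G. \<exists>v\<in>verts G. u \<noteq> v \<and> e = {u, v}) \<and>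
     (\<nexists>vs. is_cycle G vs)"

definition only_unweighted_vertex :: "'v wgraph \<Rightarrow> 'v \<Rightarrow> bool" where
  "only_unweighted_vertex G v0 \<longleftrightarrow> v0 \<in> verts G \<and> dom (wt G) = verts G - {v0}"

definition remove_vertex :: "'v wgraph \<Rightarrow> 'v \<Rightarrow> 'v wgraph" where
  "remove_vertex G v0 =
     \<lparr>verts = verts G - {v0}, edges = {e \<in> edges G. v0 \<notin> e}, wt = (wt G)(v0 := None)\<rparr>"

definition set_weight :: "'v wgraph \<Rightarrow> 'v \<Rightarrow> int \<Rightarrow> 'v wgraph" where
  "set_weight G v0 n = G\<lparr>wt := (wt G)(v0 \<mapsto> n)\<rparr>"


section \<open>Homology of plumbings\<close>

text \<open>The plumbing \<open>X\<^sub>H\<close> is simply connected and \<open>H\<^sub>2(X\<^sub>H; R)\<close> is free on the vertices, so a class in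
  it is a function on vertices (zero off \<open>verts H\<close>) giving its coefficients.  An element of
  \<open>H\<^sup>2(X\<^sub>H; \<int>) = Hom(H\<^sub>2(X\<^sub>H; \<int>), \<int>)\<close> is the function giving its values on the vertices.  A class \<open>S\<close>
  in \<open>H\<^sub>2(X\<^sub>H, Y\<^sub>H; \<int>)\<close> is the function giving its coefficients in the basis of disk fibers; since the
  disk fiber over \<open>u\<close> meets \<open>v\<close> in \<open>\<delta>\<^sub>u\<^sub>v\<close> points, that is the same function as its Poincare dual
  \<open>PD[S]\<close> in \<open>H\<^sup>2(X\<^sub>H; \<int>)\<close>.\<close>

definition classes :: "'v wgraph \<Rightarrow> ('v \<Rightarrow> 'a::zero) set" where
  "classes H = {x. \<forall>v. v \<notin> verts H \<longrightarrow> x v = 0}"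

definition vertex :: "'v \<Rightarrow> 'v \<Rightarrow> 'a::zero_neq_one" where
  "vertex v = (\<lambda>u. if u = v then 1 else 0)"

definition inter :: "'v wgraph \<Rightarrow> 'v \<Rightarrow> 'v \<Rightarrow> int" where
  "inter H u v = (if u = v then the (wt H u) else if {u, v} \<in> edges H then 1 else 0)"

definition form :: "'v wgraph \<Rightarrow> ('v \<Rightarrow> 'a::comm_ring_1) \<Rightarrow> ('v \<Rightarrow> 'a) \<Rightarrow> 'a" where
  "form H x y = (\<Sum>u\<in>verts H. \<Sum>v\<in>verts H. x u * of_int (inter H u v) * y v)"

definition negative_definite :: "'v wgraph \<Rightarrow> bool" where
  "negative_definite H \<longleftrightarrow> (\<forall>x::'v \<Rightarrow> int. x \<in> classes H \<longrightarrow> x \<noteq> (\<lambda>_. 0) \<longrightarrow> form H x x < 0)"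

definition evaluate :: "'v wgraph \<Rightarrow> ('v \<Rightarrow> int) \<Rightarrow> ('v \<Rightarrow> 'a::comm_ring_1) \<Rightarrow> 'a" where
  "evaluate H k x = (\<Sum>v\<in>verts H. of_int (k v) * x v)"

text \<open>The image of a class under \<open>H\<^sub>2(X\<^sub>H; \<int>) \<rightarrow> H\<^sub>2(X\<^sub>H, Y\<^sub>H; \<int>)\<close>.\<close>

definition rel_class :: "'v wgraph \<Rightarrow> ('v \<Rightarrow> int) \<Rightarrow> 'v \<Rightarrow> int" where
  "rel_class H x = (\<lambda>v. if v \<in> verts H then form H x (vertex v) else 0)"

text \<open>The class of the unweighted vertex \<open>v\<^sub>0\<close> in \<open>H\<^sub>2(X\<^sub>G, Y\<^sub>G; \<int>)\<close>: the sum of the disk fibers over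
  its neighbors.\<close>

definition knot_class :: "'v wgraph \<Rightarrow> 'v \<Rightarrow> 'v \<Rightarrow> int" where
  "knot_class Gv0 v0 = (\<lambda>v. if v \<in> verts Gv0 - {v0} \<and> {v0, v} \<in> edges Gv0 then 1 else 0)"

text \<open>The action \<open>k + S = k + 2 PD[S]\<close>.\<close>

definition act :: "('v \<Rightarrow> int) \<Rightarrow> ('v \<Rightarrow> int) \<Rightarrow> 'v \<Rightarrow> int" where
  "act k S = (\<lambda>v. k v + 2 * S v)"

definition Char :: "'v wgraph \<Rightarrow> ('v \<Rightarrow> int) set" where
  "Char H = {k \<in> classes H. \<forall>x::'v \<Rightarrow> int. x \<in> classes H \<longrightarrow> even (evaluate H k x - form H x x)}"

text \<open>A \<open>Spin\<^sup>c\<close> structure on \<open>Y\<^sub>H\<close> is an orbit \<open>\<tt>\<close> of characteristic classes; thus \<open>Char(H, \<tt>)\<close> is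
  the set \<open>\<tt>\<close> itself.\<close>

definition orbit_rel :: "'v wgraph \<Rightarrow> (('v \<Rightarrow> int) \<times> ('v \<Rightarrow> int)) set" where
  "orbit_rel H = {(k, k'). k \<in> Char H \<and> k' \<in> Char H \<and>
     (\<exists>x\<in>classes H. k' = act k (rel_class H x))}"

definition Spinc :: "'v wgraph \<Rightarrow> ('v \<Rightarrow> int) set set" where
  "Spinc H = Char H // orbit_rel H"

definition add_knot :: "'v wgraph \<Rightarrow> 'v \<Rightarrow> ('v \<Rightarrow> int) set \<Rightarrow> ('v \<Rightarrow> int) set" where
  "add_knot Gv0 v0 \<tt> = (\<lambda>k. act k (knot_class Gv0 v0)) ` \<tt>"

text \<open>The rational class \<open>x\<close> with \<open>x \<cdot> v = S \<cdot> v\<close> for all vertices \<open>v\<close>; it is unique when \<open>H\<close> is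
  negative definite.\<close>

definition rat_lift :: "'v wgraph \<Rightarrow> ('v \<Rightarrow> int) \<Rightarrow> 'v \<Rightarrow> rat" where
  "rat_lift H S =
     (THE x. x \<in> classes H \<and> (\<forall>v\<in>verts H. form H x (vertex v) = of_int (S v)))"

definition square :: "'v wgraph \<Rightarrow> ('v \<Rightarrow> int) \<Rightarrow> rat" where
  "square H k = form H (rat_lift H k) (rat_lift H k)"


section \<open>Filtered simplicial sets\<close>

text \<open>Heights take values in a partial order: \<open>rat\<close> for filtered and \<open>rat \<times> rat\<close> with the
  componentwise order for doubly filtered simplicial sets.  \<open>face X n i\<close>, \<open>degen X n i\<close> and
  \<open>height X n\<close> are applied to \<open>n\<close>-simplices.\<close>

record ('a, 'h) fsset =
  simps :: "nat \<Rightarrow> 'a set"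
  face :: "nat \<Rightarrow> nat \<Rightarrow> 'a \<Rightarrow> 'a"
  degen :: "nat \<Rightarrow> nat \<Rightarrow> 'a \<Rightarrow> 'a"
  height :: "nat \<Rightarrow> 'a \<Rightarrow> 'h"

definition simplicial_set :: "('a, 'h) fsset \<Rightarrow> bool" where
  "simplicial_set X \<longleftrightarrow>
     (\<forall>n. \<forall>x\<in>simps X (Suc n). \<forall>i\<le>Suc n. face X (Suc n) i x \<in> simps X n) \<and>
     (\<forall>n. \<forall>x\<in>simps X n. \<forall>i\<le>n. degen X n i x \<in> simps X (Suc n)) \<and>
     (\<forall>n. \<forall>x\<in>simps X (Suc (Suc n)). \<forall>j\<le>Suc (Suc n). \<forall>i<j.
        face X (Suc n) i (face X (Suc (Suc n)) j x)
          = face X (Suc n) (j - 1) (face X (Suc (Suc n)) i x)) \<and>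
     (\<forall>n. \<forall>x\<in>simps X n. \<forall>j\<le>n. \<forall>i\<le>j.
        degen X (Suc n) i (degen X n j x) = degen X (Suc n) (Suc j) (degen X n i x)) \<and>
     (\<forall>n. \<forall>x\<in>simps X n. \<forall>j\<le>n. \<forall>i\<le>Suc n.
        face X (Suc n) i (degen X n j x) =
          (if i < j then degen X (n - 1) (j - 1) (face X n i x)
           else if i \<le> Suc j then x
           else degen X (n - 1) j (face X n (i - 1) x)))"

text \<open>Degenerate simplices have the height of the simplex they come from, so that the simplices of
  height at least a given value form a simplicial subset.\<close>

definition filtered_sset :: "('a, 'h::order) fsset \<Rightarrow> bool" where
  "filtered_sset X \<longleftrightarrow> simplicial_set X \<and>
     (\<forall>n. \<forall>x\<in>simps X (Suc n). \<forall>i\<le>Suc n. height X (Suc n) x \<le> height X n (face X (Suc n) i x)) \<and>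
     (\<forall>n. \<forall>x\<in>simps X n. \<forall>i\<le>n. height X (Suc n) (degen X n i x) = height X n x)"

definition filtered_map ::
  "('a, 'h::order) fsset \<Rightarrow> ('b, 'h) fsset \<Rightarrow> (nat \<Rightarrow> 'a \<Rightarrow> 'b) \<Rightarrow> bool" where
  "filtered_map X Y f \<longleftrightarrow>
     (\<forall>n. \<forall>x\<in>simps X n. f n x \<in> simps Y n) \<and>
     (\<forall>n. \<forall>x\<in>simps X (Suc n). \<forall>i\<le>Suc n. f n (face X (Suc n) i x) = face Y (Suc n) i (f (Suc n) x)) \<and>
     (\<forall>n. \<forall>x\<in>simps X n. \<forall>i\<le>n. f (Suc n) (degen X n i x) = degen Y n i (f n x)) \<and>
     (\<forall>n. \<forall>x\<in>simps X n. height X n x \<le> height Y n (f n x))"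

definition filtered_iso ::
  "('a, 'h::order) fsset \<Rightarrow> ('b, 'h) fsset \<Rightarrow> (nat \<Rightarrow> 'a \<Rightarrow> 'b) \<Rightarrow> bool" where
  "filtered_iso X Y f \<longleftrightarrow> filtered_sset X \<and> filtered_sset Y \<and> filtered_map X Y f \<and>
     (\<exists>g. filtered_map Y X g \<and>
        (\<forall>n. \<forall>x\<in>simps X n. g n (f n x) = x) \<and> (\<forall>n. \<forall>y\<in>simps Y n. f n (g n y) = y))"

definition point :: "'h \<Rightarrow> (unit, 'h) fsset" where
  "point q = \<lparr>simps = (\<lambda>_. UNIV), face = (\<lambda>_ _ x. x), degen = (\<lambda>_ _ x. x), height = (\<lambda>_ _. q)\<rparr>"

definition map_height :: "('h \<Rightarrow> 'g) \<Rightarrow> ('a, 'h) fsset \<Rightarrow> ('a, 'g) fsset" where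
  "map_height \<phi> X =
     \<lparr>simps = simps X, face = face X, degen = degen X, height = (\<lambda>n x. \<phi> (height X n x))\<rparr>"

definition shift :: "rat \<Rightarrow> ('a, rat) fsset \<Rightarrow> ('a, rat) fsset" where
  "shift q = map_height (\<lambda>h. h + q)"

definition p1 :: "('a, rat \<times> rat) fsset \<Rightarrow> ('a, rat) fsset" where
  "p1 = map_height fst"

definition p2 :: "('a, rat \<times> rat) fsset \<Rightarrow> ('a, rat) fsset" where
  "p2 = map_height snd"

definition A_pull :: "rat \<Rightarrow> ('a, rat \<times> rat) fsset \<Rightarrow> ('a, rat) fsset" where
  "A_pull i = map_height (\<lambda>(h1, h2). min h1 (h2 + 2 * i))"


section \<open>Diagrams and homotopy colimits\<close>

record ('o, 'm) cat =
  Obj :: "'o set"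
  Arr :: "'m set"
  Dom :: "'m \<Rightarrow> 'o"
  Cod :: "'m \<Rightarrow> 'o"
  Ident :: "'o \<Rightarrow> 'm"
  Comp :: "'m \<Rightarrow> 'm \<Rightarrow> 'm"

text \<open>\<open>Comp C g f\<close> is the composite \<open>g \<circ> f\<close>.\<close>

definition category :: "('o, 'm) cat \<Rightarrow> bool" where
  "category C \<longleftrightarrow>
     (\<forall>f\<in>Arr C. Dom C f \<in> Obj C \<and> Cod C f \<in> Obj C) \<and>
     (\<forall>c\<in>Obj C. Ident C c \<in> Arr C \<and> Dom C (Ident C c) = c \<and> Cod C (Ident C c) = c) \<and>
     (\<forall>f\<in>Arr C. \<forall>g\<in>Arr C. Cod C f = Dom C g \<longrightarrow>
        Comp C g f \<in> Arr C \<and> Dom C (Comp C g f) = Dom C f \<and> Cod C (Comp C g f) = Cod C g) \<and>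
     (\<forall>f\<in>Arr C. Comp C f (Ident C (Dom C f)) = f \<and> Comp C (Ident C (Cod C f)) f = f) \<and>
     (\<forall>f\<in>Arr C. \<forall>g\<in>Arr C. \<forall>h\<in>Arr C. Cod C f = Dom C g \<longrightarrow> Cod C g = Dom C h \<longrightarrow>
        Comp C h (Comp C g f) = Comp C (Comp C h g) f)"

definition full_subcat :: "('o, 'm) cat \<Rightarrow> ('o \<Rightarrow> bool) \<Rightarrow> ('o, 'm) cat" where
  "full_subcat C P = C\<lparr>Obj := {c \<in> Obj C. P c}, Arr := {f \<in> Arr C. P (Dom C f) \<and> P (Cod C f)}\<rparr>"

record ('o, 'm, 'a, 'h) diagram =
  Ob :: "'o \<Rightarrow> ('a, 'h) fsset"
  Mor :: "'m \<Rightarrow> nat \<Rightarrow> 'a \<Rightarrow> 'a"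

definition filtered_diagram :: "('o, 'm) cat \<Rightarrow> ('o, 'm, 'a, 'h::order) diagram \<Rightarrow> bool" where
  "filtered_diagram C F \<longleftrightarrow> category C \<and>
     (\<forall>c\<in>Obj C. filtered_sset (Ob F c)) \<and>
     (\<forall>f\<in>Arr C. filtered_map (Ob F (Dom C f)) (Ob F (Cod C f)) (Mor F f)) \<and>
     (\<forall>c\<in>Obj C. \<forall>n. \<forall>x\<in>simps (Ob F c) n. Mor F (Ident C c) n x = x) \<and>
     (\<forall>f\<in>Arr C. \<forall>g\<in>Arr C. Cod C f = Dom C g \<longrightarrow>
        (\<forall>n. \<forall>x\<in>simps (Ob F (Dom C f)) n. Mor F (Comp C g f) n x = Mor F g n (Mor F f n x)))"

definition diagram_iso :: "('o, 'm) cat \<Rightarrow> ('o, 'm, 'a, 'h::order) diagram \<Rightarrow>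
    ('o, 'm, 'b, 'h) diagram \<Rightarrow> ('o \<Rightarrow> nat \<Rightarrow> 'a \<Rightarrow> 'b) \<Rightarrow> bool" where
  "diagram_iso C F F' \<Phi> \<longleftrightarrow> filtered_diagram C F \<and> filtered_diagram C F' \<and>
     (\<forall>c\<in>Obj C. filtered_iso (Ob F c) (Ob F' c) (\<Phi> c)) \<and>
     (\<forall>f\<in>Arr C. \<forall>n. \<forall>x\<in>simps (Ob F (Dom C f)) n.
        \<Phi> (Cod C f) n (Mor F f n x) = Mor F' f n (\<Phi> (Dom C f) n x))"

fun composable :: "('o, 'm) cat \<Rightarrow> 'o \<Rightarrow> 'm list \<Rightarrow> bool" where
  "composable C c [] \<longleftrightarrow> c \<in> Obj C"
| "composable C c (f # fs) \<longleftrightarrow> f \<in> Arr C \<and> Dom C f = c \<and> composable C (Cod C f) fs"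

text \<open>The diagonal of the simplicial bar construction: an \<open>n\<close>-simplex \<open>(c\<^sub>0, [f\<^sub>1, \<dots>, f\<^sub>n], x)\<close> consists
  of composable arrows \<open>c\<^sub>0 \<rightarrow> \<dots> \<rightarrow> c\<^sub>n\<close> and an \<open>n\<close>-simplex \<open>x\<close> of \<open>F(c\<^sub>0)\<close>, and has the height of \<open>x\<close>.
  The list index of \<open>f\<^sub>j\<close> is \<open>j - 1\<close>.\<close>

definition hocolim :: "('o, 'm) cat \<Rightarrow> ('o, 'm, 'a, 'h) diagram \<Rightarrow> ('o \<times> 'm list \<times> 'a, 'h) fsset"
  where
  "hocolim C F = \<lparr>
     simps = (\<lambda>n. {(c, fs, x). composable C c fs \<and> length fs = n \<and> x \<in> simps (Ob F c) n}),
     face = (\<lambda>n i (c, fs, x).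
       if i = 0 then (Cod C (hd fs), tl fs, Mor F (hd fs) (n - 1) (face (Ob F c) n 0 x))
       else (c,
             if i = n then butlast fs
             else take (i - 1) fs @ [Comp C (fs ! i) (fs ! (i - 1))] @ drop (Suc i) fs,
             face (Ob F c) n i x)),
     degen = (\<lambda>n i (c, fs, x).
       (c, take i fs @ [Ident C ((c # map (Cod C) fs) ! i)] @ drop i fs, degen (Ob F c) n i x)),
     height = (\<lambda>n (c, fs, x). height (Ob F c) n x)\<rparr>"


section \<open>Lattice simplicial sets\<close>

text \<open>The cube \<open>[k, E]\<close> is recorded by the pair \<open>(k, E)\<close>, which its convex hull determines when the
  intersection form is nondegenerate.  Its vertices are \<open>cube_vertex H k I\<close> for \<open>I \<subseteq> E\<close>, and a face is
  obtained by fixing the coordinates in \<open>E - E'\<close> to be \<open>1\<close> on \<open>J\<close> and \<open>0\<close> off \<open>J\<close>.\<close>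

type_synonym 'v cube = "('v \<Rightarrow> int) \<times> 'v set"

definition cube_vertex :: "'v wgraph \<Rightarrow> ('v \<Rightarrow> int) \<Rightarrow> 'v set \<Rightarrow> 'v \<Rightarrow> int" where
  "cube_vertex H k I = act k (rel_class H (\<lambda>u. \<Sum>v\<in>I. vertex v u))"

definition cube_face :: "'v wgraph \<Rightarrow> 'v cube \<Rightarrow> 'v cube \<Rightarrow> bool" where
  "cube_face H c' c \<longleftrightarrow> (case (c', c) of ((k', E'), (k, E)) \<Rightarrow>
     E' \<subseteq> E \<and> (\<exists>J \<subseteq> E - E'. k' = cube_vertex H k J))"

definition cube_cat :: "'v wgraph \<Rightarrow> ('v \<Rightarrow> int) set \<Rightarrow> ('v cube, 'v cube \<times> 'v cube) cat" where
  "cube_cat H \<tt> = (let Q = {(k, E). k \<in> \<tt> \<and> E \<subseteq> verts H} in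
     \<lparr>Obj = Q, Arr = {(c, c'). c \<in> Q \<and> c' \<in> Q \<and> cube_face H c' c}, Dom = fst, Cod = snd,
      Ident = (\<lambda>c. (c, c)), Comp = (\<lambda>g f. (fst f, snd g))\<rparr>)"

definition hU_point :: "'v wgraph \<Rightarrow> ('v \<Rightarrow> int) \<Rightarrow> rat" where
  "hU_point H k = (square H k + of_nat (card (verts H))) / 4"

definition hU :: "'v wgraph \<Rightarrow> 'v cube \<Rightarrow> rat" where
  "hU H c = (case c of (k, E) \<Rightarrow> Min {hU_point H (cube_vertex H k I) | I. I \<subseteq> E})"

definition flip_cube :: "'v wgraph \<Rightarrow> 'v \<Rightarrow> 'v cube \<Rightarrow> 'v cube" where
  "flip_cube Gv0 v0 c = (case c of (k, E) \<Rightarrow> (act k (knot_class Gv0 v0), E))"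

definition hV :: "'v wgraph \<Rightarrow> 'v \<Rightarrow> 'v cube \<Rightarrow> rat" where
  "hV Gv0 v0 c = hU (remove_vertex Gv0 v0) (flip_cube Gv0 v0 c)"

definition point_diagram :: "('o \<Rightarrow> 'h) \<Rightarrow> ('o, 'm, unit, 'h) diagram" where
  "point_diagram h = \<lparr>Ob = (\<lambda>c. point (h c)), Mor = (\<lambda>_ _ x. x)\<rparr>"

type_synonym 'v lattice_simplex = "'v cube \<times> ('v cube \<times> 'v cube) list \<times> unit"

definition CF :: "'v wgraph \<Rightarrow> ('v \<Rightarrow> int) set \<Rightarrow> ('v lattice_simplex, rat) fsset" where
  "CF H \<tt> = hocolim (cube_cat H \<tt>) (point_diagram (hU H))"

definition induced :: "('v cube \<Rightarrow> 'v cube) \<Rightarrow> nat \<Rightarrow> 'v lattice_simplex \<Rightarrow> 'v lattice_simplex" where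
  "induced \<phi> n s = (case s of (c, fs, x) \<Rightarrow> (\<phi> c, map (map_prod \<phi> \<phi>) fs, x))"

text \<open>A family of doubly filtered simplicial sets \<open>X\<^sup>\<tt>\<close> together with flip maps
  \<open>p\<^sub>2 X\<^sup>\<tt> \<rightarrow> p\<^sub>1 X\<^bsup>\<tt> + [K]\<^esup>\<close>.\<close>

record ('t, 'a) knot_family =
  component :: "'t \<Rightarrow> ('a, rat \<times> rat) fsset"
  flip :: "'t \<Rightarrow> nat \<Rightarrow> 'a \<Rightarrow> 'a"

definition CFK :: "'v wgraph \<Rightarrow> 'v \<Rightarrow> (('v \<Rightarrow> int) set, 'v lattice_simplex) knot_family" where
  "CFK Gv0 v0 = (let G = remove_vertex Gv0 v0 in
     \<lparr>component = (\<lambda>\<tt>. hocolim (cube_cat G \<tt>) (point_diagram (\<lambda>c. (hU G c, hV Gv0 v0 c)))),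
      flip = (\<lambda>\<tt>. induced (flip_cube Gv0 v0))\<rparr>)"


section \<open>Surgery indexing\<close>

definition Sigma0 :: "'v wgraph \<Rightarrow> 'v \<Rightarrow> 'v \<Rightarrow> rat" where
  "Sigma0 Gv0 v0 = rat_lift (remove_vertex Gv0 v0) (knot_class Gv0 v0)"

definition Seifert_class :: "'v wgraph \<Rightarrow> 'v \<Rightarrow> 'v \<Rightarrow> rat" where
  "Seifert_class Gv0 v0 = (\<lambda>v. vertex v0 v - Sigma0 Gv0 v0 v)"

definition Seifert_framing :: "'v wgraph \<Rightarrow> 'v \<Rightarrow> int \<Rightarrow> rat" where
  "Seifert_framing Gv0 v0 n =
     form (set_weight Gv0 v0 n) (Seifert_class Gv0 v0) (Seifert_class Gv0 v0)"

definition Alex :: "'v wgraph \<Rightarrow> 'v \<Rightarrow> int \<Rightarrow> ('v \<Rightarrow> int) \<Rightarrow> rat" where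
  "Alex Gv0 v0 n L =
     (evaluate (set_weight Gv0 v0 n) L (Seifert_class Gv0 v0) + Seifert_framing Gv0 v0 n) / 2"

definition restrict_class :: "'v wgraph \<Rightarrow> ('v \<Rightarrow> int) \<Rightarrow> 'v \<Rightarrow> int" where
  "restrict_class G L = (\<lambda>v. if v \<in> verts G then L v else 0)"

definition surgery_pairs :: "'v wgraph \<Rightarrow> 'v \<Rightarrow> int \<Rightarrow> (('v \<Rightarrow> int) set \<times> rat) set" where
  "surgery_pairs Gv0 v0 n = {(\<tt>, i). \<tt> \<in> Spinc (remove_vertex Gv0 v0) \<and>
     (\<exists>L\<in>Char (set_weight Gv0 v0 n).
        restrict_class (remove_vertex Gv0 v0) L \<in> \<tt> \<and> Alex Gv0 v0 n L = i)}"

definition surgery_step :: "'v wgraph \<Rightarrow> 'v \<Rightarrow> int \<Rightarrow>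
    ((('v \<Rightarrow> int) set \<times> rat) \<times> (('v \<Rightarrow> int) set \<times> rat)) set" where
  "surgery_step Gv0 v0 n = {((\<tt>, i), (\<tt>', i')). (\<tt>, i) \<in> surgery_pairs Gv0 v0 n \<and>
     \<tt>' = add_knot Gv0 v0 \<tt> \<and> i' = i + Seifert_framing Gv0 v0 n}"

definition surgery_classes :: "'v wgraph \<Rightarrow> 'v \<Rightarrow> int \<Rightarrow> (('v \<Rightarrow> int) set \<times> rat) set set" where
  "surgery_classes Gv0 v0 n =
     surgery_pairs Gv0 v0 n // (surgery_step Gv0 v0 n \<union> (surgery_step Gv0 v0 n)\<inverse>)\<^sup>*"

text \<open>The orbit \<open>Char(G\<^sub>v\<^sub>0(n), [\<tt>, i])\<close> of characteristic classes belonging to a class \<open>[\<tt>, i]\<close>.\<close>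

definition surgery_Char ::
  "'v wgraph \<Rightarrow> 'v \<Rightarrow> int \<Rightarrow> (('v \<Rightarrow> int) set \<times> rat) set \<Rightarrow> ('v \<Rightarrow> int) set" where
  "surgery_Char Gv0 v0 n \<ss> = {L \<in> Char (set_weight Gv0 v0 n).
     \<exists>(\<tt>, i)\<in>\<ss>. restrict_class (remove_vertex Gv0 v0) L \<in> \<tt> \<and> Alex Gv0 v0 n L = i}"

datatype vertex_type = type_a | type_b

type_synonym 't index_obj = "'t \<times> rat \<times> vertex_type"

datatype 't index_arr = Identity "'t index_obj" | Lam 't rat | Rho 't rat

text \<open>In \<open>index_cat K r \<ss>\<close>, \<open>K\<close> is the operation \<open>\<tt> \<mapsto> \<tt> + [K]\<close>.  In any composite at least one of
  the two arrows is an identity.\<close>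

definition index_cat ::
  "('t \<Rightarrow> 't) \<Rightarrow> rat \<Rightarrow> ('t \<times> rat) set \<Rightarrow> ('t index_obj, 't index_arr) cat" where
  "index_cat K r \<ss> = (let Q = {(\<tt>, i, z). (\<tt>, i) \<in> \<ss>} in
     \<lparr>Obj = Q,
      Arr = Identity ` Q \<union> (\<lambda>(\<tt>, i). Lam \<tt> i) ` \<ss> \<union> (\<lambda>(\<tt>, i). Rho \<tt> i) ` \<ss>,
      Dom = (\<lambda>f. case f of Identity c \<Rightarrow> c | Lam \<tt> i \<Rightarrow> (\<tt>, i, type_a) | Rho \<tt> i \<Rightarrow> (\<tt>, i, type_a)),
      Cod = (\<lambda>f. case f of Identity c \<Rightarrow> c | Lam \<tt> i \<Rightarrow> (\<tt>, i, type_b) | Rho \<tt> i \<Rightarrow> (K \<tt>, i + r, type_b)),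
      Ident = Identity,
      Comp = (\<lambda>g f. case f of Identity c \<Rightarrow> g | _ \<Rightarrow> f)\<rparr>)"

definition surgery_cat :: "'v wgraph \<Rightarrow> 'v \<Rightarrow> int \<Rightarrow> (('v \<Rightarrow> int) set \<times> rat) set \<Rightarrow>
    (('v \<Rightarrow> int) set index_obj, ('v \<Rightarrow> int) set index_arr) cat" where
  "surgery_cat Gv0 v0 n \<ss> = index_cat (add_knot Gv0 v0) (Seifert_framing Gv0 v0 n) \<ss>"


section \<open>The diagrams TB and XD\<close>

definition TB :: "'v wgraph \<Rightarrow> 'v \<Rightarrow> int \<Rightarrow> (('v \<Rightarrow> int) set \<times> rat) set \<Rightarrow>
    (('v \<Rightarrow> int) set index_obj, ('v \<Rightarrow> int) set index_arr, 'v lattice_simplex, rat) diagram" where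
  "TB Gv0 v0 n \<ss> = (let H = set_weight Gv0 v0 n in
     \<lparr>Ob = (\<lambda>(\<tt>, i, z).
        hocolim
          (full_subcat (cube_cat H (surgery_Char Gv0 v0 n \<ss>))
             (\<lambda>(L, E). (case z of type_a \<Rightarrow> v0 \<in> E | type_b \<Rightarrow> v0 \<notin> E) \<and>
                restrict_class (remove_vertex Gv0 v0) L \<in> \<tt> \<and> Alex Gv0 v0 n L = i))
          (point_diagram (hU H))),
      Mor = (\<lambda>f. case f of
          Identity c \<Rightarrow> (\<lambda>m s. s)
        | Lam \<tt> i \<Rightarrow> induced (\<lambda>(L, E). (L, E - {v0}))
        | Rho \<tt> i \<Rightarrow> induced (\<lambda>(L, E). (act L (rel_class H (vertex v0)), E - {v0})))\<rparr>)"

definition gr :: "rat \<Rightarrow> rat \<Rightarrow> rat" where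
  "gr r i = ((2 * i - r)\<^sup>2 + r) / (4 * r)"

definition eta1 :: "nat \<Rightarrow> 'a \<Rightarrow> 'a" where
  "eta1 m x = x"

definition eta2 :: "nat \<Rightarrow> 'a \<Rightarrow> 'a" where
  "eta2 m x = x"

definition XD :: "rat \<Rightarrow> ('t, 'a) knot_family \<Rightarrow> ('t index_obj, 't index_arr, 'a, rat) diagram" where
  "XD r X =
     \<lparr>Ob = (\<lambda>(\<tt>, i, z). shift (gr r i)
        (case z of type_a \<Rightarrow> A_pull i (component X \<tt>) | type_b \<Rightarrow> p1 (component X \<tt>))),
      Mor = (\<lambda>f. case f of
          Identity c \<Rightarrow> (\<lambda>m s. s)
        | Lam \<tt> i \<Rightarrow> eta1
        | Rho \<tt> i \<Rightarrow> (\<lambda>m s. flip X \<tt> m (eta2 m s)))\<rparr>"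


section \<open>Consistency of the conventions\<close>

lemma solve_definite:
  fixes B :: "'v \<Rightarrow> 'v \<Rightarrow> rat"
  assumes "finite V"
    and "\<And>x. (\<forall>v. v \<notin> V \<longrightarrow> x v = 0) \<Longrightarrow> x \<noteq> (\<lambda>_. 0) \<Longrightarrow> (\<Sum>u\<in>V. \<Sum>v\<in>V. x u * B u v * x v) < 0"
  shows "\<exists>x. (\<forall>v. v \<notin> V \<longrightarrow> x v = 0) \<and> (\<forall>v\<in>V. (\<Sum>u\<in>V. x u * B u v) = s v)"
  using assms
proof (induction V arbitrary: s rule: finite_induct)
  case empty
  show ?case by (intro exI[of _ "\<lambda>_. 0"]) simp
next
  case (insert v V)
  have neg: "(\<Sum>u\<in>V. \<Sum>v\<in>V. x u * B u v * x v) < 0"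
    if "\<forall>v. v \<notin> V \<longrightarrow> x v = 0" "x \<noteq> (\<lambda>_. 0)" for x
    using insert.prems[of x] that insert.hyps by simp
  obtain y where y: "\<forall>w. w \<notin> V \<longrightarrow> y w = 0" "\<forall>w\<in>V. (\<Sum>u\<in>V. y u * B u w) = B v w"
    using insert.IH[OF neg, of "B v"] by blast
  obtain x0 where x0: "\<forall>w. w \<notin> V \<longrightarrow> x0 w = 0" "\<forall>w\<in>V. (\<Sum>u\<in>V. x0 u * B u w) = s w"
    using insert.IH[OF neg, of s] by blast
  define \<sigma> where "\<sigma> = (\<lambda>u. (if u = v then 1 else 0) - y u)"
  have \<sigma>v: "\<sigma> v = 1" using y(1) insert.hyps by (simp add: \<sigma>_def)
  have \<sigma>V: "\<sigma> u = - y u" if "u \<in> V" for u using that insert.hyps by (auto simp: \<sigma>_def)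
  have row: "(\<Sum>u\<in>insert v V. \<sigma> u * B u w) = B v w - (\<Sum>u\<in>V. y u * B u w)" for w
    using insert.hyps by (simp add: \<sigma>v \<sigma>V sum_negf cong: sum.cong)
  define t where "t = B v v - (\<Sum>u\<in>V. y u * B u v)"
  have "(\<Sum>u\<in>insert v V. \<Sum>w\<in>insert v V. \<sigma> u * B u w * \<sigma> w)
      = (\<Sum>w\<in>insert v V. (\<Sum>u\<in>insert v V. \<sigma> u * B u w) * \<sigma> w)"
    by (subst sum.swap) (simp add: sum_distrib_right)
  also have "\<dots> = t"
    unfolding row using insert.hyps y(2) \<sigma>v by (simp add: t_def)
  finally have tq: "(\<Sum>u\<in>insert v V. \<Sum>w\<in>insert v V. \<sigma> u * B u w * \<sigma> w) = t" .
  have "t < 0"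
    unfolding tq[symmetric]
  proof (rule insert.prems)
    show "\<forall>w. w \<notin> insert v V \<longrightarrow> \<sigma> w = 0" using y(1) by (auto simp: \<sigma>_def)
    show "\<sigma> \<noteq> (\<lambda>_. 0)" using \<sigma>v by (metis zero_neq_one)
  qed
  define c where "c = (s v - (\<Sum>u\<in>V. x0 u * B u v)) / t"
  define x where "x = (\<lambda>u. x0 u + c * \<sigma> u)"
  have x0v: "x0 v = 0" using x0(1) insert.hyps by blast
  have rx: "(\<Sum>u\<in>insert v V. x u * B u w)
      = (\<Sum>u\<in>V. x0 u * B u w) + c * (B v w - (\<Sum>u\<in>V. y u * B u w))" for w
  proof -
    have "(\<Sum>u\<in>insert v V. x u * B u w)
        = (\<Sum>u\<in>insert v V. x0 u * B u w) + c * (\<Sum>u\<in>insert v V. \<sigma> u * B u w)"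
      by (simp only: x_def distrib_right sum.distrib sum_distrib_left mult.assoc)
    then show ?thesis using row insert.hyps x0v by simp
  qed
  show ?case
  proof (intro exI[of _ x] conjI allI impI ballI)
    fix w assume "w \<notin> insert v V" then show "x w = 0"
      using x0(1) y(1) by (auto simp: x_def \<sigma>_def)
  next
    fix w assume w: "w \<in> insert v V"
    show "(\<Sum>u\<in>insert v V. x u * B u w) = s w"
    proof (cases "w = v")
      case True
      then show ?thesis unfolding rx using \<open>t < 0\<close> by (simp add: c_def t_def[symmetric])
    next
      case False
      then show ?thesis unfolding rx using w x0(2) y(2) by simp
    qed
  qed
qed

lemma inter_sym: "inter H u v = inter H v u"
  by (simp add: inter_def insert_commute)

lemma form_sym: "form H x y = form H y x"
  unfolding form_def
  by (subst sum.swap) (intro sum.cong refl, simp add: inter_sym mult_ac)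

lemma form_add: "form H (\<lambda>v. x v + y v) z = form H x z + form H y z"
  by (simp add: form_def distrib_right sum.distrib)

lemma form_diff: "form H (\<lambda>v. x v - y v) z = form H x z - form H y z"
  by (simp add: form_def left_diff_distrib sum_subtractf)

lemma form_scale: "form H (\<lambda>v. m * x v) z = m * form H x z"
  by (simp add: form_def sum_distrib_left mult.assoc)

lemma form_vertex:
  assumes "finite (verts H)" "v \<in> verts H"
  shows "form H x (vertex v) = (\<Sum>u\<in>verts H. x u * of_int (inter H u v))"
  using assms by (simp add: form_def vertex_def sum.delta if_distrib cong: if_cong)

lemma form_expand:
  assumes "finite (verts H)"
  shows "form H x y = (\<Sum>v\<in>verts H. form H x (vertex v) * y v)"
proof -
  have "form H x y = (\<Sum>v\<in>verts H. (\<Sum>u\<in>verts H. x u * of_int (inter H u v)) * y v)"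
    unfolding form_def by (subst sum.swap) (simp add: sum_distrib_right)
  then show ?thesis using assms by (simp add: form_vertex)
qed

lemma form_of_int: "form H (\<lambda>v. of_int (x v)) (\<lambda>v. of_int (y v)) = of_int (form H x y)"
  by (simp add: form_def)

lemma of_int_vertex: "(\<lambda>u. of_int (vertex v u)) = vertex v"
  by (auto simp: vertex_def)

lemma negative_definite_rat:
  fixes x :: "'v \<Rightarrow> rat"
  assumes fin: "finite (verts H)" and nd: "negative_definite H"
    and x: "x \<in> classes H" "x \<noteq> (\<lambda>_. 0)"
  shows "form H x x < 0"
proof -
  define d :: int where "d = (\<Prod>v\<in>verts H. snd (quotient_of (x v)))"
  have d: "d > 0" unfolding d_def by (intro prod_pos) (simp add: quotient_of_denom_pos')
  have "\<exists>m::int. of_int m = of_int d * x v" for v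
  proof (cases "v \<in> verts H")
    case True
    obtain p q where pq: "quotient_of (x v) = (p, q)" by (cases "quotient_of (x v)")
    have q: "q > 0" using quotient_of_denom_pos[OF pq] .
    have xv: "x v = of_int p / of_int q" using quotient_of_div[OF pq] .
    have "q dvd d" unfolding d_def using dvd_prodI[OF fin True, of "\<lambda>v. snd (quotient_of (x v))"] pq by simp
    then obtain e where "d = q * e" ..
    then have "of_int (e * p) = of_int d * x v" using xv q by simp
    then show ?thesis by blast
  next
    case False
    then have "x v = 0" using x(1) by (simp add: classes_def)
    then show ?thesis by (intro exI[of _ 0]) simp
  qed
  then obtain y :: "'v \<Rightarrow> int" where y: "\<And>v. of_int (y v) = of_int d * x v" by metis
  have "y \<in> classes H"
    unfolding classes_def
  proof (intro CollectI allI impI)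
    fix v assume "v \<notin> verts H"
    then have "x v = 0" using x(1) by (simp add: classes_def)
    then show "y v = 0" using y[of v] by simp
  qed
  moreover have "y \<noteq> (\<lambda>_. 0)"
  proof
    assume "y = (\<lambda>_. 0)"
    then have "x v = 0" for v using y[of v] d by simp
    then show False using x(2) by auto
  qed
  ultimately have "form H y y < 0" using nd by (simp add: negative_definite_def)
  then have "of_int (form H y y) < (0::rat)" by simp
  moreover have "of_int (form H y y) = of_int d * (of_int d * form H x x)"
    unfolding form_of_int[symmetric] y form_scale by (subst form_sym) (simp add: form_scale)
  ultimately show ?thesis using d by (simp add: mult_less_0_iff)
qed

lemma rat_lift:
  assumes fin: "finite (verts H)"
    and nd: "\<And>x::'v \<Rightarrow> rat. x \<in> classes H \<Longrightarrow> x \<noteq> (\<lambda>_. 0) \<Longrightarrow> form H x x < 0"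
  shows "rat_lift H S \<in> classes H"
    and "v \<in> verts H \<Longrightarrow> form H (rat_lift H S) (vertex v) = of_int (S v)"
proof -
  let ?P = "\<lambda>x::'v \<Rightarrow> rat. x \<in> classes H \<and> (\<forall>v\<in>verts H. form H x (vertex v) = of_int (S v))"
  have "\<exists>x. ?P x"
    using solve_definite[OF fin, of "\<lambda>u v. of_int (inter H u v)" "\<lambda>v. of_int (S v)"] nd
    by (simp add: classes_def form_def[symmetric] form_vertex[OF fin])
  moreover have "x = y" if x: "?P x" and y: "?P y" for x y
  proof (rule ccontr)
    define z where "z = (\<lambda>v. x v - y v)"
    assume "x \<noteq> y"
    then have "z \<noteq> (\<lambda>_. 0)" by (auto simp: z_def fun_eq_iff)
    moreover have "z \<in> classes H" using x y by (simp add: classes_def z_def)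
    moreover have "form H z z = 0"
      using x y by (subst form_expand[OF fin]) (simp add: z_def form_diff)
    ultimately show False using nd by fastforce
  qed
  ultimately have "\<exists>!x. ?P x" by (intro ex_ex1I) blast+
  from theI'[OF this] show "rat_lift H S \<in> classes H"
    and "v \<in> verts H \<Longrightarrow> form H (rat_lift H S) (vertex v) = of_int (S v)"
    unfolding rat_lift_def by blast+
qed

lemma orbit_equiv: "equiv (Char H) (orbit_rel H)"
proof (rule equivI)
  show "orbit_rel H \<subseteq> Char H \<times> Char H" by (auto simp: orbit_rel_def)
  show "refl_on (Char H) (orbit_rel H)"
  proof (rule refl_onI)
    fix k assume "k \<in> Char H"
    moreover have "k = act k (rel_class H (\<lambda>_. 0))" by (auto simp: act_def rel_class_def form_def)
    ultimately show "(k, k) \<in> orbit_rel H"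
      by (auto simp: orbit_rel_def classes_def intro!: exI[of _ "\<lambda>_. 0"])
  qed
  show "sym (orbit_rel H)"
  proof (rule symI)
    fix k k' assume "(k, k') \<in> orbit_rel H"
    then obtain x where x: "x \<in> classes H" "k' = act k (rel_class H x)" "k \<in> Char H" "k' \<in> Char H"
      by (auto simp: orbit_rel_def)
    have "k = act k' (rel_class H (\<lambda>v. -1 * x v))"
      unfolding x(2) act_def rel_class_def form_scale by auto
    moreover have "(\<lambda>v. -1 * x v) \<in> classes H" using x by (simp add: classes_def)
    ultimately show "(k', k) \<in> orbit_rel H" using x by (auto simp: orbit_rel_def)
  qed
  show "trans (orbit_rel H)"
  proof (rule transI)
    fix k k' k'' assume "(k, k') \<in> orbit_rel H" "(k', k'') \<in> orbit_rel H"
    then obtain x y where x: "x \<in> classes H" "k' = act k (rel_class H x)" "k \<in> Char H"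
      and y: "y \<in> classes H" "k'' = act k' (rel_class H y)" "k'' \<in> Char H"
      by (auto simp: orbit_rel_def)
    have "k'' = act k (rel_class H (\<lambda>v. x v + y v))"
      unfolding x(2) y(2) act_def rel_class_def form_add by auto
    moreover have "(\<lambda>v. x v + y v) \<in> classes H" using x y by (simp add: classes_def)
    ultimately show "(k, k'') \<in> orbit_rel H" using x y by (auto simp: orbit_rel_def)
  qed
qed

lemma orbit_sym: "(k, k') \<in> orbit_rel H \<Longrightarrow> (k', k) \<in> orbit_rel H"
  using equivE[OF orbit_equiv[of H]] by (blast dest: symD)

lemma orbit_trans: "(k, k') \<in> orbit_rel H \<Longrightarrow> (k', k'') \<in> orbit_rel H \<Longrightarrow> (k, k'') \<in> orbit_rel H"
  using equivE[OF orbit_equiv[of H]] by (blast dest: transD)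

lemma Char_act: "k \<in> Char H \<Longrightarrow> S \<in> classes H \<Longrightarrow> act k S \<in> Char H"
  unfolding Char_def
proof (intro CollectI conjI allI impI; elim CollectE conjE)
  assume "S \<in> classes H" "k \<in> classes H"
  then show "act k S \<in> classes H" by (simp add: classes_def act_def)
next
  fix x :: "'a \<Rightarrow> int"
  assume "\<forall>x::'a \<Rightarrow> int. x \<in> classes H \<longrightarrow> even (evaluate H k x - form H x x)" "x \<in> classes H"
  moreover have "evaluate H (act k S) x = evaluate H k x + 2 * evaluate H S x"
    by (simp add: evaluate_def act_def distrib_right sum.distrib sum_distrib_left mult.assoc)
  ultimately show "even (evaluate H (act k S) x - form H x x)" by simp
qed

lemma rel_class_classes: "rel_class H x \<in> classes H"
  by (simp add: classes_def rel_class_def)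

context
  fixes Gv0 :: "'v wgraph" and v0 :: 'v and n :: int
    and G H :: "'v wgraph" and r :: rat and \<Sigma> \<Sigma>0 :: "'v \<Rightarrow> rat"
  assumes fo: "forest Gv0" and uw: "only_unweighted_vertex Gv0 v0"
    and nd: "negative_definite (set_weight Gv0 v0 n)"
  defines "G \<equiv> remove_vertex Gv0 v0" and "H \<equiv> set_weight Gv0 v0 n"
    and "r \<equiv> Seifert_framing Gv0 v0 n" and "\<Sigma> \<equiv> Seifert_class Gv0 v0" and "\<Sigma>0 \<equiv> Sigma0 Gv0 v0"
begin

private lemma vH: "verts H = insert v0 (verts G)" and v0G: "v0 \<notin> verts G"
  using uw by (auto simp: H_def G_def set_weight_def remove_vertex_def only_unweighted_vertex_def)

private lemma finG: "finite (verts G)" and finH: "finite (verts H)"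
  using fo by (auto simp: H_def G_def set_weight_def remove_vertex_def forest_def)

private lemma inter_G: "u \<in> verts G \<Longrightarrow> v \<in> verts G \<Longrightarrow> inter H u v = inter G u v"
  by (auto simp: inter_def H_def G_def set_weight_def remove_vertex_def)

private lemma inter_v0: "v \<in> verts G \<Longrightarrow> inter H v0 v = knot_class Gv0 v0 v"
  by (auto simp: inter_def H_def G_def set_weight_def remove_vertex_def knot_class_def)

private lemma inter_v0v0: "inter H v0 v0 = n"
  by (simp add: inter_def H_def set_weight_def)

private lemma classes_GH: "x \<in> classes G \<Longrightarrow> x \<in> classes H"
  by (auto simp: classes_def vH)

private lemma v0_H: "(vertex v0 :: 'v \<Rightarrow> 'a::zero_neq_one) \<in> classes H"
  by (simp add: classes_def vH vertex_def)

private lemma form_GH: "x \<in> classes G \<Longrightarrow> y \<in> classes G \<Longrightarrow> form H x y = form G x y"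
  using v0G by (simp add: form_def vH finG classes_def inter_G cong: sum.cong)

private lemma form_GH_vertex: "x \<in> classes G \<Longrightarrow> v \<in> verts G \<Longrightarrow> form H x (vertex v) = form G x (vertex v)"
  using v0G by (intro form_GH) (auto simp: classes_def vertex_def)

private lemma form_v0: "form H (vertex v0) (vertex v) = of_int (if v = v0 then n else knot_class Gv0 v0 v)"
  if "v \<in> verts H"
proof -
  have "form H (vertex v0) (vertex v) = (form H (vertex v) (vertex v0) :: 'a)" by (rule form_sym)
  also have "\<dots> = of_int (inter H v v0)"
    unfolding form_vertex[OF finH, of v0, unfolded vH, simplified]
    using that finG by (simp add: vertex_def vH if_distrib[of "\<lambda>x. x * _"] sum.delta' cong: if_cong)
  finally show ?thesis using that inter_v0[of v] inter_v0v0 by (auto simp: vH inter_sym)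
qed

private lemma lift: "\<Sigma>0 \<in> classes G" "v \<in> verts G \<Longrightarrow> form G \<Sigma>0 (vertex v) = of_int (knot_class Gv0 v0 v)"
proof -
  have "form G x x < 0" if "x \<in> classes G" "x \<noteq> (\<lambda>_. 0)" for x :: "'v \<Rightarrow> rat"
    using negative_definite_rat[OF finH nd[folded H_def], of x] that
      form_GH[OF that(1) that(1)] classes_GH[OF that(1)] by simp
  from rat_lift[OF finG this, where S = "knot_class Gv0 v0"]
  show "\<Sigma>0 \<in> classes G" "v \<in> verts G \<Longrightarrow> form G \<Sigma>0 (vertex v) = of_int (knot_class Gv0 v0 v)"
    by (simp_all add: \<Sigma>0_def Sigma0_def G_def[symmetric])
qed

private lemma \<Sigma>_alt: "\<Sigma> = (\<lambda>v. vertex v0 v - \<Sigma>0 v)"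
  by (simp add: \<Sigma>_def Seifert_class_def \<Sigma>0_def)

private lemma \<Sigma>_H: "\<Sigma> \<in> classes H"
  using lift(1) by (auto simp: \<Sigma>_alt classes_def vertex_def vH)

private lemma \<Sigma>_v0: "\<Sigma> v0 = 1"
  using lift(1) v0G by (simp add: \<Sigma>_alt classes_def vertex_def)

private lemma \<Sigma>_G: "v \<in> verts G \<Longrightarrow> form H \<Sigma> (vertex v) = 0"
  using v0G by (auto simp: \<Sigma>_alt form_diff form_v0 vH form_GH_vertex lift)

private lemma r_alt: "r = form H \<Sigma> \<Sigma>"
  by (simp add: r_def Seifert_framing_def \<Sigma>_def H_def)

private lemma form_\<Sigma>: "form H \<Sigma> x = r * x v0"
proof -
  have *: "form H \<Sigma> x = form H \<Sigma> (vertex v0) * x v0" for x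
    using v0G by (subst form_expand[OF finH]) (simp add: vH finG \<Sigma>_G)
  have "r = form H \<Sigma> (vertex v0)" unfolding r_alt by (subst *) (simp add: \<Sigma>_v0)
  with *[of x] show ?thesis by simp
qed

lemma Seifert_framing_eq:
  "Seifert_framing Gv0 v0 n
    = of_int n - form (remove_vertex Gv0 v0) (Sigma0 Gv0 v0) (Sigma0 Gv0 v0)"
proof -
  have "r = form H \<Sigma> (vertex v0)" unfolding form_\<Sigma> by (simp add: vertex_def)
  also have "\<dots> = of_int n - form H \<Sigma>0 (vertex v0)"
    by (simp add: \<Sigma>_alt form_diff form_v0 vH)
  also have "form H \<Sigma>0 (vertex v0) = form H (vertex v0) \<Sigma>0" by (rule form_sym)
  also have "\<dots> = (\<Sum>v\<in>verts G. form G \<Sigma>0 (vertex v) * \<Sigma>0 v)"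
    using v0G lift by (subst form_expand[OF finH])
      (simp add: vH finG classes_def form_v0, intro sum.cong, auto simp: form_v0 vH)
  also have "\<dots> = form G \<Sigma>0 \<Sigma>0" by (rule form_expand[OF finG, symmetric])
  finally show ?thesis by (simp add: r_def G_def \<Sigma>0_def)
qed

lemma Seifert_framing_neg: "Seifert_framing Gv0 v0 n < 0"
  using negative_definite_rat[OF finH nd[folded H_def] \<Sigma>_H] \<Sigma>_v0 r_alt
  by (metis r_def zero_neq_one)

private definition res where "res = restrict_class G"
private definition alex where "alex = Alex Gv0 v0 n"
private definition pr where "pr L = (orbit_rel G `` {res L}, alex L)"
private definition R where "R = (surgery_step Gv0 v0 n \<union> (surgery_step Gv0 v0 n)\<inverse>)\<^sup>*"

private lemma res_Char: "L \<in> Char H \<Longrightarrow> res L \<in> Char G"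
proof -
  assume L: "L \<in> Char H"
  have ev: "evaluate G (res L) x = evaluate H L x" if "x \<in> classes G" for x :: "'v \<Rightarrow> int"
    using that v0G by (simp add: evaluate_def vH finG classes_def res_def restrict_class_def)
  have "even (evaluate G (res L) x - form G x x)" if "x \<in> classes G" for x :: "'v \<Rightarrow> int"
    using L ev[OF that] form_GH[OF that that] classes_GH[OF that] by (simp add: Char_def)
  then show ?thesis by (simp add: Char_def classes_def res_def restrict_class_def)
qed

private lemma alex_act: "alex (act L (rel_class H x)) = alex L + r * of_int (x v0)"
proof -
  have of_int_form: "of_int (form H x (vertex v)) = form H (\<lambda>v. of_int (x v)) (vertex v :: 'v \<Rightarrow> rat)" for v
    unfolding form_of_int[symmetric] of_int_vertex ..
  have "evaluate H (act L (rel_class H x)) \<Sigma>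
      = evaluate H L \<Sigma> + 2 * (\<Sum>v\<in>verts H. form H (\<lambda>v. of_int (x v)) (vertex v) * \<Sigma> v)"
    by (simp add: evaluate_def act_def rel_class_def distrib_right sum.distrib sum_distrib_left
        mult.assoc of_int_form)
  also have "\<dots> = evaluate H L \<Sigma> + 2 * form H \<Sigma> (\<lambda>v. of_int (x v))"
    by (subst (2) form_sym) (simp add: form_expand[OF finH, symmetric])
  finally show ?thesis
    by (simp add: alex_def Alex_def H_def[symmetric] \<Sigma>_def[symmetric] form_\<Sigma> r_def[symmetric] field_simps)
qed

private lemma res_act_G: "x \<in> classes G \<Longrightarrow> res (act L (rel_class H x)) = act (res L) (rel_class G x)"
  by (auto simp: res_def restrict_class_def act_def rel_class_def form_GH_vertex vH)

private lemma res_act_v0: "res (act L (rel_class H (vertex v0))) = act (res L) (knot_class Gv0 v0)"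
proof -
  have "knot_class Gv0 v0 v = 0" if "v \<notin> verts G" for v
    using that by (simp add: knot_class_def G_def remove_vertex_def)
  then show ?thesis
    using v0G by (auto simp: res_def restrict_class_def act_def rel_class_def form_v0 vH)
qed

private lemma knot_G: "knot_class Gv0 v0 \<in> classes G"
  by (simp add: classes_def knot_class_def G_def remove_vertex_def)

private lemma orbit_act:
  assumes "k \<in> Char G"
  shows "add_knot Gv0 v0 (orbit_rel G `` {k}) = orbit_rel G `` {act k (knot_class Gv0 v0)}"
proof -
  let ?K = "knot_class Gv0 v0"
  have comm: "act (act k S) T = act (act k T) S" for k S T :: "'v \<Rightarrow> int"
    by (simp add: act_def algebra_simps)
  show ?thesis
  proof (intro set_eqI iffI)
    fix l assume "l \<in> add_knot Gv0 v0 (orbit_rel G `` {k})"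
    then obtain k' x where "l = act k' ?K" "k' = act k (rel_class G x)" "x \<in> classes G" "k' \<in> Char G"
      by (auto simp: add_knot_def orbit_rel_def)
    then show "l \<in> orbit_rel G `` {act k ?K}"
      using assms knot_G comm[of k] by (auto simp: orbit_rel_def intro!: Char_act rel_class_classes bexI[of _ x])
  next
    fix l assume "l \<in> orbit_rel G `` {act k ?K}"
    then obtain x where x: "l = act (act k ?K) (rel_class G x)" "x \<in> classes G"
      by (auto simp: orbit_rel_def)
    then have "l = act (act k (rel_class G x)) ?K" using comm by metis
    moreover have "act k (rel_class G x) \<in> orbit_rel G `` {k}"
      using x assms by (auto simp: orbit_rel_def intro: Char_act rel_class_classes)
    ultimately show "l \<in> add_knot Gv0 v0 (orbit_rel G `` {k})" by (auto simp: add_knot_def)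
  qed
qed

private lemma pr_v0:
  "L \<in> Char H \<Longrightarrow> pr (act L (rel_class H (vertex v0))) = (add_knot Gv0 v0 (fst (pr L)), snd (pr L) + r)"
  by (simp add: pr_def res_act_v0 alex_act orbit_act res_Char) (simp add: vertex_def)

private lemma pairs_iff:
  "p \<in> surgery_pairs Gv0 v0 n \<longleftrightarrow> (\<exists>L\<in>Char H. p = pr L)"
proof -
  have *: "\<tt> = orbit_rel G `` {k}" if "\<tt> \<in> Spinc G" "k \<in> \<tt>" for \<tt> k
    using that orbit_equiv[of G] unfolding Spinc_def
    by (metis Image_singleton_iff equiv_class_eq quotientE)
  show ?thesis
  proof
    assume "p \<in> surgery_pairs Gv0 v0 n"
    then show "\<exists>L\<in>Char H. p = pr L"
      using * by (auto simp: surgery_pairs_def pr_def H_def G_def res_def alex_def)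
  next
    assume "\<exists>L\<in>Char H. p = pr L"
    then obtain L where L: "L \<in> Char H" "p = pr L" by blast
    have "fst p \<in> Spinc G" "res L \<in> fst p"
      using res_Char[OF L(1)] equiv_class_self[OF orbit_equiv] by (auto simp: L pr_def Spinc_def quotientI)
    then show "p \<in> surgery_pairs Gv0 v0 n"
      using L by (auto simp: surgery_pairs_def pr_def H_def G_def res_def alex_def)
  qed
qed

private lemma pr_eq:
  assumes "L \<in> Char H" "L' \<in> Char H" "pr L = pr L'"
  shows "(L, L') \<in> orbit_rel H"
proof -
  have "(res L, res L') \<in> orbit_rel G"
    using assms(3) eq_equiv_class_iff[OF orbit_equiv res_Char[OF assms(1)] res_Char[OF assms(2)]]
    by (simp add: pr_def)
  then obtain x where x: "x \<in> classes G" "res L' = act (res L) (rel_class G x)"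
    by (auto simp: orbit_rel_def)
  define M where "M = act L (rel_class H x)"
  have M: "M \<in> Char H" "res M = res L'" "alex M = alex L'"
    using x assms v0G by (auto simp: M_def res_act_G alex_act pr_def classes_def
        intro: Char_act rel_class_classes)
  have eq: "M v = L' v" if "v \<noteq> v0" for v
  proof (cases "v \<in> verts G")
    case True
    then show ?thesis using fun_cong[OF M(2), of v] by (simp add: res_def restrict_class_def)
  next
    case False
    then show ?thesis using that M(1) assms(2) by (simp add: Char_def classes_def vH)
  qed
  have "evaluate H M \<Sigma> = evaluate H L' \<Sigma>"
    using M(3) by (simp add: alex_def Alex_def H_def \<Sigma>_def)
  moreover have "(\<Sum>v\<in>verts G. of_int (M v) * \<Sigma> v) = (\<Sum>v\<in>verts G. of_int (L' v) * \<Sigma> v)"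
    using eq v0G by (intro sum.cong refl) (metis)
  ultimately have "M v0 = L' v0" using v0G by (simp add: evaluate_def vH finG \<Sigma>_v0)
  with eq have "M = L'" by (metis ext)
  then show ?thesis using x(1) assms classes_GH by (auto simp: orbit_rel_def M_def)
qed

private lemma R_sym: "(p, q) \<in> R \<Longrightarrow> (q, p) \<in> R"
  unfolding R_def by (metis converse_Un converse_converse rtrancl_converseD sup_commute)

private lemma R_trans: "(p, q) \<in> R \<Longrightarrow> (q, s) \<in> R \<Longrightarrow> (p, s) \<in> R"
  unfolding R_def by (rule rtrancl_trans)

private lemma step_v0:
  assumes "L \<in> Char H"
  shows "(pr L, pr (act L (rel_class H (vertex v0)))) \<in> surgery_step Gv0 v0 n"
  using assms pairs_iff[of "pr L"]
  by (auto simp: pr_v0 surgery_step_def r_def split: prod.splits)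

private lemma step_act:
  assumes "L \<in> Char H"
  shows "(pr L, pr (act L (\<lambda>v. int m * rel_class H (vertex v0) v))) \<in> R"
proof (induction m)
  case 0
  then show ?case by (simp add: R_def act_def)
next
  case (Suc m)
  let ?L = "act L (\<lambda>v. int m * rel_class H (vertex v0) v)"
  have "?L \<in> Char H" using assms by (rule Char_act) (simp add: classes_def rel_class_def)
  moreover have "act L (\<lambda>v. int (Suc m) * rel_class H (vertex v0) v) = act ?L (rel_class H (vertex v0))"
    by (simp add: act_def algebra_simps)
  ultimately show ?case using Suc step_v0[of ?L] unfolding R_def
    by (metis UnI1 rtrancl.rtrancl_into_rtrancl)
qed

private lemma orbit_imp_R:
  assumes "(L, L') \<in> orbit_rel H"
  shows "(pr L, pr L') \<in> R"
proof -
  obtain x where L: "L \<in> Char H" "L' \<in> Char H" and x: "x \<in> classes H" "L' = act L (rel_class H x)"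
    using assms by (auto simp: orbit_rel_def)
  define m where "m = x v0"
  define y where "y = (\<lambda>v. x v - m * vertex v0 v)"
  have y: "y \<in> classes G" using x(1) by (auto simp: y_def m_def classes_def vertex_def vH)
  define M where "M = act L (rel_class H y)"
  have M: "M \<in> Char H" unfolding M_def using L(1) rel_class_classes by (rule Char_act)
  have "(res L, res M) \<in> orbit_rel G"
    using y res_Char[OF L(1)] res_Char[OF M] by (auto simp: orbit_rel_def M_def res_act_G[OF y])
  then have prM: "pr L = pr M"
    using equiv_class_eq[OF orbit_equiv] y v0G by (auto simp: pr_def M_def alex_act classes_def)
  have form_x: "form H x z = form H y z + m * form H (vertex v0) z" for z
    by (simp add: y_def form_diff form_scale)
  have L_M: "L' = act M (\<lambda>v. m * rel_class H (vertex v0) v)"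
    by (auto simp: x(2) M_def act_def rel_class_def form_x algebra_simps)
  have "(pr M, pr L') \<in> R"
  proof (cases "m \<ge> 0")
    case True
    then show ?thesis using step_act[OF M, of "nat m"] by (simp add: L_M)
  next
    case False
    have "M = act L' (\<lambda>v. int (nat (- m)) * rel_class H (vertex v0) v)"
      using False by (simp add: L_M act_def)
    then show ?thesis using step_act[OF L(2), of "nat (- m)"] R_sym by simp
  qed
  then show ?thesis using prM by simp
qed

private lemma R_imp_orbit:
  assumes "(p, q) \<in> R" "p = pr L" "L \<in> Char H"
  shows "\<exists>L'. (L, L') \<in> orbit_rel H \<and> q = pr L'"
  using assms(1) unfolding R_def
proof (induction rule: rtrancl_induct)
  case base
  then show ?case using assms equiv_class_self[OF orbit_equiv, of L H] by blast
next
  case (step q q')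
  obtain M where M: "(L, M) \<in> orbit_rel H" "q = pr M" using step.IH by blast
  have MC: "M \<in> Char H" using M(1) by (simp add: orbit_rel_def)
  have v: "(N, act N (rel_class H (vertex v0))) \<in> orbit_rel H" if "N \<in> Char H" for N
    using that v0_H Char_act[OF that rel_class_classes] by (auto simp: orbit_rel_def)
  show ?case
  proof (cases "(q, q') \<in> surgery_step Gv0 v0 n")
    case True
    then have "q' = pr (act M (rel_class H (vertex v0)))"
      using M(2) MC by (auto simp: surgery_step_def pr_v0 r_def prod_eq_iff)
    then show ?thesis using orbit_trans[OF M(1) v[OF MC]] by blast
  next
    case False
    then have st: "(q', q) \<in> surgery_step Gv0 v0 n" using step.hyps by simp
    then have "q' \<in> surgery_pairs Gv0 v0 n" by (auto simp: surgery_step_def)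
    then obtain N where N: "N \<in> Char H" "q' = pr N" using pairs_iff by blast
    let ?N = "act N (rel_class H (vertex v0))"
    have "pr ?N = pr M" using st N M(2) by (auto simp: surgery_step_def pr_v0 r_def prod_eq_iff)
    then have "(?N, M) \<in> orbit_rel H"
      using N(1) MC by (intro pr_eq) (auto intro: Char_act rel_class_classes)
    then have "(L, N) \<in> orbit_rel H"
      using M(1) v[OF N(1)] by (blast intro: orbit_trans orbit_sym)
    then show ?thesis using N(2) by blast
  qed
qed

private lemma surgery_Char_iff:
  "M \<in> surgery_Char Gv0 v0 n \<ss> \<longleftrightarrow> M \<in> Char H \<and> (\<exists>\<tt> i. (\<tt>, i) \<in> \<ss> \<and> res M \<in> \<tt> \<and> alex M = i)"
  unfolding surgery_Char_def H_def G_def res_def alex_def by auto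

text \<open>The identification of \<open>Spin\<^sup>c(Y\<^bsub>G\<^sub>v\<^sub>0(n)\<^esub>)\<close> with the set of classes \<open>[\<tt>, i]\<close>.\<close>

lemma bij_surgery_classes_Spinc:
  "bij_betw (surgery_Char Gv0 v0 n) (surgery_classes Gv0 v0 n) (Spinc (set_weight Gv0 v0 n))"
proof -
  have Rpr: "(pr L, pr L') \<in> R \<longleftrightarrow> (L, L') \<in> orbit_rel H" if "L \<in> Char H" "L' \<in> Char H" for L L'
  proof
    assume "(pr L, pr L') \<in> R"
    from R_imp_orbit[OF this refl that(1)]
    obtain M where M: "(L, M) \<in> orbit_rel H" "pr L' = pr M" by blast
    then have "M \<in> Char H" by (simp add: orbit_rel_def)
    then have "(M, L') \<in> orbit_rel H" using that(2) M(2) by (intro pr_eq) simp_all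
    with M(1) show "(L, L') \<in> orbit_rel H" by (rule orbit_trans)
  qed (rule orbit_imp_R)
  have SC: "surgery_Char Gv0 v0 n (R `` {pr L}) = orbit_rel H `` {L}" if L: "L \<in> Char H" for L
  proof (intro set_eqI iffI)
    fix M assume "M \<in> surgery_Char Gv0 v0 n (R `` {pr L})"
    then obtain \<tt> i where M: "M \<in> Char H" "(pr L, (\<tt>, i)) \<in> R" "res M \<in> \<tt>" "alex M = i"
      unfolding surgery_Char_iff by auto
    obtain N where N: "(L, N) \<in> orbit_rel H" "(\<tt>, i) = pr N"
      using R_imp_orbit[OF M(2) refl L] by blast
    have \<tt>: "\<tt> = orbit_rel G `` {res N}" using N(2) by (simp add: pr_def)
    then have "(res N, res M) \<in> orbit_rel G" using M(3) by simp
    then have "\<tt> = orbit_rel G `` {res M}"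
      unfolding \<tt> by (rule equiv_class_eq[OF orbit_equiv])
    then have "pr M = (\<tt>, i)" using M(4) by (simp add: pr_def)
    then have "(pr L, pr M) \<in> R" using M(2) by simp
    then have "(L, M) \<in> orbit_rel H" using Rpr[OF L M(1)] by blast
    then show "M \<in> orbit_rel H `` {L}" by simp
  next
    fix M assume "M \<in> orbit_rel H `` {L}"
    then have M: "(L, M) \<in> orbit_rel H" "M \<in> Char H" by (auto simp: orbit_rel_def)
    then have "(pr L, pr M) \<in> R" using Rpr[OF L M(2)] by blast
    then have "pr M \<in> R `` {pr L}" by simp
    then have "(orbit_rel G `` {res M}, alex M) \<in> R `` {pr L}" by (simp only: pr_def)
    moreover have "res M \<in> orbit_rel G `` {res M}"
      using orbit_equiv res_Char[OF M(2)] by (rule equiv_class_self)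
    ultimately show "M \<in> surgery_Char Gv0 v0 n (R `` {pr L})"
      unfolding surgery_Char_iff using M(2) by blast
  qed
  have cl: "surgery_classes Gv0 v0 n = (\<lambda>L. R `` {pr L}) ` Char H"
  proof -
    have "surgery_pairs Gv0 v0 n = pr ` Char H" using pairs_iff by blast
    then show ?thesis by (auto simp: surgery_classes_def R_def[symmetric] quotient_def)
  qed
  have sp: "Spinc H = (\<lambda>L. orbit_rel H `` {L}) ` Char H"
    unfolding Spinc_def quotient_def by blast
  show ?thesis
    unfolding H_def[symmetric]
  proof (rule bij_betw_imageI)
    show "surgery_Char Gv0 v0 n ` surgery_classes Gv0 v0 n = Spinc H"
      unfolding cl sp image_image by (rule image_cong[OF refl SC])
    show "inj_on (surgery_Char Gv0 v0 n) (surgery_classes Gv0 v0 n)"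
      unfolding cl
    proof (rule inj_onI, elim imageE, hypsubst)
      fix L M assume LM: "L \<in> Char H" "M \<in> Char H"
        and "surgery_Char Gv0 v0 n (R `` {pr L}) = surgery_Char Gv0 v0 n (R `` {pr M})"
      then have "(L, M) \<in> orbit_rel H"
        unfolding SC[OF LM(1)] SC[OF LM(2)] eq_equiv_class_iff[OF orbit_equiv LM] by blast
      then have "(pr L, pr M) \<in> R" using Rpr[OF LM] by blast
      then show "R `` {pr L} = R `` {pr M}"
        using R_sym R_trans by blast
    qed
  qed
qed

end

end

theory Submission
  imports Defs
begin

text \<open>
  Rationally, \<open>H\<^sub>2(X\<^bsub>G(n)\<^esub>)\<close> is the orthogonal sum of \<open>H\<^sub>2(X\<^sub>G)\<close> and the line spanned by \<open>\<Sigma>\<close>, so that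
  \<open>L\<^sup>2 = (L|\<^sub>G)\<^sup>2 + L(\<Sigma>)\<^sup>2 / r\<close> and the height of \<open>L\<close> exceeds that of \<open>L|\<^sub>G\<close> by \<open>gr\<^sub>r(alex L)\<close>, where
  \<open>alex L\<close> is the index \<open>(L(\<Sigma>) + r) / 2\<close>.
  A characteristic class \<open>L\<close> is determined by \<open>L|\<^sub>G\<close> and \<open>alex L\<close>.  Hence \<open>[L, E] \<mapsto> [L|\<^sub>G, E - {v\<^sub>0}]\<close>
  identifies the categories of cubes that underlie both diagrams; a cube with \<open>v\<^sub>0 \<in> E\<close> has the minimum
  of the heights of its two faces transverse to \<open>v\<^sub>0\<close>, which is the height on \<open>A\<^sub>i\<^sup>*\<close>.

  For the homotopy colimit, the maps \<open>\<lambda>\<close> and \<open>\<rho>\<close> are induced by isomorphisms of categories of cubes.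
  Every chain of cubes of \<open>G(n)\<close> therefore arises from a unique chain of index arrows and a unique
  chain of cubes over the first index, by pushing each cube forward along the arrows up to its
  position.  This makes the comparison map a bijection on simplices, and not just a weak equivalence.
\<close>

text \<open>Since \<open>filtered_iso\<close> requires both ends to be filtered simplicial sets, the
  simplicial identities of \<open>hocolim\<close> must be proved; this is done once, for every
  filtered diagram. Cubes form a thin category and each carries a single point, so a simplex over
  them is just a chain of cubes, and maps and isomorphisms of the homotopy colimits come from maps
  of cubes. Uniqueness in the comparison of iterated homotopy colimits depends on the sign of r. The
  arrows \<lambda> and \<rho> out of one object end at the indices i and i + r, which differ because
  r < 0; so an index arrow is determined by its ends and can be read off from the cubes. Existence
  depends on transport being invertible on fibers: the later part of a chain of cubes can then be
  pulled back to the first fiber. The heights match across the flip because gr(i + r) - gr(i) = 2i,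
  which is exactly the shift built into \<open>A_pull\<close> and \<eta>_2.\<close>

section \<open>Homotopy colimits of filtered diagrams\<close>

text \<open>Recursive forms of the list operations in \<open>hocolim\<close>.  For \<open>i = 0\<close>, \<open>nface\<close> gives only the list of
  arrows; the change of the first object is not recorded.\<close>

fun nface :: "('o, 'm) cat \<Rightarrow> nat \<Rightarrow> 'm list \<Rightarrow> 'm list" where
  "nface C (Suc 0) (f # g # fs) = Comp C g f # fs"
| "nface C (Suc (Suc i)) (f # fs) = f # nface C (Suc i) fs"
| "nface C _ fs = tl fs"

fun ndegen :: "('o, 'm) cat \<Rightarrow> 'o \<Rightarrow> nat \<Rightarrow> 'm list \<Rightarrow> 'm list" where
  "ndegen C c 0 fs = Ident C c # fs"
| "ndegen C c (Suc i) (f # fs) = f # ndegen C (Cod C f) i fs"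
| "ndegen C c (Suc i) [] = []"

lemma nface_eq:
  "1 \<le> i \<Longrightarrow> i \<le> length fs \<Longrightarrow> nface C i fs = (if i = length fs then butlast fs
     else take (i - 1) fs @ [Comp C (fs ! i) (fs ! (i - 1))] @ drop (Suc i) fs)"
proof (induction C i fs rule: nface.induct)
  case (2 C i f fs)
  then show ?case by (cases fs) auto
qed auto

lemma ndegen_eq:
  "i \<le> length fs \<Longrightarrow>
    ndegen C c i fs = take i fs @ [Ident C ((c # map (Cod C) fs) ! i)] @ drop i fs"
  by (induction C c i fs rule: ndegen.induct) auto

lemma length_nface: "i \<le> length fs \<Longrightarrow> length (nface C i fs) = length fs - 1"
proof (induction C i fs rule: nface.induct)
  case (2 C i f fs)
  then show ?case by (cases fs) auto
qed auto

lemma length_ndegen: "i \<le> length fs \<Longrightarrow> length (ndegen C c i fs) = Suc (length fs)"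
  by (induction C c i fs rule: ndegen.induct) auto

lemma categoryD:
  assumes "category C"
  shows "f \<in> Arr C \<Longrightarrow> Dom C f \<in> Obj C" "f \<in> Arr C \<Longrightarrow> Cod C f \<in> Obj C"
    and "c \<in> Obj C \<Longrightarrow> Ident C c \<in> Arr C"
    and "c \<in> Obj C \<Longrightarrow> Dom C (Ident C c) = c" "c \<in> Obj C \<Longrightarrow> Cod C (Ident C c) = c"
    and "f \<in> Arr C \<Longrightarrow> g \<in> Arr C \<Longrightarrow> Cod C f = Dom C g \<Longrightarrow> Comp C g f \<in> Arr C"
    and "f \<in> Arr C \<Longrightarrow> g \<in> Arr C \<Longrightarrow> Cod C f = Dom C g \<Longrightarrow> Dom C (Comp C g f) = Dom C f"
    and "f \<in> Arr C \<Longrightarrow> g \<in> Arr C \<Longrightarrow> Cod C f = Dom C g \<Longrightarrow> Cod C (Comp C g f) = Cod C g"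
    and "f \<in> Arr C \<Longrightarrow> Comp C f (Ident C (Dom C f)) = f"
    and "f \<in> Arr C \<Longrightarrow> Comp C (Ident C (Cod C f)) f = f"
    and "f \<in> Arr C \<Longrightarrow> g \<in> Arr C \<Longrightarrow> h \<in> Arr C \<Longrightarrow> Cod C f = Dom C g \<Longrightarrow> Cod C g = Dom C h \<Longrightarrow>
      Comp C h (Comp C g f) = Comp C (Comp C h g) f"
  using assms unfolding category_def by blast+

lemma composable_Obj: "category C \<Longrightarrow> composable C c fs \<Longrightarrow> c \<in> Obj C"
  by (cases fs) (auto intro: categoryD(1))

lemma composable_nface:
  assumes "category C"
  shows "composable C c fs \<Longrightarrow> Suc i \<le> length fs \<Longrightarrow> composable C c (nface C (Suc i) fs)"
proof (induction i arbitrary: c fs)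
  case 0
  then obtain f gs where fs: "fs = f # gs" by (cases fs) auto
  show ?case
    using 0 assms by (cases gs) (auto simp: fs categoryD)
next
  case (Suc i)
  then show ?case by (cases fs) auto
qed

lemma composable_ndegen:
  assumes "category C"
  shows "composable C c fs \<Longrightarrow> i \<le> length fs \<Longrightarrow> composable C c (ndegen C c i fs)"
proof (induction i arbitrary: c fs)
  case 0
  then show ?case using composable_Obj[OF assms] categoryD[OF assms] by simp
next
  case (Suc i)
  then show ?case by (cases fs) auto
qed

text \<open>Associativity is needed only for \<open>i = j\<close>, where both sides merge the same
  three consecutive arrows; for \<open>i < j\<close> the two operations touch disjoint places of the
  list.\<close>

lemma nface_nface:
  assumes "category C"
  shows "composable C c fs \<Longrightarrow> Suc (Suc j) \<le> length fs \<Longrightarrow> i \<le> j \<Longrightarrow>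
    nface C (Suc i) (nface C (Suc (Suc j)) fs) = nface C (Suc j) (nface C (Suc i) fs)"
proof (induction j arbitrary: c fs i)
  case 0
  then obtain f g gs where fs: "fs = f # g # gs" by (metis Suc_le_length_iff numeral_nat(7))
  show ?case using 0 categoryD(11)[OF assms] by (cases gs) (auto simp: fs)
next
  case (Suc j)
  then obtain f g gs where fs: "fs = f # g # gs" by (metis Suc_le_length_iff)
  show ?case
  proof (cases i)
    case 0
    then show ?thesis using Suc.prems by (cases gs) (auto simp: fs)
  next
    case (Suc i')
    then show ?thesis using Suc.IH[of "Cod C f" "g # gs" i'] Suc.prems by (simp add: fs)
  qed
qed

lemma ndegen_ndegen:
  assumes "category C"
  shows "composable C c fs \<Longrightarrow> j \<le> length fs \<Longrightarrow> i \<le> j \<Longrightarrow>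
    ndegen C c i (ndegen C c j fs) = ndegen C c (Suc j) (ndegen C c i fs)"
proof (induction j arbitrary: c fs i)
  case 0
  then show ?case using composable_Obj[OF assms] categoryD[OF assms] by simp
next
  case (Suc j)
  then obtain f gs where fs: "fs = f # gs" by (metis Suc_le_length_iff)
  show ?case using Suc.IH[of "Cod C f" gs] Suc.prems composable_Obj[OF assms] categoryD[OF assms]
    by (cases i) (auto simp: fs)
qed

text \<open>The two unit laws give the middle case: the inserted identity is merged with the arrow
  after it when \<open>i = j\<close>, and with the arrow before it when
  \<open>Suc i = j\<close>.\<close>

lemma nface_ndegen:
  assumes "category C"
  shows "composable C c fs \<Longrightarrow> j \<le> length fs \<Longrightarrow> i \<le> length fs \<Longrightarrow>
    nface C (Suc i) (ndegen C c j fs) =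
      (if Suc i < j then ndegen C c (j - 1) (nface C (Suc i) fs)
       else if i \<le> j then fs else ndegen C c j (nface C i fs))"
proof (induction j arbitrary: c fs i)
  case 0
  show ?case
  proof (cases i)
    case 0
    with \<open>composable C c fs\<close> show ?thesis using categoryD(9)[OF assms] by (cases fs) auto
  next
    case (Suc i')
    then show ?thesis using 0 by (cases fs) auto
  qed
next
  case (Suc j)
  then obtain f gs where fs: "fs = f # gs" by (metis Suc_le_length_iff)
  show ?case
  proof (cases i)
    case 0
    show ?thesis
    proof (cases j)
      case 0
      then show ?thesis using \<open>i = 0\<close> Suc.prems categoryD(10)[OF assms] by (simp add: fs)
    next
      case (Suc j')
      then show ?thesis using \<open>i = 0\<close> Suc.prems categoryD(8)[OF assms] by (cases gs) (auto simp: fs)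
    qed
  next
    case (Suc i')
    then show ?thesis using Suc.IH[of "Cod C f" gs i'] Suc.prems
      by (cases j; cases i') (auto simp: fs)
  qed
qed

section \<open>Simplicial identities and heights of the homotopy colimit\<close>

lemma simps_hocolim:
  "simps (hocolim C F) n = {(c, fs, x). composable C c fs \<and> length fs = n \<and> x \<in> simps (Ob F c) n}"
  by (simp add: hocolim_def)

lemma face_hocolim_0:
  "face (hocolim C F) (Suc n) 0 (c, f # fs, x) = (Cod C f, fs, Mor F f n (face (Ob F c) (Suc n) 0 x))"
  by (simp add: hocolim_def)

lemma face_hocolim_Suc:
  "length fs = n \<Longrightarrow> Suc i \<le> n \<Longrightarrow>
    face (hocolim C F) n (Suc i) (c, fs, x) = (c, nface C (Suc i) fs, face (Ob F c) n (Suc i) x)"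
  using nface_eq[of "Suc i" fs C] by (simp add: hocolim_def)

lemma degen_hocolim:
  "length fs = n \<Longrightarrow> i \<le> n \<Longrightarrow>
    degen (hocolim C F) n i (c, fs, x) = (c, ndegen C c i fs, degen (Ob F c) n i x)"
  using ndegen_eq[of i fs C c] by (simp add: hocolim_def)

lemma height_hocolim: "height (hocolim C F) n (c, fs, x) = height (Ob F c) n x"
  by (simp add: hocolim_def)

lemma filtered_ssetD:
  assumes "filtered_sset X"
  shows "x \<in> simps X (Suc n) \<Longrightarrow> i \<le> Suc n \<Longrightarrow> face X (Suc n) i x \<in> simps X n"
    and "x \<in> simps X n \<Longrightarrow> i \<le> n \<Longrightarrow> degen X n i x \<in> simps X (Suc n)"
    and "x \<in> simps X (Suc (Suc n)) \<Longrightarrow> j \<le> Suc n \<Longrightarrow> i \<le> j \<Longrightarrow>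
      face X (Suc n) i (face X (Suc (Suc n)) (Suc j) x) = face X (Suc n) j (face X (Suc (Suc n)) i x)"
    and "x \<in> simps X n \<Longrightarrow> j \<le> n \<Longrightarrow> i \<le> j \<Longrightarrow>
      degen X (Suc n) i (degen X n j x) = degen X (Suc n) (Suc j) (degen X n i x)"
    and "x \<in> simps X n \<Longrightarrow> j \<le> n \<Longrightarrow> i \<le> Suc n \<Longrightarrow> face X (Suc n) i (degen X n j x) =
      (if i < j then degen X (n - 1) (j - 1) (face X n i x)
       else if i \<le> Suc j then x
       else degen X (n - 1) j (face X n (i - 1) x))"
    and "x \<in> simps X (Suc n) \<Longrightarrow> i \<le> Suc n \<Longrightarrow> height X (Suc n) x \<le> height X n (face X (Suc n) i x)"
    and "x \<in> simps X n \<Longrightarrow> i \<le> n \<Longrightarrow> height X (Suc n) (degen X n i x) = height X n x"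
proof -
  note * = assms[unfolded filtered_sset_def simplicial_set_def]
  note S = *[THEN conjunct1]
  show "x \<in> simps X (Suc n) \<Longrightarrow> i \<le> Suc n \<Longrightarrow> face X (Suc n) i x \<in> simps X n"
    by (rule S[THEN conjunct1, rule_format])
  show "x \<in> simps X n \<Longrightarrow> i \<le> n \<Longrightarrow> degen X n i x \<in> simps X (Suc n)"
    by (rule S[THEN conjunct2, THEN conjunct1, rule_format])
  show "x \<in> simps X (Suc (Suc n)) \<Longrightarrow> j \<le> Suc n \<Longrightarrow> i \<le> j \<Longrightarrow>
      face X (Suc n) i (face X (Suc (Suc n)) (Suc j) x) = face X (Suc n) j (face X (Suc (Suc n)) i x)"
    using S[THEN conjunct2, THEN conjunct2, THEN conjunct1, rule_format, of x n "Suc j" i] by simp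
  show "x \<in> simps X n \<Longrightarrow> j \<le> n \<Longrightarrow> i \<le> j \<Longrightarrow>
      degen X (Suc n) i (degen X n j x) = degen X (Suc n) (Suc j) (degen X n i x)"
    by (rule S[THEN conjunct2, THEN conjunct2, THEN conjunct2, THEN conjunct1, rule_format])
  show "x \<in> simps X n \<Longrightarrow> j \<le> n \<Longrightarrow> i \<le> Suc n \<Longrightarrow> face X (Suc n) i (degen X n j x) =
      (if i < j then degen X (n - 1) (j - 1) (face X n i x)
       else if i \<le> Suc j then x
       else degen X (n - 1) j (face X n (i - 1) x))"
    by (rule S[THEN conjunct2, THEN conjunct2, THEN conjunct2, THEN conjunct2, rule_format])
  show "x \<in> simps X (Suc n) \<Longrightarrow> i \<le> Suc n \<Longrightarrow> height X (Suc n) x \<le> height X n (face X (Suc n) i x)"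
    by (rule *[THEN conjunct2, THEN conjunct1, rule_format])
  show "x \<in> simps X n \<Longrightarrow> i \<le> n \<Longrightarrow> height X (Suc n) (degen X n i x) = height X n x"
    by (rule *[THEN conjunct2, THEN conjunct2, rule_format])
qed

lemma filtered_mapD:
  assumes "filtered_map X Y f"
  shows "x \<in> simps X n \<Longrightarrow> f n x \<in> simps Y n"
    and "x \<in> simps X (Suc n) \<Longrightarrow> i \<le> Suc n \<Longrightarrow> f n (face X (Suc n) i x) = face Y (Suc n) i (f (Suc n) x)"
    and "x \<in> simps X n \<Longrightarrow> i \<le> n \<Longrightarrow> f (Suc n) (degen X n i x) = degen Y n i (f n x)"
    and "x \<in> simps X n \<Longrightarrow> height X n x \<le> height Y n (f n x)"
  using assms unfolding filtered_map_def by blast+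

lemma filtered_diagramD:
  assumes "filtered_diagram C F"
  shows "category C" and "c \<in> Obj C \<Longrightarrow> filtered_sset (Ob F c)"
    and "f \<in> Arr C \<Longrightarrow> filtered_map (Ob F (Dom C f)) (Ob F (Cod C f)) (Mor F f)"
    and "c \<in> Obj C \<Longrightarrow> x \<in> simps (Ob F c) n \<Longrightarrow> Mor F (Ident C c) n x = x"
    and "f \<in> Arr C \<Longrightarrow> g \<in> Arr C \<Longrightarrow> Cod C f = Dom C g \<Longrightarrow> x \<in> simps (Ob F (Dom C f)) n \<Longrightarrow>
      Mor F (Comp C g f) n x = Mor F g n (Mor F f n x)"
  using assms unfolding filtered_diagram_def by blast+

text \<open>Only face 0 changes the first object, and it pushes the label \<open>x\<close> along the
  first arrow. So naturality and functoriality of \<open>F\<close> enter only in the identities with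
  \<open>i = 0\<close>; every other identity splits into one for the list of arrows and one for the
  simplicial set at the first object.\<close>

lemma filtered_sset_hocolim:
  assumes F: "filtered_diagram C F"
  shows "filtered_sset (hocolim C F)"
proof -
  note C = filtered_diagramD(1)[OF F]
  note cat = categoryD[OF C]
  note sset = filtered_ssetD[OF filtered_diagramD(2)[OF F]]
  note mor = filtered_mapD[OF filtered_diagramD(3)[OF F]]
  note comp = filtered_diagramD(4,5)[OF F]
  have ob: "c \<in> Obj C" if "composable C c fs" for c fs using composable_Obj[OF C that] .
  note hoco = simps_hocolim face_hocolim_0 face_hocolim_Suc degen_hocolim height_hocolim
  show ?thesis
    unfolding filtered_sset_def simplicial_set_def
  proof (intro conjI allI ballI impI)
    fix n i :: nat and s assume "s \<in> simps (hocolim C F) (Suc n)" and i: "i \<le> Suc n"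
    then obtain c f fs x where s: "s = (c, f # fs, x)" "composable C c (f # fs)" "length fs = n"
      "x \<in> simps (Ob F c) (Suc n)" by (auto simp: simps_hocolim length_Suc_conv)
    note cO = ob[OF s(2)]
    show "face (hocolim C F) (Suc n) i s \<in> simps (hocolim C F) n"
      using s i cO sset(1)[OF cO s(4) i] composable_nface[OF C s(2)] length_nface[of i "f # fs" C]
        mor(1)[of f]
      by (cases i) (auto simp: hoco)
    show "height (hocolim C F) (Suc n) s \<le> height (hocolim C F) n (face (hocolim C F) (Suc n) i s)"
    proof (cases i)
      case 0
      have "height (Ob F c) (Suc n) x \<le> height (Ob F c) n (face (Ob F c) (Suc n) 0 x)"
        using sset(6)[OF cO s(4)] by simp
      \<comment> \<open>Face 0 moves to another object of the diagram, where the height can only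
        have gone up because \<open>Mor F f\<close> is filtered.\<close>
      also have "\<dots> \<le> height (Ob F (Cod C f)) n (Mor F f n (face (Ob F c) (Suc n) 0 x))"
        using mor(4)[of f] sset(1)[OF cO s(4)] s(2) by auto
      finally show ?thesis using s 0 by (simp add: hoco)
    next
      case (Suc i')
      then show ?thesis using s i sset(6)[OF cO s(4) i] by (simp add: hoco)
    qed
  next
    fix n i :: nat and s assume "s \<in> simps (hocolim C F) n" and i: "i \<le> n"
    then obtain c fs x where s: "s = (c, fs, x)" "composable C c fs" "length fs = n"
      "x \<in> simps (Ob F c) n" by (auto simp: simps_hocolim)
    note cO = ob[OF s(2)]
    show "degen (hocolim C F) n i s \<in> simps (hocolim C F) (Suc n)"
      using s i sset(2)[OF cO s(4) i] composable_ndegen[OF C s(2)] length_ndegen[of i fs C c]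
      by (simp add: hoco)
    show "height (hocolim C F) (Suc n) (degen (hocolim C F) n i s) = height (hocolim C F) n s"
      using s i sset(7)[OF cO s(4) i] by (simp add: hoco)
  next
    fix n j i :: nat and s assume "s \<in> simps (hocolim C F) (Suc (Suc n))"
      and j: "j \<le> Suc (Suc n)" and i: "i < j"
    then obtain c f g fs x where s: "s = (c, f # g # fs, x)" "composable C c (f # g # fs)"
      "length fs = n" "x \<in> simps (Ob F c) (Suc (Suc n))" by (auto simp: simps_hocolim length_Suc_conv)
    obtain j' where j': "j = Suc j'" using i by (cases j) auto
    note cO = ob[OF s(2)]
    have fg: "f \<in> Arr C" "g \<in> Arr C" "Dom C f = c" "Dom C g = Cod C f" using s(2) by auto
    note xx = sset(3)[OF cO s(4), of j' i]
    have x1: "face (Ob F c) (Suc (Suc n)) k x \<in> simps (Ob F c) (Suc n)" if "k \<le> Suc (Suc n)" for k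
      using sset(1)[OF cO s(4) that] .
    have x2: "face (Ob F c) (Suc n) l (face (Ob F c) (Suc (Suc n)) k x) \<in> simps (Ob F c) n"
      if "k \<le> Suc (Suc n)" "l \<le> Suc n" for k l
      using sset(1)[OF cO x1[OF that(1)] that(2)] .
    show "face (hocolim C F) (Suc n) i (face (hocolim C F) (Suc (Suc n)) j s)
        = face (hocolim C F) (Suc n) (j - 1) (face (hocolim C F) (Suc (Suc n)) i s)"
    proof (cases i)
      case 0
      show ?thesis
      proof (cases j')
        case 0
        then show ?thesis using cat(8)[of f g] \<open>i = 0\<close> fg s xx comp(2)[of f g] x2[of 0 0] mor(2)[of f _ n 0] x1
          by (simp add: hoco j')
      next
        case (Suc j'')
        then show ?thesis using \<open>i = 0\<close> fg s xx j mor(2)[of f _ n "Suc j''"] x1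
            length_nface[of "Suc j''" "g # fs" C]
          by (simp add: hoco j')
      qed
    next
      case (Suc i')
      then obtain j'' where j'': "j' = Suc j''" using i j' by (cases j') auto
      have "nface C (Suc i') (nface C (Suc (Suc j'')) (f # g # fs)) = nface C (Suc j'') (nface C (Suc i') (f # g # fs))"
        using i j s(3) by (intro nface_nface[OF C s(2)]) (auto simp: j' j'' Suc)
      then show ?thesis
        using s xx i j length_nface[of i "f # g # fs" C] length_nface[of j "f # g # fs" C]
        by (simp add: hoco j' j'' Suc del: nface.simps)
    qed
  next
    fix n j i :: nat and s assume "s \<in> simps (hocolim C F) n"
      and j: "j \<le> n" and i: "i \<le> j"
    then obtain c fs x where s: "s = (c, fs, x)" "composable C c fs" "length fs = n"
      "x \<in> simps (Ob F c) n" by (auto simp: simps_hocolim)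
    note cO = ob[OF s(2)]
    show "degen (hocolim C F) (Suc n) i (degen (hocolim C F) n j s)
        = degen (hocolim C F) (Suc n) (Suc j) (degen (hocolim C F) n i s)"
      using s i j sset(4)[OF cO s(4) j i] ndegen_ndegen[OF C s(2) _ i] 
      by (simp add: hoco length_ndegen)
  next
    fix n j i :: nat and s assume "s \<in> simps (hocolim C F) n"
      and j: "j \<le> n" and i: "i \<le> Suc n"
    then obtain c fs x where s: "s = (c, fs, x)" "composable C c fs" "length fs = n"
      "x \<in> simps (Ob F c) n" by (auto simp: simps_hocolim)
    note cO = ob[OF s(2)]
    note xx = sset(5)[OF cO s(4) j i]
    show "face (hocolim C F) (Suc n) i (degen (hocolim C F) n j s) =
        (if i < j then degen (hocolim C F) (n - 1) (j - 1) (face (hocolim C F) n i s)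
         else if i \<le> Suc j then s
         else degen (hocolim C F) (n - 1) j (face (hocolim C F) n (i - 1) s))"
    proof (cases i)
      case 0
      show ?thesis
      proof (cases j)
        case 0
        then show ?thesis using s \<open>i = 0\<close> xx cat(5)[OF cO] comp(1)[OF cO s(4)]
          by (simp add: hoco)
      next
        case (Suc j')
        then obtain m f gs where m: "n = Suc m" "fs = f # gs" using j s(3) by (cases fs) auto
        then show ?thesis
          using s xx \<open>i = 0\<close> Suc j mor(3)[of f _ m j'] sset(1)[OF cO, of x m 0]
          by (simp add: hoco)
      qed
    next
      case (Suc i')
      note ff = nface_ndegen[OF C s(2), of j i']
      show ?thesis
      proof (cases "n = 0")
        case True
        then show ?thesis using s xx ff i j Suc by (auto simp: hoco length_ndegen)
      next
        case False
        then obtain m where m: "n = Suc m" by (cases n) auto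
        have "face (hocolim C F) (Suc n) i (degen (hocolim C F) n j s)
            = (c, nface C i (ndegen C c j fs), face (Ob F c) (Suc n) i (degen (Ob F c) n j x))"
          using s i j by (simp add: hoco length_ndegen Suc)
        moreover have "degen (hocolim C F) (n - 1) (j - 1) (face (hocolim C F) n i s)
            = (c, ndegen C c (j - 1) (nface C i fs), degen (Ob F c) (n - 1) (j - 1) (face (Ob F c) n i x))"
          if "i < j" using s that i j by (simp add: hoco length_nface Suc m)
        moreover have "degen (hocolim C F) (n - 1) j (face (hocolim C F) n (i - 1) s)
            = (c, ndegen C c j (nface C (i - 1) fs), degen (Ob F c) (n - 1) j (face (Ob F c) n (i - 1) x))"
          if "\<not> i \<le> Suc j" using s that i j by (cases i') (simp_all add: hoco length_nface Suc m)
        ultimately show ?thesis using xx ff s i j Suc by auto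
      qed
    qed
  qed
qed

section \<open>Isomorphisms of filtered simplicial sets\<close>

lemma filtered_isoI:
  assumes "filtered_sset X" "filtered_sset Y" and f: "filtered_map X Y f"
    and bij: "\<And>n. bij_betw (f n) (simps X n) (simps Y n)"
    and ht: "\<And>n x. x \<in> simps X n \<Longrightarrow> height Y n (f n x) = height X n x"
  shows "filtered_iso X Y f"
proof -
  define g where "g n = inv_into (simps X n) (f n)" for n
  have gf: "g n (f n x) = x" if "x \<in> simps X n" for n x
    using that bij[of n] by (simp add: g_def bij_betw_def)
  have fg: "f n (g n y) = y" "g n y \<in> simps X n" if "y \<in> simps Y n" for n y
    using that bij[of n] unfolding g_def bij_betw_def by (auto intro: f_inv_into_f inv_into_into)
  note X = filtered_ssetD[OF assms(1)] and Y = filtered_ssetD[OF assms(2)]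
  have "filtered_map Y X g"
    unfolding filtered_map_def
  proof (intro conjI allI ballI impI)
    fix n y assume y: "y \<in> simps Y n"
    show "g n y \<in> simps X n" using fg(2)[OF y] .
    \<comment> \<open>Here the equality of heights in \<open>ht\<close> is essential: a filtered
      bijection that strictly raises some height has no filtered inverse.\<close>
    show "height Y n y \<le> height X n (g n y)" using ht[OF fg(2)[OF y]] fg(1)[OF y] by simp
    fix i assume i: "i \<le> n"
    have "f (Suc n) (degen X n i (g n y)) = degen Y n i y"
      using filtered_mapD(3)[OF f fg(2)[OF y] i] fg(1)[OF y] by simp
    then show "g (Suc n) (degen Y n i y) = degen X n i (g n y)"
      using gf[OF X(2)[OF fg(2)[OF y] i]] by simp
  next
    fix n y i assume y: "y \<in> simps Y (Suc n)" and i: "i \<le> Suc n"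
    have "f n (face X (Suc n) i (g (Suc n) y)) = face Y (Suc n) i y"
      using filtered_mapD(2)[OF f fg(2)[OF y] i] fg(1)[OF y] by simp
    then show "g n (face Y (Suc n) i y) = face X (Suc n) i (g (Suc n) y)"
      using gf[OF X(1)[OF fg(2)[OF y] i]] by simp
  qed
  then show ?thesis using assms(1-3) gf fg(1) unfolding filtered_iso_def by blast
qed

lemma filtered_isoD:
  assumes "filtered_iso X Y f"
  shows "filtered_sset X" "filtered_sset Y" "filtered_map X Y f"
    and "bij_betw (f n) (simps X n) (simps Y n)"
    and "x \<in> simps X n \<Longrightarrow> height Y n (f n x) = height X n x"
proof -
  obtain g where g: "filtered_map Y X g" "\<And>n x. x \<in> simps X n \<Longrightarrow> g n (f n x) = x"
    "\<And>n y. y \<in> simps Y n \<Longrightarrow> f n (g n y) = y"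
    using assms unfolding filtered_iso_def by blast
  show X: "filtered_sset X" "filtered_sset Y" "filtered_map X Y f"
    using assms unfolding filtered_iso_def by blast+
  show "bij_betw (f n) (simps X n) (simps Y n)"
    by (rule bij_betw_byWitness[where f' = "g n"])
       (auto intro: g filtered_mapD(1)[OF X(3)] filtered_mapD(1)[OF g(1)])
  assume x: "x \<in> simps X n"
  \<comment> \<open>Neither direction lowers a height and the round trip returns to
    \<open>x\<close>, so both inequalities are equalities.\<close>
  show "height Y n (f n x) = height X n x"
    using filtered_mapD(4)[OF X(3) x] filtered_mapD(4)[OF g(1) filtered_mapD(1)[OF X(3) x]]
    by (simp add: g(2)[OF x])
qed

lemma filtered_iso_sym: "filtered_iso X Y f \<Longrightarrow> \<exists>g. filtered_iso Y X g"
  unfolding filtered_iso_def by blast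

lemma filtered_map_comp:
  assumes f: "filtered_map X Y f" and g: "filtered_map Y Z g"
  shows "filtered_map X Z (\<lambda>n x. g n (f n x))"
  unfolding filtered_map_def
proof (intro conjI allI ballI impI)
  fix n x assume "x \<in> simps X n"
  then show "height X n x \<le> height Z n (g n (f n x))"
    using filtered_mapD(1,4)[OF f] filtered_mapD(4)[OF g] by (blast intro: order_trans)
qed (simp_all add: filtered_mapD[OF f] filtered_mapD[OF g])

lemma filtered_iso_trans:
  assumes f: "filtered_iso X Y f" and g: "filtered_iso Y Z g"
  shows "filtered_iso X Z (\<lambda>n x. g n (f n x))"
proof (rule filtered_isoI)
  note F = filtered_isoD[OF f] and G = filtered_isoD[OF g]
  show "filtered_sset X" "filtered_sset Z" by fact+
  show "filtered_map X Z (\<lambda>n x. g n (f n x))" using F(3) G(3) by (rule filtered_map_comp)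
  show "bij_betw (\<lambda>x. g n (f n x)) (simps X n) (simps Z n)" for n
    using bij_betw_trans[OF F(4) G(4)] by (simp add: comp_def)
  show "height Z n (g n (f n x)) = height X n x" if "x \<in> simps X n" for n x
    using F(5)[OF that] G(5)[OF filtered_mapD(1)[OF F(3) that]] by simp
qed

text \<open>The chain of index arrows is kept and only the label is changed, so naturality of \<Phi>
  is called upon just for face 0.\<close>

lemma filtered_iso_hocolim:
  assumes "diagram_iso C F F' \<Phi>"
  shows "filtered_iso (hocolim C F) (hocolim C F') (\<lambda>n (c, fs, x). (c, fs, \<Phi> c n x))"
proof -
  have F: "filtered_diagram C F" and F': "filtered_diagram C F'"
    and iso: "\<And>c. c \<in> Obj C \<Longrightarrow> filtered_iso (Ob F c) (Ob F' c) (\<Phi> c)"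
    and nat: "\<And>f n x. f \<in> Arr C \<Longrightarrow> x \<in> simps (Ob F (Dom C f)) n \<Longrightarrow>
        \<Phi> (Cod C f) n (Mor F f n x) = Mor F' f n (\<Phi> (Dom C f) n x)"
    using assms unfolding diagram_iso_def by blast+
  note C = filtered_diagramD(1)[OF F]
  note ob = composable_Obj[OF C]
  note S = filtered_ssetD[OF filtered_diagramD(2)[OF F]]
  note I = filtered_isoD[OF iso]
  note M = filtered_mapD[OF I(3)]
  note hoco = simps_hocolim face_hocolim_0 face_hocolim_Suc degen_hocolim height_hocolim
  show ?thesis
  proof (rule filtered_isoI)
    show "filtered_sset (hocolim C F)" "filtered_sset (hocolim C F')"
      using F F' by (simp_all add: filtered_sset_hocolim)
    show ht: "height (hocolim C F') n (case s of (c, fs, x) \<Rightarrow> (c, fs, \<Phi> c n x))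
        = height (hocolim C F) n s"
      if "s \<in> simps (hocolim C F) n" for n s
      using that ob I(5) by (auto simp: hoco)
    show "filtered_map (hocolim C F) (hocolim C F') (\<lambda>n (c, fs, x). (c, fs, \<Phi> c n x))"
      unfolding filtered_map_def
    proof (intro conjI allI ballI impI)
      fix n s assume s: "s \<in> simps (hocolim C F) n"
      then show "(case s of (c, fs, x) \<Rightarrow> (c, fs, \<Phi> c n x)) \<in> simps (hocolim C F') n"
        using ob M(1) by (auto simp: hoco)
      show "height (hocolim C F) n s \<le> height (hocolim C F') n (case s of (c, fs, x) \<Rightarrow> (c, fs, \<Phi> c n x))"
        using ht[OF s] by simp
      fix i assume "i \<le> n"
      then show "(case degen (hocolim C F) n i s of (c, fs, x) \<Rightarrow> (c, fs, \<Phi> c (Suc n) x))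
          = degen (hocolim C F') n i (case s of (c, fs, x) \<Rightarrow> (c, fs, \<Phi> c n x))"
        using s ob M(3) by (auto simp: hoco)
    next
      fix n s i assume "s \<in> simps (hocolim C F) (Suc n)" and i: "i \<le> Suc n"
      then obtain c f fs x where s: "s = (c, f # fs, x)" "composable C c (f # fs)" "length fs = n"
        "x \<in> simps (Ob F c) (Suc n)" by (auto simp: simps_hocolim length_Suc_conv)
      show "(case face (hocolim C F) (Suc n) i s of (c, fs, x) \<Rightarrow> (c, fs, \<Phi> c n x))
          = face (hocolim C F') (Suc n) i (case s of (c, fs, x) \<Rightarrow> (c, fs, \<Phi> c (Suc n) x))"
        using s i ob[OF s(2)] M(2)[OF ob[OF s(2)] s(4) i] nat[of f] S(1)[OF ob[OF s(2)] s(4) i]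
        by (cases i) (auto simp: hoco)
    qed
    show "bij_betw (\<lambda>(c, fs, x). (c, fs, \<Phi> c n x)) (simps (hocolim C F) n) (simps (hocolim C F') n)" for n
    proof (rule bij_betw_imageI)
      show "inj_on (\<lambda>(c, fs, x). (c, fs, \<Phi> c n x)) (simps (hocolim C F) n)"
        by (rule inj_onI) (auto simp: hoco dest: ob I(4) bij_betw_imp_inj_on inj_onD)
      show "(\<lambda>(c, fs, x). (c, fs, \<Phi> c n x)) ` simps (hocolim C F) n = simps (hocolim C F') n"
      proof (intro equalityI subsetI)
        fix s assume "s \<in> simps (hocolim C F') n"
        then obtain c fs y where s: "s = (c, fs, y)" "composable C c fs" "length fs = n"
          "y \<in> simps (Ob F' c) n" by (auto simp: hoco)
        obtain x where "x \<in> simps (Ob F c) n" "y = \<Phi> c n x"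
          using s(4) I(4)[OF ob[OF s(2)], of n] unfolding bij_betw_def by blast
        then have "(c, fs, x) \<in> simps (hocolim C F) n" "s = (\<lambda>(c, fs, x). (c, fs, \<Phi> c n x)) (c, fs, x)"
          using s by (simp_all add: hoco)
        then show "s \<in> (\<lambda>(c, fs, x). (c, fs, \<Phi> c n x)) ` simps (hocolim C F) n" by (rule rev_image_eqI)
      qed (use ob M(1) in \<open>auto simp: hoco\<close>)
    qed
  qed
qed

section \<open>Homotopy colimits of points over thin categories\<close>

text \<open>Arrows are literally pairs of objects. Hence \<open>nface\<close> and
  \<open>ndegen\<close> are the same list operations in all thin categories, which lets chains in a
  fiber be compared with chains in the total category, and a map of objects acts on chains entry by
  entry.\<close>

definition thin :: "('o, 'o \<times> 'o) cat \<Rightarrow> bool" where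
  "thin C \<longleftrightarrow> category C \<and> Dom C = fst \<and> Cod C = snd \<and> Ident C = (\<lambda>c. (c, c)) \<and>
     Comp C = (\<lambda>g f. (fst f, snd g))"

lemma thinD:
  assumes "thin C"
  shows "category C" "Dom C = fst" "Cod C = snd" "Ident C = (\<lambda>c. (c, c))"
    and "Comp C = (\<lambda>g f. (fst f, snd g))"
    and "(a, b) \<in> Arr C \<Longrightarrow> a \<in> Obj C" "(a, b) \<in> Arr C \<Longrightarrow> b \<in> Obj C"
    and "a \<in> Obj C \<Longrightarrow> (a, a) \<in> Arr C"
    and "(a, b) \<in> Arr C \<Longrightarrow> (b, c) \<in> Arr C \<Longrightarrow> (a, c) \<in> Arr C"
proof -
  show C: "category C" "Dom C = fst" "Cod C = snd" "Ident C = (\<lambda>c. (c, c))"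
    "Comp C = (\<lambda>g f. (fst f, snd g))" using assms by (simp_all add: thin_def)
  note cat = categoryD[OF C(1)]
  show "(a, b) \<in> Arr C \<Longrightarrow> a \<in> Obj C" "(a, b) \<in> Arr C \<Longrightarrow> b \<in> Obj C"
    using cat(1)[of "(a, b)"] cat(2)[of "(a, b)"] by (simp_all add: C)
  show "a \<in> Obj C \<Longrightarrow> (a, a) \<in> Arr C" using cat(3)[of a] by (simp add: C)
  show "(a, b) \<in> Arr C \<Longrightarrow> (b, c) \<in> Arr C \<Longrightarrow> (a, c) \<in> Arr C"
    using cat(6)[of "(a, b)" "(b, c)"] by (simp add: C)
qed

lemma thinI:
  assumes "Dom C = fst" "Cod C = snd" "Ident C = (\<lambda>c. (c, c))" "Comp C = (\<lambda>g f. (fst f, snd g))"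
    and "\<And>a b. (a, b) \<in> Arr C \<Longrightarrow> a \<in> Obj C \<and> b \<in> Obj C"
    and "\<And>a. a \<in> Obj C \<Longrightarrow> (a, a) \<in> Arr C"
    and "\<And>a b c. (a, b) \<in> Arr C \<Longrightarrow> (b, c) \<in> Arr C \<Longrightarrow> (a, c) \<in> Arr C"
  shows "thin C"
  using assms unfolding thin_def category_def by auto

lemma thin_full_subcat: "thin C \<Longrightarrow> thin (full_subcat C P)"
  by (rule thinI) (auto simp: full_subcat_def thinD dest: thinD(6,7,8) intro: thinD(9))

lemma Obj_full_subcat: "c \<in> Obj (full_subcat C P) \<longleftrightarrow> c \<in> Obj C \<and> P c"
  by (simp add: full_subcat_def)

lemma Arr_full_subcat: "thin C \<Longrightarrow> (a, b) \<in> Arr (full_subcat C P) \<longleftrightarrow> (a, b) \<in> Arr C \<and> P a \<and> P b"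
  by (simp add: full_subcat_def thinD)

lemma full_subcat_cong:
  assumes "category C" "\<And>c. c \<in> Obj C \<Longrightarrow> P c = Q c"
  shows "full_subcat C P = full_subcat C Q"
proof -
  have "{c \<in> Obj C. P c} = {c \<in> Obj C. Q c}"
    "{f \<in> Arr C. P (Dom C f) \<and> P (Cod C f)} = {f \<in> Arr C. Q (Dom C f) \<and> Q (Cod C f)}"
    using assms(2) categoryD(1,2)[OF assms(1)] by blast+
  then show ?thesis by (simp add: full_subcat_def)
qed

lemma nface_thin: "thin C \<Longrightarrow> thin D \<Longrightarrow> nface C i fs = nface D i fs"
  by (induction C i fs rule: nface.induct) (auto simp: thinD(5))

lemma ndegen_thin: "thin C \<Longrightarrow> thin D \<Longrightarrow> ndegen C c i fs = ndegen D c i fs"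
  by (induction C c i fs rule: ndegen.induct) (auto simp: thinD(3,4))

lemma nface_map:
  "thin C \<Longrightarrow> nface C i (map (map_prod \<phi> \<phi>) fs) = map (map_prod \<phi> \<phi>) (nface C i fs)"
  by (induction C i fs rule: nface.induct) (auto simp: thinD(5) map_tl)

lemma ndegen_map:
  "thin C \<Longrightarrow> ndegen C (\<phi> c) i (map (map_prod \<phi> \<phi>) fs) = map (map_prod \<phi> \<phi>) (ndegen C c i fs)"
  by (induction C c i fs rule: ndegen.induct) (auto simp: thinD(3,4))

lemma composable_map:
  assumes "thin C" "thin D"
    and "\<And>c. c \<in> Obj C \<Longrightarrow> \<phi> c \<in> Obj D"
    and "\<And>a b. (a, b) \<in> Arr C \<Longrightarrow> (\<phi> a, \<phi> b) \<in> Arr D"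
  shows "composable C c fs \<Longrightarrow> composable D (\<phi> c) (map (map_prod \<phi> \<phi>) fs)"
  by (induction fs arbitrary: c)
     (auto simp: thinD(2,3)[OF assms(1)] thinD(2,3)[OF assms(2)] assms(3,4))

lemma Obj_thin_composable: "thin C \<Longrightarrow> composable C c fs \<Longrightarrow> c \<in> Obj C"
  by (rule composable_Obj[OF thinD(1)])

text \<open>Needed because the laws for transports hold only on objects of the relevant fiber: every
  entry of a chain there is such an object.\<close>

lemma map_chain_cong:
  assumes "thin C" and "\<And>c. c \<in> Obj C \<Longrightarrow> \<phi> c = \<psi> c"
  shows "composable C c fs \<Longrightarrow> map (map_prod \<phi> \<phi>) fs = map (map_prod \<psi> \<psi>) fs"
proof (induction fs arbitrary: c)
  case (Cons f fs)
  then show ?case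
    using thinD(6,7)[OF assms(1), of "fst f" "snd f"] assms(2)
    by (cases f) (auto simp: thinD(2,3)[OF assms(1)])
qed simp

lemma inj_chain:
  assumes "thin C" and "inj_on \<phi> (Obj C)"
  shows "composable C c fs \<Longrightarrow> composable C d gs \<Longrightarrow>
    map (map_prod \<phi> \<phi>) fs = map (map_prod \<phi> \<phi>) gs \<Longrightarrow> fs = gs"
proof (induction fs arbitrary: c d gs)
  case (Cons f fs)
  then obtain g gs' where gs: "gs = g # gs'" by (cases gs) auto
  have "f \<in> Arr C" "g \<in> Arr C" using Cons.prems gs by auto
  then have "f = g"
    using thinD(6,7)[OF assms(1), of "fst f" "snd f"] thinD(6,7)[OF assms(1), of "fst g" "snd g"]
      Cons.prems(3) inj_onD[OF assms(2)] by (cases f; cases g) (auto simp: gs)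
  then show ?case using Cons.IH[of "Cod C f" "Cod C g" gs'] Cons.prems by (simp add: gs)
qed simp

text \<open>Arrows must be reflected as well as preserved; a bijection on objects that only
  preserves them would not allow chains to be lifted.\<close>

definition thin_iso :: "('a \<Rightarrow> 'b) \<Rightarrow> ('a, 'a \<times> 'a) cat \<Rightarrow> ('b, 'b \<times> 'b) cat \<Rightarrow> bool" where
  "thin_iso \<phi> C D \<longleftrightarrow> bij_betw \<phi> (Obj C) (Obj D) \<and>
     (\<forall>a\<in>Obj C. \<forall>b\<in>Obj C. (\<phi> a, \<phi> b) \<in> Arr D \<longleftrightarrow> (a, b) \<in> Arr C)"

lemma thin_isoD:
  assumes "thin_iso \<phi> C D"
  shows "inj_on \<phi> (Obj C)" and "c \<in> Obj C \<Longrightarrow> \<phi> c \<in> Obj D"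
    and "d \<in> Obj D \<Longrightarrow> \<exists>c\<in>Obj C. d = \<phi> c"
    and "a \<in> Obj C \<Longrightarrow> b \<in> Obj C \<Longrightarrow> (\<phi> a, \<phi> b) \<in> Arr D \<longleftrightarrow> (a, b) \<in> Arr C"
  using assms unfolding thin_iso_def bij_betw_def by auto

lemma lift_chain:
  assumes C: "thin C" and D: "thin D" and iso: "thin_iso \<phi> C D"
  shows "composable D (\<phi> c) gs \<Longrightarrow> c \<in> Obj C \<Longrightarrow>
    \<exists>fs. composable C c fs \<and> map (map_prod \<phi> \<phi>) fs = gs"
proof (induction gs arbitrary: c)
  case Nil
  then show ?case by (intro exI[of _ "[]"]) simp
next
  case (Cons g gs)
  obtain y where g: "g = (\<phi> c, y)" using Cons.prems by (cases g) (auto simp: thinD(2)[OF D])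
  have arr: "(\<phi> c, y) \<in> Arr D" using Cons.prems g by simp
  obtain b where b: "b \<in> Obj C" "y = \<phi> b" using thin_isoD(3)[OF iso thinD(7)[OF D arr]] by blast
  have "(c, b) \<in> Arr C" using arr b thin_isoD(4)[OF iso Cons.prems(2) b(1)] by simp
  moreover obtain fs where "composable C b fs" "map (map_prod \<phi> \<phi>) fs = gs"
    using Cons.IH[of b] Cons.prems(1) b g by (auto simp: thinD(3)[OF D])
  ultimately show ?case
    by (intro exI[of _ "(c, b) # fs"]) (simp add: g b thinD(2,3)[OF C])
qed

lemma simps_point [simp]: "x \<in> simps (Ob (point_diagram h) c) n"
  and face_point [simp]: "face (Ob (point_diagram h) c) n i x = x"
  and degen_point [simp]: "degen (Ob (point_diagram h) c) n i x = x"
  and height_point [simp]: "height (Ob (point_diagram h) c) n x = h c"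
  and Mor_point [simp]: "Mor (point_diagram h) f n x = x"
  by (simp_all add: point_diagram_def point_def)

lemma filtered_diagram_point:
  assumes "category C" "\<And>f. f \<in> Arr C \<Longrightarrow> h (Dom C f) \<le> h (Cod C f)"
  shows "filtered_diagram C (point_diagram h)"
  using assms unfolding filtered_diagram_def filtered_sset_def simplicial_set_def filtered_map_def
  by simp

lemma filtered_sset_point:
  assumes "thin C" "\<And>a b. (a, b) \<in> Arr C \<Longrightarrow> h a \<le> h b"
  shows "filtered_sset (hocolim C (point_diagram h))"
  using assms by (intro filtered_sset_hocolim filtered_diagram_point) (auto simp: thinD)

text \<open>Thus \<open>shift\<close>, \<open>p1\<close> and \<open>A_pull\<close> applied to the
  knot complex only change the heights of the points, and the objects of \<open>XD\<close> are again
  homotopy colimits of points over the cubes of G.\<close>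

lemma map_height_hocolim_point:
  "map_height \<psi> (hocolim C (point_diagram h)) = hocolim C (point_diagram (\<lambda>c. \<psi> (h c)))"
  by (auto simp: map_height_def hocolim_def point_diagram_def point_def fun_eq_iff)

lemma induced_Pair: "induced \<phi> n (c, fs, x) = (\<phi> c, map (map_prod \<phi> \<phi>) fs, x)"
  by (simp add: induced_def)

lemma filtered_map_induced:
  assumes C: "thin C" and D: "thin D"
    and obj: "\<And>c. c \<in> Obj C \<Longrightarrow> \<phi> c \<in> Obj D"
    and arr: "\<And>a b. (a, b) \<in> Arr C \<Longrightarrow> (\<phi> a, \<phi> b) \<in> Arr D"
    and ht: "\<And>c. c \<in> Obj C \<Longrightarrow> h c \<le> h' (\<phi> c)"
  shows "filtered_map (hocolim C (point_diagram h)) (hocolim D (point_diagram h')) (induced \<phi>)"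
proof -
  note hoco = simps_hocolim face_hocolim_0 face_hocolim_Suc degen_hocolim height_hocolim induced_Pair
  have nf: "nface D i (map (map_prod \<phi> \<phi>) fs) = map (map_prod \<phi> \<phi>) (nface C i fs)" for i fs
    using nface_map[OF D] nface_thin[OF C D] by metis
  have nd: "ndegen D (\<phi> c) i (map (map_prod \<phi> \<phi>) fs) = map (map_prod \<phi> \<phi>) (ndegen C c i fs)" for c i fs
    using ndegen_map[OF D] ndegen_thin[OF C D] by metis
  show ?thesis
    unfolding filtered_map_def
  proof (intro conjI allI ballI impI)
    fix n s assume s: "s \<in> simps (hocolim C (point_diagram h)) n"
    then obtain c fs x where s': "s = (c, fs, x)" "composable C c fs" "length fs = n"
      by (auto simp: hoco)
    show "induced \<phi> n s \<in> simps (hocolim D (point_diagram h')) n"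
      using s' composable_map[of C D \<phi>, OF C D obj arr s'(2)] by (simp add: hoco)
    show "height (hocolim C (point_diagram h)) n s
        \<le> height (hocolim D (point_diagram h')) n (induced \<phi> n s)"
      using s ht Obj_thin_composable[OF C] by (auto simp: hoco)
    fix i assume "i \<le> n"
    then show "induced \<phi> (Suc n) (degen (hocolim C (point_diagram h)) n i s)
        = degen (hocolim D (point_diagram h')) n i (induced \<phi> n s)"
      using s by (auto simp: hoco nd)
  next
    fix n s i assume "s \<in> simps (hocolim C (point_diagram h)) (Suc n)" and i: "i \<le> Suc n"
    then obtain c f fs x where s: "s = (c, f # fs, x)" "length fs = n"
      by (auto simp: simps_hocolim length_Suc_conv)
    show "induced \<phi> n (face (hocolim C (point_diagram h)) (Suc n) i s)
        = face (hocolim D (point_diagram h')) (Suc n) i (induced \<phi> (Suc n) s)"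
    proof (cases i)
      case 0
      then show ?thesis using s by (simp add: hoco thinD(3)[OF C] thinD(3)[OF D])
    next
      case (Suc i')
      then show ?thesis using s i nf[of "Suc i'" "f # fs"] by (simp add: hoco)
    qed
  qed
qed

lemma filtered_iso_induced:
  assumes C: "thin C" and D: "thin D" and iso: "thin_iso \<phi> C D"
    and mono: "\<And>a b. (a, b) \<in> Arr C \<Longrightarrow> h a \<le> h b"
    and ht: "\<And>c. c \<in> Obj C \<Longrightarrow> h' (\<phi> c) = h c"
  shows "filtered_iso (hocolim C (point_diagram h)) (hocolim D (point_diagram h')) (induced \<phi>)"
proof (rule filtered_isoI)
  note I = thin_isoD[OF iso]
  note ob = Obj_thin_composable[OF C] Obj_thin_composable[OF D]
  note hoco = simps_hocolim height_hocolim induced_Pair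
  \<comment> \<open>Monotonicity is assumed on one side only; it is carried over by reflecting the
    arrow to \<open>C\<close>.\<close>
  have mono': "h' a \<le> h' b" if ab': "(a, b) \<in> Arr D" for a b
  proof -
    obtain a' b' where ab: "a' \<in> Obj C" "b' \<in> Obj C" "a = \<phi> a'" "b = \<phi> b'"
      using I(3) thinD(6,7)[OF D ab'] by blast
    then have "(a', b') \<in> Arr C" using ab' I(4) by simp
    then show ?thesis using mono ht ab by simp
  qed
  show "filtered_sset (hocolim C (point_diagram h))" using C mono by (rule filtered_sset_point)
  show "filtered_sset (hocolim D (point_diagram h'))" using D mono' by (rule filtered_sset_point)
  have arr: "(\<phi> a, \<phi> b) \<in> Arr D" if "(a, b) \<in> Arr C" for a b
    using I(4) thinD(6,7)[OF C that] that by simp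
  show map: "filtered_map (hocolim C (point_diagram h)) (hocolim D (point_diagram h')) (induced \<phi>)"
    using I(2) arr ht by (intro filtered_map_induced[OF C D]) auto
  show "height (hocolim D (point_diagram h')) n (induced \<phi> n s) = height (hocolim C (point_diagram h)) n s"
    if "s \<in> simps (hocolim C (point_diagram h)) n" for n s
    using that ht ob by (auto simp: hoco)
  show "bij_betw (induced \<phi> n) (simps (hocolim C (point_diagram h)) n)
      (simps (hocolim D (point_diagram h')) n)" for n
  proof (rule bij_betw_imageI)
    show "inj_on (induced \<phi> n) (simps (hocolim C (point_diagram h)) n)"
    proof (rule inj_onI)
      fix s t assume "s \<in> simps (hocolim C (point_diagram h)) n"
        "t \<in> simps (hocolim C (point_diagram h)) n" and eq: "induced \<phi> n s = induced \<phi> n t"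
      then obtain c fs x d gs y where st: "s = (c, fs, x)" "composable C c fs"
        "t = (d, gs, y)" "composable C d gs" by (auto simp: hoco)
      then show "s = t"
        using eq inj_onD[OF I(1) _ ob(1) ob(1)] inj_chain[OF C I(1), of c fs d gs]
        by (simp add: induced_Pair)
    qed
    show "induced \<phi> n ` simps (hocolim C (point_diagram h)) n = simps (hocolim D (point_diagram h')) n"
    proof (intro equalityI subsetI)
      fix s assume "s \<in> simps (hocolim D (point_diagram h')) n"
      then obtain d gs x where s: "s = (d, gs, x)" "composable D d gs" "length gs = n"
        by (auto simp: hoco)
      obtain c where c: "c \<in> Obj C" "d = \<phi> c" using ob(2)[OF s(2)] I(3) by blast
      obtain fs where "composable C c fs" "map (map_prod \<phi> \<phi>) fs = gs"
        using lift_chain[OF C D iso, of c gs] s(2) c by blast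
      then have "(c, fs, x) \<in> simps (hocolim C (point_diagram h)) n" "s = induced \<phi> n (c, fs, x)"
        using s c by (auto simp: hoco)
      then show "s \<in> induced \<phi> n ` simps (hocolim C (point_diagram h)) n" by (rule rev_image_eqI)
    qed (use filtered_mapD(1)[OF map] in blast)
  qed
qed

section \<open>Diagrams on the surgery index category\<close>

lemma category_index_cat:
  assumes "\<And>\<tt> i. (\<tt>, i) \<in> \<ss> \<Longrightarrow> (K \<tt>, i + r) \<in> \<ss>"
  shows "category (index_cat K r \<ss>)"
  unfolding category_def index_cat_def Let_def
  by (auto simp: assms split: index_arr.splits)

text \<open>Every composite contains an identity, so functoriality costs nothing beyond
  \<open>ident\<close>; what remains is to check objects, the two kinds of arrows, and that targets
  of \<rho> stay in \<open>\<ss>\<close>.\<close>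

lemma filtered_diagram_index_cat:
  assumes closed: "\<And>\<tt> i. (\<tt>, i) \<in> \<ss> \<Longrightarrow> (K \<tt>, i + r) \<in> \<ss>"
    and ob: "\<And>\<tt> i z. (\<tt>, i) \<in> \<ss> \<Longrightarrow> filtered_sset (Ob F (\<tt>, i, z))"
    and ident: "\<And>c n x. Mor F (Identity c) n x = x"
    and lam: "\<And>\<tt> i. (\<tt>, i) \<in> \<ss> \<Longrightarrow>
      filtered_map (Ob F (\<tt>, i, type_a)) (Ob F (\<tt>, i, type_b)) (Mor F (Lam \<tt> i))"
    and rho: "\<And>\<tt> i. (\<tt>, i) \<in> \<ss> \<Longrightarrow>
      filtered_map (Ob F (\<tt>, i, type_a)) (Ob F (K \<tt>, i + r, type_b)) (Mor F (Rho \<tt> i))"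
  shows "filtered_diagram (index_cat K r \<ss>) F"
proof -
  have id: "filtered_map X X (Mor F (Identity c))" for X c
    by (simp add: filtered_map_def ident)
  have "category (index_cat K r \<ss>)" using closed by (rule category_index_cat)
  then show ?thesis
    unfolding filtered_diagram_def
    by (auto simp: index_cat_def Let_def ob id lam rho ident closed split: index_arr.splits)
qed

section \<open>Homotopy colimits of fibers\<close>

text \<open>Pushes the object in position \<open>k\<close> of the chain \<open>gs\<close> forward along the first \<open>k\<close> arrows of \<open>fs\<close>.\<close>

fun glue :: "('m \<Rightarrow> 'd \<Rightarrow> 'd) \<Rightarrow> 'm list \<Rightarrow> ('d \<times> 'd) list \<Rightarrow> ('d \<times> 'd) list" where
  "glue \<phi> (f # fs) (g # gs) =
     (fst g, \<phi> f (snd g)) # glue \<phi> fs (map (map_prod (\<phi> f) (\<phi> f)) gs)"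
| "glue \<phi> _ _ = []"

text \<open>The transports are isomorphisms of the fibers of \<open>P\<close>, and every arrow of \<open>D\<close> factors through the
  transport along an arrow of \<open>C\<close>: \<open>D\<close> is a Grothendieck construction over \<open>C\<close>.\<close>

locale fibered_thin =
  fixes C :: "('i, 'm) cat" and D :: "('d, 'd \<times> 'd) cat"
    and P :: "'d \<Rightarrow> 'i" and \<phi> :: "'m \<Rightarrow> 'd \<Rightarrow> 'd"
  assumes C: "category C" and D: "thin D"
    and P_Obj: "d \<in> Obj D \<Longrightarrow> P d \<in> Obj C"
    and iso: "f \<in> Arr C \<Longrightarrow> thin_iso (\<phi> f) (full_subcat D (\<lambda>d. P d = Dom C f))
      (full_subcat D (\<lambda>d. P d = Cod C f))"
    and ident: "d \<in> Obj D \<Longrightarrow> \<phi> (Ident C (P d)) d = d"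
    and comp: "f \<in> Arr C \<Longrightarrow> g \<in> Arr C \<Longrightarrow> Cod C f = Dom C g \<Longrightarrow> d \<in> Obj D \<Longrightarrow> P d = Dom C f \<Longrightarrow>
      \<phi> (Comp C g f) d = \<phi> g (\<phi> f d)"
    and push: "f \<in> Arr C \<Longrightarrow> (x, y) \<in> Arr D \<Longrightarrow> P x = Dom C f \<Longrightarrow> P y = Dom C f \<Longrightarrow> (x, \<phi> f y) \<in> Arr D"
    and factor: "(x, y') \<in> Arr D \<Longrightarrow>
      \<exists>f y. f \<in> Arr C \<and> Dom C f = P x \<and> (x, y) \<in> Arr D \<and> P y = P x \<and> \<phi> f y = y'"
    and unique: "f \<in> Arr C \<Longrightarrow> g \<in> Arr C \<Longrightarrow> Dom C f = Dom C g \<Longrightarrow> Cod C f = Cod C g \<Longrightarrow>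
      f = g"
begin

abbreviation fiber :: "'i \<Rightarrow> ('d, 'd \<times> 'd) cat" where
  "fiber c \<equiv> full_subcat D (\<lambda>d. P d = c)"

lemma thin_fiber: "thin (fiber c)"
  using D by (rule thin_full_subcat)

lemma composable_fiber_Obj:
  assumes "composable (fiber c) d gs"
  shows "d \<in> Obj D \<and> P d = c"
  using Obj_thin_composable[OF thin_fiber assms] by (simp only: Obj_full_subcat)

lemma fiber_simps [simp]:
  "Dom (fiber c) = fst" "Cod (fiber c) = snd"
  "g \<in> Arr (fiber c) \<longleftrightarrow> g \<in> Arr D \<and> P (fst g) = c \<and> P (snd g) = c"
  using Arr_full_subcat[OF D, of "fst g" "snd g" "\<lambda>d. P d = c"]
  by (simp_all add: thinD(2,3)[OF thin_fiber])

lemma transport: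
  assumes "f \<in> Arr C" "d \<in> Obj D" "P d = Dom C f"
  shows "\<phi> f d \<in> Obj D" "P (\<phi> f d) = Cod C f"
  using thin_isoD(2)[OF iso[OF assms(1)], of d] assms(2,3) by (simp_all add: Obj_full_subcat)

lemma composable_transport:
  assumes "f \<in> Arr C" "composable (fiber (Dom C f)) d gs"
  shows "composable (fiber (Cod C f)) (\<phi> f d) (map (map_prod (\<phi> f) (\<phi> f)) gs)"
proof (rule composable_map[OF thin_fiber thin_fiber _ _ assms(2)])
  note I = thin_isoD[OF iso[OF assms(1)]]
  show "c \<in> Obj (fiber (Dom C f)) \<Longrightarrow> \<phi> f c \<in> Obj (fiber (Cod C f))" for c by (rule I(2))
  show "(a, b) \<in> Arr (fiber (Dom C f)) \<Longrightarrow> (\<phi> f a, \<phi> f b) \<in> Arr (fiber (Cod C f))" for a b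
    using I(4) thinD(6,7)[OF thin_fiber] by blast
qed

text \<open>The first object stays where it is, and all later ones move along the first index arrow
  into the fiber over \<open>Cod C f\<close>. There they again form a chain inside one fiber, to
  which the induction hypothesis applies.\<close>

lemma composable_glue:
  "composable C c fs \<Longrightarrow> composable (fiber c) d gs \<Longrightarrow> length fs = length gs \<Longrightarrow>
    composable D d (glue \<phi> fs gs) \<and> length (glue \<phi> fs gs) = length gs"
proof (induction fs arbitrary: c d gs)
  case Nil
  then show ?case using composable_fiber_Obj[OF Nil(2)] by simp
next
  case (Cons f fs)
  then obtain g gs' where gs: "gs = g # gs'" by (cases gs) auto
  have f: "f \<in> Arr C" "Dom C f = c" "composable C (Cod C f) fs" using Cons.prems by auto
  have g: "fst g = d" "(d, snd g) \<in> Arr D" "P d = c" "P (snd g) = c"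
    and gs': "composable (fiber c) (snd g) gs'"
    using Cons.prems(2) prod.collapse[of g] by (simp_all add: gs) metis
  have "composable (fiber (Cod C f)) (\<phi> f (snd g)) (map (map_prod (\<phi> f) (\<phi> f)) gs')"
    using composable_transport[OF f(1)] f(2) gs' by simp
  then have "composable D (\<phi> f (snd g)) (glue \<phi> fs (map (map_prod (\<phi> f) (\<phi> f)) gs')) \<and>
      length (glue \<phi> fs (map (map_prod (\<phi> f) (\<phi> f)) gs')) = length gs'"
    using Cons.IH[OF f(3)] Cons.prems(3) by (simp add: gs)
  moreover have "(d, \<phi> f (snd g)) \<in> Arr D" using push[OF f(1) g(2)] f(2) g(3,4) by simp
  ultimately show ?case using g(1) by (simp add: gs thinD(2,3)[OF D])
qed

text \<open>Merging two index arrows corresponds to skipping one object of the glued chain, since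
  pushing along a composite is pushing twice. Face 0 is excluded because it changes the fiber of the
  starting object.\<close>

lemma glue_nface:
  "composable C c fs \<Longrightarrow> composable (fiber c) d gs \<Longrightarrow> length fs = length gs \<Longrightarrow> Suc i \<le> length gs \<Longrightarrow>
    glue \<phi> (nface C (Suc i) fs) (nface D (Suc i) gs) = nface D (Suc i) (glue \<phi> fs gs)"
proof (induction i arbitrary: c d fs gs)
  case 0
  then obtain f fs' g gs' where fg: "fs = f # fs'" "gs = g # gs'" by (cases fs; cases gs) auto
  show ?case
  proof (cases fs')
    case Nil
    then show ?thesis using 0 by (simp add: fg)
  next
    case (Cons f2 fs2)
    then obtain g2 gs2 where gs': "gs' = g2 # gs2" using 0 fg by (cases gs') auto
    have f: "f \<in> Arr C" "f2 \<in> Arr C" "Dom C f = c" "Dom C f2 = Cod C f"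
      using 0 by (simp_all add: fg Cons)
    have g2: "composable (fiber c) (snd g2) gs2" using 0 by (simp add: fg gs')
    have "\<phi> (Comp C f2 f) x = \<phi> f2 (\<phi> f x)" if "x \<in> Obj (fiber c)" for x
      using that comp[of f f2 x] f by (simp add: Obj_full_subcat)
    then have "map (map_prod (\<phi> (Comp C f2 f)) (\<phi> (Comp C f2 f))) gs2
        = map (map_prod (\<phi> f2) (\<phi> f2)) (map (map_prod (\<phi> f) (\<phi> f)) gs2)"
      "\<phi> (Comp C f2 f) (snd g2) = \<phi> f2 (\<phi> f (snd g2))"
      using map_chain_cong[OF thin_fiber _ g2, of "\<phi> (Comp C f2 f)" "\<lambda>x. \<phi> f2 (\<phi> f x)"]
        composable_fiber_Obj[OF g2] by (simp_all add: Obj_full_subcat map_prod_def case_prod_beta)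
    then show ?thesis by (simp add: fg Cons gs' thinD(5)[OF D] del: map_map map_eq_conv)
  qed
next
  case (Suc i)
  then obtain f fs' g gs' where fg: "fs = f # fs'" "gs = g # gs'" by (cases fs; cases gs) auto
  have f: "f \<in> Arr C" "Dom C f = c" "composable C (Cod C f) fs'" using Suc.prems by (auto simp: fg)
  have "composable (fiber c) (snd g) gs'" using Suc.prems by (simp add: fg)
  from Suc.IH[OF f(3) composable_transport[OF f(1), unfolded f(2), OF this]] show ?case
    using Suc.prems by (simp add: fg nface_map[OF D])
qed

lemma glue_ndegen:
  "composable C c fs \<Longrightarrow> composable (fiber c) d gs \<Longrightarrow> length fs = length gs \<Longrightarrow> i \<le> length gs \<Longrightarrow>
    glue \<phi> (ndegen C c i fs) (ndegen D d i gs) = ndegen D d i (glue \<phi> fs gs)"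
proof (induction i arbitrary: c d fs gs)
  case 0
  have "\<phi> (Ident C c) x = x" if "x \<in> Obj (fiber c)" for x
    using that ident[of x] by (auto simp: Obj_full_subcat)
  then have "map (map_prod (\<phi> (Ident C c)) (\<phi> (Ident C c))) gs = gs" "\<phi> (Ident C c) d = d"
    using map_chain_cong[OF thin_fiber _ 0(2), of "\<phi> (Ident C c)" "\<lambda>x. x"]
      composable_fiber_Obj[OF 0(2)] by (simp_all add: map_prod_ident Obj_full_subcat)
  then show ?case by (simp add: thinD(4)[OF D])
next
  case (Suc i)
  then obtain f fs' g gs' where fg: "fs = f # fs'" "gs = g # gs'" by (cases fs; cases gs) auto
  have f: "f \<in> Arr C" "Dom C f = c" "composable C (Cod C f) fs'" using Suc.prems by (auto simp: fg)
  have "composable (fiber c) (snd g) gs'" using Suc.prems by (simp add: fg)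
  from Suc.IH[OF f(3) composable_transport[OF f(1), unfolded f(2), OF this]] show ?case
    using Suc.prems by (simp add: fg ndegen_map[OF D, symmetric] thinD(3)[OF D])
qed

text \<open>The second object of the glued chain lies over \<open>Cod C f\<close>, and an index
  arrow is determined by its two ends, so the chain reveals \<open>f\<close>. Injectivity of the
  transport along \<open>f\<close> then recovers the cube before transport and, after the induction
  step, the rest of the chain.\<close>

lemma glue_inj:
  "composable C c fs \<Longrightarrow> composable (fiber c) d gs \<Longrightarrow> length fs = length gs \<Longrightarrow>
    composable C c fs' \<Longrightarrow> composable (fiber c) d gs' \<Longrightarrow> length fs' = length gs' \<Longrightarrow>
    glue \<phi> fs gs = glue \<phi> fs' gs' \<Longrightarrow> fs = fs' \<and> gs = gs'"
proof (induction fs arbitrary: c d gs fs' gs')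
  case Nil
  then show ?case by (cases fs'; cases gs') auto
next
  case (Cons f fs)
  obtain g hs where gs: "gs = g # hs" using Cons.prems by (cases gs) auto
  obtain f' ks g' hs' where fgs': "fs' = f' # ks" "gs' = g' # hs'"
    using Cons.prems by (cases fs'; cases gs') (auto simp: gs)
  have f: "f \<in> Arr C" "Dom C f = c" "composable C (Cod C f) fs" using Cons.prems by auto
  have f': "f' \<in> Arr C" "Dom C f' = c" "composable C (Cod C f') ks" using Cons.prems by (auto simp: fgs')
  have g: "fst g = d" "P (snd g) = c" "composable (fiber c) (snd g) hs"
    using Cons.prems by (auto simp: gs)
  have g': "fst g' = d" "P (snd g') = c" "composable (fiber c) (snd g') hs'"
    using Cons.prems by (auto simp: fgs')
  have obj: "snd g \<in> Obj D" "snd g' \<in> Obj D" using composable_fiber_Obj g(3) g'(3) by blast+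
  have eq: "\<phi> f (snd g) = \<phi> f' (snd g')"
    "glue \<phi> fs (map (map_prod (\<phi> f) (\<phi> f)) hs) = glue \<phi> ks (map (map_prod (\<phi> f') (\<phi> f')) hs')"
    using Cons.prems(7) by (simp_all add: gs fgs')
  have "Cod C f = Cod C f'"
    using transport(2)[OF f(1) obj(1)] transport(2)[OF f'(1) obj(2)] f f' g g' eq by simp
  then have ff: "f' = f" using unique[OF f(1) f'(1)] f(2) f'(2) by simp
  note inj = thin_isoD(1)[OF iso[OF f(1)], unfolded f(2)]
  have gg: "snd g = snd g'"
    using inj_onD[OF inj] eq(1) obj g g' by (simp add: ff Obj_full_subcat)
  have "fs = ks \<and> map (map_prod (\<phi> f) (\<phi> f)) hs = map (map_prod (\<phi> f) (\<phi> f)) hs'"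
    using composable_transport[OF f(1), unfolded f(2)] g(3) g'(3) eq(2) Cons.prems f' f
    by (intro Cons.IH[of "Cod C f" "\<phi> f (snd g)"]) (auto simp: gg gs fgs' ff)
  then show ?case
    using inj_chain[OF thin_fiber inj g(3) g'(3)] gg g g' by (simp add: gs fgs' ff prod_eq_iff)
qed

text \<open>The first arrow is factored as a move inside the fiber followed by a transport.
  Induction decomposes the tail over the next index, and its chain of objects is pulled back along
  the same transport, which is possible because transports are isomorphisms of fibers.\<close>

lemma glue_surj:
  "composable D d hs \<Longrightarrow> \<exists>fs gs. composable C (P d) fs \<and> composable (fiber (P d)) d gs \<and>
    length fs = length hs \<and> length gs = length hs \<and> glue \<phi> fs gs = hs"
proof (induction hs arbitrary: d)
  case Nil
  then show ?case using P_Obj by (intro exI[of _ "[]"]) (simp add: Obj_full_subcat)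
next
  case (Cons h hs)
  obtain y' where h: "h = (d, y')" "(d, y') \<in> Arr D" "composable D y' hs"
    using Cons.prems by (cases h) (auto simp: thinD(2,3)[OF D])
  obtain f y where f: "f \<in> Arr C" "Dom C f = P d" "(d, y) \<in> Arr D" "P y = P d" "\<phi> f y = y'"
    using factor[OF h(2)] by blast
  have y: "y \<in> Obj D" using thinD(7)[OF D f(3)] .
  have Py': "P y' = Cod C f" using transport(2)[OF f(1) y] f by simp
  obtain fs gs where fg: "composable C (P y') fs" "composable (fiber (P y')) y' gs"
    "length fs = length hs" "length gs = length hs" "glue \<phi> fs gs = hs"
    using Cons.IH[OF h(3)] by blast
  obtain gs' where gs': "composable (fiber (P d)) y gs'" "map (map_prod (\<phi> f) (\<phi> f)) gs' = gs"
    using lift_chain[OF thin_fiber thin_fiber iso[OF f(1)], of y gs] fg(2) f y Py'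
    by (auto simp: Obj_full_subcat)
  have "length gs' = length hs" using gs'(2) fg(4) by auto
  then show ?case
    using f fg gs' h Py'
    by (intro exI[of _ "f # fs"] exI[of _ "(d, y) # gs'"])
       simp
qed

text \<open>On the diagonal of the bar construction the chain of index arrows and the chain inside
  the fiber have the same length n, so gluing them yields a chain of length n in the total category.
  Both sides take their height from the first object \<open>d\<close>, hence heights are preserved
  exactly.\<close>

theorem filtered_iso_hocolim_fibers:
  assumes F: "filtered_diagram C F"
    and Ob: "\<And>c. c \<in> Obj C \<Longrightarrow> Ob F c = hocolim (fiber c) (point_diagram h)"
    and Mor: "\<And>f n d gs x. f \<in> Arr C \<Longrightarrow>
      Mor F f n (d, gs, x) = (\<phi> f d, map (map_prod (\<phi> f) (\<phi> f)) gs, x)"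
    and mono: "\<And>a b. (a, b) \<in> Arr D \<Longrightarrow> h a \<le> h b"
  shows "filtered_iso (hocolim C F) (hocolim D (point_diagram h))
    (\<lambda>n (c, fs, d, gs, x). (d, glue \<phi> fs gs, x))" (is "filtered_iso ?X ?Y ?\<Theta>")
proof (rule filtered_isoI)
  note hoco = simps_hocolim face_hocolim_0 face_hocolim_Suc degen_hocolim height_hocolim
  have simpsX: "s \<in> simps ?X n \<longleftrightarrow> (\<exists>c fs d gs. s = (c, fs, d, gs, ()) \<and> composable C c fs \<and>
      composable (fiber c) d gs \<and> length fs = n \<and> length gs = n)" for s n
    using composable_Obj[OF C] by (auto simp: simps_hocolim Ob)
  show "filtered_sset ?X" using F by (rule filtered_sset_hocolim)
  show "filtered_sset ?Y" using D mono by (rule filtered_sset_point)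
  show ht: "height ?Y n (?\<Theta> n s) = height ?X n s" if "s \<in> simps ?X n" for n s
    using that composable_Obj[OF C] unfolding simpsX by (auto simp: height_hocolim Ob)
  show map: "filtered_map ?X ?Y ?\<Theta>"
    unfolding filtered_map_def
  proof (intro conjI allI ballI impI)
    fix n s assume s: "s \<in> simps ?X n"
    then obtain c fs d gs where s': "s = (c, fs, d, gs, ())" "composable C c fs"
      "composable (fiber c) d gs" "length fs = n" "length gs = n" unfolding simpsX by blast
    note cO = composable_Obj[OF C s'(2)]
    note gl = composable_glue[OF s'(2,3)]
    show "?\<Theta> n s \<in> simps ?Y n" using s' gl by (simp add: simps_hocolim)
    show "height ?X n s \<le> height ?Y n (?\<Theta> n s)" using ht[OF s] by simp
    fix i assume "i \<le> n"
    then show "?\<Theta> (Suc n) (degen ?X n i s) = degen ?Y n i (?\<Theta> n s)"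
      using s' gl glue_ndegen[OF s'(2,3)]
      by (simp add: degen_hocolim Ob[OF cO] ndegen_thin[OF thin_fiber D])
  next
    fix n s i assume "s \<in> simps ?X (Suc n)" and i: "i \<le> Suc n"
    then obtain c fs d gs where s: "s = (c, fs, d, gs, ())" "composable C c fs"
      "composable (fiber c) d gs" "length fs = Suc n" "length gs = Suc n" unfolding simpsX by blast
    note cO = composable_Obj[OF C s(2)]
    have gl: "length (glue \<phi> fs gs) = Suc n" using composable_glue[OF s(2,3)] s(4,5) by simp
    show "?\<Theta> n (face ?X (Suc n) i s) = face ?Y (Suc n) i (?\<Theta> (Suc n) s)"
    proof (cases i)
      case 0
      obtain f fs' g gs' where fg: "fs = f # fs'" "gs = g # gs'"
        using s(4,5) by (cases fs; cases gs) auto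
      have "f \<in> Arr C" using s(2) by (simp add: fg)
      \<comment> \<open>For face 0 the functor pushes the remaining chain along \<open>f\<close>,
        and the tail of \<open>glue\<close> is defined from this pushed chain.\<close>
      then show ?thesis
        using s 0 gl by (simp add: fg face_hocolim_0 Ob[OF cO] Mor thinD(3)[OF thin_fiber] thinD(3)[OF D])
    next
      case (Suc i')
      then show ?thesis
        using s gl i glue_nface[OF s(2,3), of i']
        by (simp add: face_hocolim_Suc Ob[OF cO] nface_thin[OF thin_fiber D])
    qed
  qed
  show "bij_betw (?\<Theta> n) (simps ?X n) (simps ?Y n)" for n
  proof (rule bij_betw_imageI)
    show "inj_on (?\<Theta> n) (simps ?X n)"
    proof (rule inj_onI)
      fix s t assume "s \<in> simps ?X n" "t \<in> simps ?X n" and eq: "?\<Theta> n s = ?\<Theta> n t"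
      then obtain c fs d gs c' fs' d' gs' where s: "s = (c, fs, d, gs, ())" "composable C c fs"
        "composable (fiber c) d gs" "length fs = n" "length gs = n"
        and t: "t = (c', fs', d', gs', ())" "composable C c' fs'"
        "composable (fiber c') d' gs'" "length fs' = n" "length gs' = n" unfolding simpsX by blast
      have d: "d' = d" "glue \<phi> fs gs = glue \<phi> fs' gs'" using eq s t by auto
      \<comment> \<open>The glued simplex does not record the index object, but it is the value of
        \<open>P\<close> at the first object.\<close>
      then have "c' = c" using composable_fiber_Obj[OF s(3)] composable_fiber_Obj[OF t(3)] by simp
      then show "s = t" using glue_inj[OF s(2,3) _ _ _ _ d(2)] s t d by simp
    qed
    show "?\<Theta> n ` simps ?X n = simps ?Y n"
    proof (intro equalityI subsetI)
      fix s assume "s \<in> simps ?Y n"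
      then obtain d hs where s: "s = (d, hs, ())" "composable D d hs" "length hs = n"
        by (auto simp: simps_hocolim)
      obtain fs gs where "composable C (P d) fs" "composable (fiber (P d)) d gs"
        "length fs = length hs" "length gs = length hs" "glue \<phi> fs gs = hs"
        using glue_surj[OF s(2)] by blast
      then have "(P d, fs, d, gs, ()) \<in> simps ?X n" "s = ?\<Theta> n (P d, fs, d, gs, ())"
        using s unfolding simpsX by auto
      then show "s \<in> ?\<Theta> n ` simps ?X n" by (rule rev_image_eqI)
    qed (use filtered_mapD(1)[OF map] in blast)
  qed
qed

end

section \<open>Cubes and heights of plumbings\<close>

lemma sum_vertex: "finite I \<Longrightarrow> (\<Sum>v\<in>I. vertex v u) = (if u \<in> I then 1 else (0::int))"
  by (simp add: vertex_def)

lemma act_act: "act (act k S) T = act k (\<lambda>v. S v + T v)"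
  by (simp add: act_def algebra_simps)

lemma act_commute: "act (act k S) T = act (act k T) S"
  by (simp add: act_def algebra_simps)

lemma act_cancel [simp]: "act k S = act k' S \<longleftrightarrow> k = k'"
  by (auto simp: act_def fun_eq_iff)

lemma act_neg [simp]: "act (act k S) (\<lambda>v. - S v) = k" "act (act k (\<lambda>v. - S v)) S = k"
  by (auto simp: act_def)

lemma rel_class_add: "rel_class H (\<lambda>v. x v + y v) = (\<lambda>v. rel_class H x v + rel_class H y v)"
  by (auto simp: rel_class_def form_add)

lemma cube_vertex_empty [simp]: "cube_vertex H k {} = k"
  by (auto simp: cube_vertex_def act_def rel_class_def form_def)

lemma cube_vertex_sing: "cube_vertex H k {v} = act k (rel_class H (vertex v))"
  by (simp add: cube_vertex_def)

lemma cube_vertex_act: "cube_vertex H (act k S) I = act (cube_vertex H k I) S"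
  unfolding cube_vertex_def by (rule act_commute)

lemma cube_vertex_Un:
  assumes "finite I" "finite J" "I \<inter> J = {}"
  shows "cube_vertex H (cube_vertex H k I) J = cube_vertex H k (I \<union> J)"
  using assms by (simp add: cube_vertex_def act_act rel_class_add[symmetric] sum.union_disjoint)

lemma Obj_cube_cat: "(k, E) \<in> Obj (cube_cat H \<tt>) \<longleftrightarrow> k \<in> \<tt> \<and> E \<subseteq> verts H"
  by (simp add: cube_cat_def Let_def)

lemma Arr_cube_cat: "((k, E), (k', E')) \<in> Arr (cube_cat H \<tt>) \<longleftrightarrow>
    k \<in> \<tt> \<and> E \<subseteq> verts H \<and> k' \<in> \<tt> \<and> E' \<subseteq> E \<and> (\<exists>J\<subseteq>E - E'. k' = cube_vertex H k J)"
  by (auto simp: cube_cat_def Let_def cube_face_def)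

text \<open>For transitivity: the coordinates set to 1 in two successive faces are disjoint, so the
  two displacements combine into the one for their union.\<close>

lemma thin_cube_cat:
  assumes "finite (verts H)"
  shows "thin (cube_cat H \<tt>)"
proof (rule thinI)
  fix a b c assume "(a, b) \<in> Arr (cube_cat H \<tt>)" "(b, c) \<in> Arr (cube_cat H \<tt>)"
  moreover obtain k E k' E' k'' E'' where abc: "a = (k, E)" "b = (k', E')" "c = (k'', E'')"
    by (cases a; cases b; cases c)
  ultimately obtain J J' where *: "k \<in> \<tt>" "k' \<in> \<tt>" "k'' \<in> \<tt>" "E \<subseteq> verts H" "E' \<subseteq> E" "E'' \<subseteq> E'"
    "J \<subseteq> E - E'" "J' \<subseteq> E' - E''" "k' = cube_vertex H k J" "k'' = cube_vertex H k' J'"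
    unfolding abc Arr_cube_cat by blast
  have "finite E" using * assms finite_subset by blast
  moreover have "J \<subseteq> E" "J' \<subseteq> E" using * by blast+
  ultimately have "finite J" "finite J'" using finite_subset by blast+
  moreover have "J \<inter> J' = {}" using * by blast
  ultimately have "k'' = cube_vertex H k (J \<union> J')" using * by (simp only: cube_vertex_Un)
  moreover have "J \<union> J' \<subseteq> E - E''" using * by blast
  ultimately show "(a, c) \<in> Arr (cube_cat H \<tt>)" using * unfolding abc Arr_cube_cat by blast
next
  fix a assume "a \<in> Obj (cube_cat H \<tt>)"
  then show "(a, a) \<in> Arr (cube_cat H \<tt>)"
    by (cases a) (auto simp: Arr_cube_cat Obj_cube_cat intro!: exI[of _ "{}"])
next
  fix a b assume "(a, b) \<in> Arr (cube_cat H \<tt>)"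
  then show "a \<in> Obj (cube_cat H \<tt>) \<and> b \<in> Obj (cube_cat H \<tt>)"
    by (cases a; cases b) (auto simp: Arr_cube_cat Obj_cube_cat)
qed (simp_all add: cube_cat_def Let_def)

lemma hU_eq: "hU H (k, E) = Min ((\<lambda>I. hU_point H (cube_vertex H k I)) ` Pow E)"
proof -
  have "{hU_point H (cube_vertex H k I) |I. I \<subseteq> E} = (\<lambda>I. hU_point H (cube_vertex H k I)) ` Pow E"
    by auto
  then show ?thesis by (simp add: hU_def)
qed

lemma hU_mono:
  assumes fin: "finite (verts H)" and ab: "(a, b) \<in> Arr (cube_cat H \<tt>)"
  shows "hU H a \<le> hU H b"
proof -
  obtain k E k' E' where abe: "a = (k, E)" "b = (k', E')" by (cases a; cases b)
  obtain J where *: "E \<subseteq> verts H" "E' \<subseteq> E" "J \<subseteq> E - E'" "k' = cube_vertex H k J"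
    using ab unfolding abe Arr_cube_cat by blast
  have E: "finite E" using * fin finite_subset by blast
  have "cube_vertex H k' I \<in> cube_vertex H k ` Pow E" if "I \<subseteq> E'" for I
  proof
    have "I \<subseteq> E" "J \<subseteq> E" using * that by blast+
    then have "finite I" "finite J" using E finite_subset by blast+
    moreover have "J \<inter> I = {}" using * that by blast
    ultimately show "cube_vertex H k' I = cube_vertex H k (J \<union> I)" using * by (simp only: cube_vertex_Un)
  qed (use * that in blast)
  \<comment> \<open>The vertices of a face are vertices of the cube, so the minimum is taken over
    fewer points.\<close>
  then have "cube_vertex H k' ` Pow E' \<subseteq> cube_vertex H k ` Pow E" by (rule image_subsetI) simp
  from image_mono[OF this, of "hU_point H"]
  have "(\<lambda>I. hU_point H (cube_vertex H k' I)) ` Pow E'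
      \<subseteq> (\<lambda>I. hU_point H (cube_vertex H k I)) ` Pow E" by (simp only: image_image)
  then show ?thesis unfolding abe hU_eq prod.case using E by (intro Min_antimono) auto
qed

lemma rat_lift_eqI:
  assumes fin: "finite (verts H)"
    and nd: "\<And>x::'v \<Rightarrow> rat. x \<in> classes H \<Longrightarrow> x \<noteq> (\<lambda>_. 0) \<Longrightarrow> form H x x < 0"
    and y: "y \<in> classes H" "\<And>v. v \<in> verts H \<Longrightarrow> form H y (vertex v) = of_int (S v)"
  shows "rat_lift H S = y"
proof (rule ccontr)
  assume "rat_lift H S \<noteq> y"
  note l = rat_lift[OF fin nd, where S = S]
  define z where "z = (\<lambda>v. rat_lift H S v - y v)"
  have "z \<in> classes H" using l(1) y(1) by (simp add: classes_def z_def)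
  moreover have "z \<noteq> (\<lambda>_. 0)" using \<open>rat_lift H S \<noteq> y\<close> by (auto simp: z_def fun_eq_iff)
  moreover have "form H z z = 0"
    using l(2) y(2) by (subst form_expand[OF fin]) (simp add: z_def form_diff)
  ultimately show False using nd by fastforce
qed

section \<open>The rational splitting along the Seifert class\<close>

locale plumbed_knot =
  fixes Gv0 :: "'v wgraph" and v0 :: 'v and n :: int
  assumes fo: "forest Gv0" and uw: "only_unweighted_vertex Gv0 v0"
    and nd: "negative_definite (set_weight Gv0 v0 n)"
begin

definition "G = remove_vertex Gv0 v0"
definition "H = set_weight Gv0 v0 n"
definition "r = Seifert_framing Gv0 v0 n"
definition "K = knot_class Gv0 v0"
text \<open>The class of the weighted vertex in the filled plumbing. It restricts to
  \<open>K\<close> on \<open>G\<close>, so translation by \<open>V\<close> upstairs is the flip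
  downstairs.\<close>

definition "V = rel_class H (vertex v0)"
definition "\<Sigma> = Seifert_class Gv0 v0"
definition "\<Sigma>0 = Sigma0 Gv0 v0"
definition "res = restrict_class G"
definition "alex = Alex Gv0 v0 n"

definition pr :: "('v \<Rightarrow> int) \<Rightarrow> ('v \<Rightarrow> int) set \<times> rat" where
  "pr L = (orbit_rel G `` {res L}, alex L)"

lemma vH: "verts H = insert v0 (verts G)" and v0G: "v0 \<notin> verts G"
  using uw by (auto simp: H_def G_def set_weight_def remove_vertex_def only_unweighted_vertex_def)

lemma finG: "finite (verts G)" and finH: "finite (verts H)"
  using fo by (auto simp: H_def G_def set_weight_def remove_vertex_def forest_def)

lemma inter_G: "u \<in> verts G \<Longrightarrow> v \<in> verts G \<Longrightarrow> inter H u v = inter G u v"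
  by (auto simp: inter_def H_def G_def set_weight_def remove_vertex_def)

lemma inter_v0: "v \<in> verts G \<Longrightarrow> inter H v v0 = K v"
  by (auto simp: inter_def H_def G_def K_def set_weight_def remove_vertex_def knot_class_def insert_commute)

lemma classes_GH: "x \<in> classes G \<Longrightarrow> x \<in> classes H" and classes_v0: "x \<in> classes G \<Longrightarrow> x v0 = 0"
  using v0G by (auto simp: classes_def vH)

lemma form_GH: "x \<in> classes G \<Longrightarrow> y \<in> classes G \<Longrightarrow> form H x y = form G x y"
  using v0G by (simp add: form_def vH finG classes_def inter_G cong: sum.cong)

lemma vertex_G: "v \<in> verts G \<Longrightarrow> vertex v \<in> classes G"
  by (simp add: classes_def vertex_def)

lemma form_v0: "x \<in> classes G \<Longrightarrow> form H x (vertex v0) = (\<Sum>v\<in>verts G. of_int (K v) * x v)"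
  using v0G by (subst form_vertex[OF finH]) (simp_all add: vH finG classes_v0 inter_v0 mult.commute)

lemma form_vertex_v0: "v \<in> verts G \<Longrightarrow> form H (vertex v) (vertex v0) = of_int (K v)"
  using finG by (simp add: form_v0 vertex_G) (simp add: vertex_def if_distrib cong: if_cong)

lemma ndH: "(x :: 'v \<Rightarrow> rat) \<in> classes H \<Longrightarrow> x \<noteq> (\<lambda>_. 0) \<Longrightarrow> form H x x < 0"
  using negative_definite_rat[OF finH] nd by (simp add: H_def)

lemma ndG: "(x :: 'v \<Rightarrow> rat) \<in> classes G \<Longrightarrow> x \<noteq> (\<lambda>_. 0) \<Longrightarrow> form G x x < 0"
  using ndH[of x] by (simp add: classes_GH form_GH)

lemma lift: "\<Sigma>0 \<in> classes G" "v \<in> verts G \<Longrightarrow> form G \<Sigma>0 (vertex v) = of_int (K v)"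
  using rat_lift[OF finG ndG, where S = K] by (simp_all add: \<Sigma>0_def Sigma0_def G_def K_def)

lemma \<Sigma>_alt: "\<Sigma> = (\<lambda>v. vertex v0 v - \<Sigma>0 v)"
  by (simp add: \<Sigma>_def Seifert_class_def \<Sigma>0_def)

lemma \<Sigma>_H: "\<Sigma> \<in> classes H"
  using lift(1) by (auto simp: \<Sigma>_alt classes_def vertex_def vH)

lemma \<Sigma>_v0: "\<Sigma> v0 = 1"
  using classes_v0[OF lift(1)] by (simp add: \<Sigma>_alt vertex_def)

lemma \<Sigma>_G: "v \<in> verts G \<Longrightarrow> form H \<Sigma> (vertex v) = 0"
proof -
  assume v: "v \<in> verts G"
  have "form H (vertex v0) (vertex v :: 'v \<Rightarrow> rat) = of_int (K v)"
    using v by (subst form_sym) (rule form_vertex_v0)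
  then show ?thesis using v by (simp add: \<Sigma>_alt form_diff form_GH lift vertex_G)
qed

text \<open>\<open>\<Sigma>\<close> is orthogonal to every vertex of \<open>G\<close>, so only the
  coefficient at \<open>v0\<close> counts; the factor is r because \<open>\<Sigma>\<close> itself
  has coefficient 1 there.\<close>

lemma form_\<Sigma>: "form H \<Sigma> x = r * x v0"
proof -
  have *: "form H \<Sigma> x = form H \<Sigma> (vertex v0) * x v0" for x
    using v0G by (subst form_expand[OF finH]) (simp add: vH finG \<Sigma>_G)
  have "r = form H \<Sigma> \<Sigma>" by (simp add: r_def Seifert_framing_def \<Sigma>_def H_def)
  then have "r = form H \<Sigma> (vertex v0)" by (subst (asm) *) (simp add: \<Sigma>_v0)
  with *[of x] show ?thesis by simp
qed

lemma r_neg: "r < 0"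
  unfolding r_def using fo uw nd by (rule Seifert_framing_neg)

lemma evaluate_\<Sigma>: "evaluate H L \<Sigma> = 2 * alex L - r"
  by (simp add: alex_def Alex_def H_def \<Sigma>_def r_def field_simps)

lemma evaluate_split: "evaluate H L \<Sigma> = of_int (L v0) - (\<Sum>v\<in>verts G. of_int (L v) * \<Sigma>0 v)"
proof -
  have "\<Sigma> v = - \<Sigma>0 v" if "v \<in> verts G" for v
    using that v0G by (auto simp: \<Sigma>_alt vertex_def)
  then show ?thesis
    using v0G by (simp add: evaluate_def vH finG \<Sigma>_v0 sum_negf cong: sum.cong)
qed

lemma square_split: "square H L = square G (res L) + (2 * alex L - r)\<^sup>2 / r"
proof -
  \<comment> \<open>The component along \<open>\<Sigma>\<close> of the dual of \<open>L\<close>: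
    pairing with \<open>\<Sigma>\<close> must give L(\<Sigma>), and \<open>\<Sigma>\<close> has
    square r.\<close>
  define c where "c = evaluate H L \<Sigma> / r"
  define y where "y = rat_lift G (res L)"
  have y: "y \<in> classes G" and yv: "\<And>v. v \<in> verts G \<Longrightarrow> form G y (vertex v) = of_int (L v)"
    using rat_lift[OF finG ndG, where S = "res L"] by (simp_all add: y_def res_def restrict_class_def)
  have v0_eq: "(vertex v0 :: 'v \<Rightarrow> rat) = (\<lambda>v. \<Sigma> v + \<Sigma>0 v)" by (simp add: \<Sigma>_alt)
  \<comment> \<open>With v0 = \<Sigma> + \<Sigma>0 the first summand is orthogonal to
    \<open>y\<close>, and the second is paired with \<open>y\<close> inside \<open>G\<close>, where
    \<open>y\<close> represents \<open>L\<close>. This is the term that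
    \<open>evaluate_split\<close> subtracts from \<open>L v0\<close>.\<close>
  have y0: "form H y (vertex v0) = (\<Sum>v\<in>verts G. of_int (L v) * \<Sigma>0 v)"
  proof -
    have "form H y (vertex v0) = form H \<Sigma> y + form H \<Sigma>0 y"
      by (subst form_sym) (simp add: v0_eq form_add)
    also have "\<dots> = form G \<Sigma>0 y"
      by (simp add: form_\<Sigma> classes_v0[OF y] form_GH[OF lift(1) y])
    also have "\<dots> = form G y \<Sigma>0" by (rule form_sym)
    finally show ?thesis by (subst (asm) form_expand[OF finG]) (simp add: yv)
  qed
  define x where "x = (\<lambda>v. y v + c * \<Sigma> v)"
  have fx: "form H x z = form H y z + c * form H \<Sigma> z" for z
    by (simp add: x_def form_add form_scale)
  have vertex_v: "vertex v v = (1::rat)" for v :: 'v by (simp add: vertex_def)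
  have "rat_lift H L = x"
  proof (rule rat_lift_eqI[OF finH ndH])
    show "x \<in> classes H" using classes_GH[OF y] \<Sigma>_H by (simp add: x_def classes_def)
    fix v assume v: "v \<in> verts H"
    show "form H x (vertex v) = of_int (L v)"
    proof (cases "v = v0")
      case True
      then show ?thesis
        using r_neg vertex_v[of v0] by (simp add: fx y0 form_\<Sigma> c_def evaluate_split)
    next
      case False
      then have "v \<in> verts G" using v vH by simp
      then show ?thesis by (simp add: fx \<Sigma>_G form_GH[OF y vertex_G] yv)
    qed
  qed
  then have "square H L = form H y x + c * form H \<Sigma> x" by (simp add: square_def fx)
  also have "form H y x = form H x y" by (rule form_sym)
  also have "\<dots> = form G y y" by (simp add: fx form_\<Sigma> classes_v0[OF y] form_GH[OF y y])
  also have "form H \<Sigma> x = r * c" by (simp add: form_\<Sigma> x_def classes_v0[OF y] \<Sigma>_v0)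
  finally show ?thesis
    using r_neg by (simp add: square_def y_def c_def evaluate_\<Sigma> power2_eq_square)
qed

text \<open>The origin of \<open>gr\<close>: L(\<Sigma>) = 2i - r contributes (2i - r)^2 / r to the
  square, and the additional vertex contributes 1, written as r / r in the common fraction; both are
  divided by 4.\<close>

lemma hU_point_split: "hU_point H L = hU_point G (res L) + gr r (alex L)"
  using r_neg v0G by (simp add: hU_point_def square_split gr_def vH finG field_simps)

text \<open>From (2i + r)^2 - (2i - r)^2 = 8ir, divided by 4r.\<close>

lemma gr_add: "gr r (i + r) = gr r i + 2 * i"
  using r_neg by (simp add: gr_def field_simps power2_eq_square)

lemma res_act_G: "x \<in> classes G \<Longrightarrow> res (act L (rel_class H x)) = act (res L) (rel_class G x)"
  by (auto simp: res_def restrict_class_def act_def rel_class_def form_GH vertex_G vH)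

lemma res_act_V: "res (act L V) = act (res L) K"
proof -
  have "V v = K v" if "v \<in> verts G" for v
  proof -
    have "V v = form H (vertex v) (vertex v0)"
      using that by (subst form_sym) (simp add: V_def rel_class_def vH)
    then show ?thesis using that by (simp add: form_vertex_v0)
  qed
  moreover have "K v = 0" if "v \<notin> verts G" for v
    using that by (simp add: K_def knot_class_def G_def remove_vertex_def)
  ultimately show ?thesis by (auto simp: res_def restrict_class_def act_def)
qed

text \<open>The action adds twice the pairing of \<open>x\<close> with \<open>\<Sigma>\<close> and
  the index halves it. In particular translations by classes of \<open>G\<close> preserve the index,
  and translation by \<open>v0\<close> adds r.\<close>

lemma alex_act: "alex (act L (rel_class H x)) = alex L + r * of_int (x v0)"
proof -
  have of_int_form: "of_int (form H x (vertex v)) = form H (\<lambda>v. of_int (x v)) (vertex v :: 'v \<Rightarrow> rat)" for v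
    unfolding form_of_int[symmetric] of_int_vertex ..
  have "evaluate H (act L (rel_class H x)) \<Sigma>
      = evaluate H L \<Sigma> + 2 * (\<Sum>v\<in>verts H. form H (\<lambda>v. of_int (x v)) (vertex v) * \<Sigma> v)"
    by (simp add: evaluate_def act_def rel_class_def distrib_right sum.distrib sum_distrib_left
        mult.assoc of_int_form)
  also have "\<dots> = evaluate H L \<Sigma> + 2 * form H \<Sigma> (\<lambda>v. of_int (x v))"
    by (subst (2) form_sym) (simp add: form_expand[OF finH, symmetric])
  finally show ?thesis by (simp add: evaluate_\<Sigma> form_\<Sigma>)
qed

lemma alex_act_V: "alex (act L V) = alex L + r"
  unfolding V_def alex_act by (simp add: vertex_def)

lemma indicator_G: "I \<subseteq> verts G \<Longrightarrow> (\<lambda>u. \<Sum>v\<in>I. vertex v u :: int) \<in> classes G"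
  using finite_subset[OF _ finG] by (auto simp: sum_vertex classes_def)

lemma res_cube_vertex: "I \<subseteq> verts G \<Longrightarrow> res (cube_vertex H L I) = cube_vertex G (res L) I"
  unfolding cube_vertex_def by (rule res_act_G[OF indicator_G])

lemma alex_cube_vertex: "I \<subseteq> verts G \<Longrightarrow> alex (cube_vertex H L I) = alex L"
  unfolding cube_vertex_def by (simp add: alex_act classes_v0[OF indicator_G])

lemma cube_vertex_insert_v0:
  assumes "I \<subseteq> verts G"
  shows "cube_vertex H L (insert v0 I) = act (cube_vertex H L I) V"
proof -
  have "v0 \<notin> I" "finite I" using assms v0G finite_subset[OF _ finG] by blast+
  then show ?thesis
    using cube_vertex_Un[of I "{v0}" H L] by (simp add: cube_vertex_sing V_def)
qed

section \<open>Heights of cubes with and without the surgery vertex\<close>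

lemma hU_without_v0:
  assumes "E \<subseteq> verts G"
  shows "hU H (L, E) = hU G (res L, E) + gr r (alex L)"
proof -
  have fin: "finite E" using assms finG finite_subset by blast
  have "(\<lambda>I. hU_point H (cube_vertex H L I)) ` Pow E
      = (\<lambda>h. h + gr r (alex L)) ` (\<lambda>I. hU_point G (cube_vertex G (res L) I)) ` Pow E"
    unfolding image_image using assms
    by (intro image_cong refl) (auto simp: hU_point_split res_cube_vertex alex_cube_vertex)
  also have "Min \<dots> = Min ((\<lambda>I. hU_point G (cube_vertex G (res L) I)) ` Pow E) + gr r (alex L)"
    using fin by (intro mono_Min_commute[symmetric]) (auto simp: mono_def)
  finally show ?thesis by (simp add: hU_eq)
qed

text \<open>The vertices of the cube are sorted by whether the subset contains \<open>v0\<close>.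
  Those that do form the cube translated by \<open>V\<close>, whose index is larger by r; by
  \<open>gr_add\<close> its grading shift is that of \<open>L\<close> plus 2i.\<close>

lemma hU_with_v0:
  assumes "E \<subseteq> verts G"
  shows "hU H (L, insert v0 E) = min (hU G (res L, E)) (hV Gv0 v0 (res L, E) + 2 * alex L) + gr r (alex L)"
proof -
  have fin: "finite E" using assms finG finite_subset by blast
  have "hU_point H (cube_vertex H L (insert v0 I)) = hU_point H (cube_vertex H (act L V) I)"
    if "I \<in> Pow E" for I
    using that assms by (simp add: cube_vertex_insert_v0 cube_vertex_act)
  then have "(\<lambda>I. hU_point H (cube_vertex H L I)) ` Pow (insert v0 E)
      = (\<lambda>I. hU_point H (cube_vertex H L I)) ` Pow E
        \<union> (\<lambda>I. hU_point H (cube_vertex H (act L V) I)) ` Pow E"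
    by (simp add: Pow_insert image_Un image_image cong: image_cong_simp)
  then have "hU H (L, insert v0 E) = min (hU H (L, E)) (hU H (act L V, E))"
    unfolding hU_eq using fin by (simp only:) (rule Min_Un, auto)
  also have "\<dots> = min (hU G (res L, E) + gr r (alex L))
      (hV Gv0 v0 (res L, E) + (gr r (alex L) + 2 * alex L))"
    using assms by (simp add: hU_without_v0 res_act_V alex_act_V gr_add hV_def flip_cube_def G_def K_def)
  finally show ?thesis by (simp add: min_add_distrib_left add_ac)
qed

end

section \<open>The surgery diagrams\<close>

lemma Char_classes: "k \<in> Char H \<Longrightarrow> k \<in> classes H"
  by (simp add: Char_def)

lemma induced_induced: "induced \<phi> n (induced \<psi> n s) = induced (\<lambda>c. \<phi> (\<psi> c)) n s"
  by (cases s) (simp add: induced_def map_prod_def comp_def case_prod_beta)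

lemma induced_ident: "induced (\<lambda>c. c) n s = s"
  by (cases s) (simp add: induced_def map_prod_ident)

context plumbed_knot
begin

section \<open>Characteristic classes and their surgery indices\<close>

lemma K_G: "K \<in> classes G" and V_H: "V \<in> classes H"
  by (simp_all add: classes_def K_def knot_class_def G_def remove_vertex_def V_def rel_class_def)

lemma res_Char:
  assumes "L \<in> Char H"
  shows "res L \<in> Char G"
proof -
  have ev: "evaluate G (res L) x = evaluate H L x" if "x \<in> classes G" for x :: "'v \<Rightarrow> int"
    using that v0G by (simp add: evaluate_def vH finG classes_v0 res_def restrict_class_def)
  have "even (evaluate G (res L) x - form G x x)" if "x \<in> classes G" for x :: "'v \<Rightarrow> int"
    using assms ev[OF that] form_GH[OF that that] classes_GH[OF that] by (simp add: Char_def)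
  then show ?thesis by (simp add: Char_def classes_def res_def restrict_class_def)
qed

text \<open>Translation by \<open>K\<close> commutes with the orbit translations and is undone by
  subtracting \<open>K\<close>, so it carries an orbit onto an orbit. The parity condition survives
  because \<open>K\<close> acts through even multiples.\<close>

lemma orbit_act_K:
  assumes "k \<in> Char G"
  shows "add_knot Gv0 v0 (orbit_rel G `` {k}) = orbit_rel G `` {act k K}"
proof -
  have iff: "(act k K, act l K) \<in> orbit_rel G \<longleftrightarrow> (k, l) \<in> orbit_rel G" if "l \<in> Char G" for l
    using that assms Char_act[OF _ K_G]
    by (simp add: orbit_rel_def act_commute[of k K])
  have "l \<in> add_knot Gv0 v0 (orbit_rel G `` {k}) \<longleftrightarrow> (act k K, l) \<in> orbit_rel G" for l
  proof
    assume "l \<in> add_knot Gv0 v0 (orbit_rel G `` {k})"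
    then obtain l' where "l = act l' K" "(k, l') \<in> orbit_rel G" by (auto simp: add_knot_def K_def)
    then show "(act k K, l) \<in> orbit_rel G" using iff[of l'] by (simp add: orbit_rel_def)
  next
    assume l: "(act k K, l) \<in> orbit_rel G"
    define l' where "l' = act l (\<lambda>v. - K v)"
    have "l' \<in> Char G"
      unfolding l'_def using l K_G by (intro Char_act) (auto simp: orbit_rel_def classes_def)
    moreover have "l = act l' K" by (simp add: l'_def)
    ultimately show "l \<in> add_knot Gv0 v0 (orbit_rel G `` {k})"
      using l iff[of l'] by (auto simp: add_knot_def K_def)
  qed
  then show ?thesis by blast
qed

lemma pr_act_V: "L \<in> Char H \<Longrightarrow> pr (act L V) = (add_knot Gv0 v0 (fst (pr L)), snd (pr L) + r)"
  by (simp add: pr_def res_act_V alex_act_V orbit_act_K res_Char)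

lemma Char_act_V: "act L V \<in> Char H \<longleftrightarrow> L \<in> Char H"
proof
  assume "act L V \<in> Char H"
  then have "act (act L V) (\<lambda>v. - V v) \<in> Char H"
    by (rule Char_act) (use V_H in \<open>simp add: classes_def\<close>)
  then show "L \<in> Char H" by simp
qed (rule Char_act[OF _ V_H])

lemma mem_orbit_iff:
  assumes "\<tt> \<in> Spinc G" "k \<in> Char G"
  shows "k \<in> \<tt> \<longleftrightarrow> \<tt> = orbit_rel G `` {k}"
proof -
  obtain l where l: "l \<in> Char G" "\<tt> = orbit_rel G `` {l}"
    using assms(1) unfolding Spinc_def by (rule quotientE)
  show ?thesis using eq_equiv_class_iff[OF orbit_equiv l(1) assms(2)] l(2) by simp
qed

lemma surgery_pairs_eq: "surgery_pairs Gv0 v0 n = pr ` Char H"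
proof (intro equalityI subsetI)
  fix p assume "p \<in> surgery_pairs Gv0 v0 n"
  then obtain L where L: "fst p \<in> Spinc G" "L \<in> Char H" "res L \<in> fst p" "snd p = alex L"
    by (auto simp: surgery_pairs_def H_def G_def res_def alex_def)
  then have "p = pr L" using mem_orbit_iff[OF L(1) res_Char[OF L(2)]] by (simp add: pr_def prod_eq_iff)
  then show "p \<in> pr ` Char H" using L(2) by simp
next
  fix p assume "p \<in> pr ` Char H"
  then obtain L where L: "L \<in> Char H" "p = pr L" by blast
  have "fst p \<in> Spinc G" "res L \<in> fst p"
    using res_Char[OF L(1)] equiv_class_self[OF orbit_equiv] by (auto simp: L pr_def Spinc_def quotientI)
  then show "p \<in> surgery_pairs Gv0 v0 n"
    using L by (auto simp: surgery_pairs_def pr_def H_def G_def res_def alex_def)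
qed

text \<open>The index determines L(\<Sigma>), where \<open>L v0\<close> occurs with coefficient 1
  and every other term depends only on the restriction to \<open>G\<close>; so \<open>L v0\<close>
  can be solved for.\<close>

lemma Char_eqI:
  assumes "L \<in> classes H" "L' \<in> classes H" "res L = res L'" "alex L = alex L'"
  shows "L = L'"
proof -
  have G: "L v = L' v" if "v \<in> verts G" for v
    using fun_cong[OF assms(3), of v] that by (simp add: res_def restrict_class_def)
  have "evaluate H L \<Sigma> = evaluate H L' \<Sigma>" by (simp add: evaluate_\<Sigma> assms(4))
  then have "L v0 = L' v0" by (simp add: evaluate_split G)
  then have "L v = L' v" for v
    using G assms(1,2) by (cases "v \<in> verts H") (auto simp: vH classes_def)
  then show ?thesis by blast
qed

text \<open>Moving \<open>L\<close> by a class of \<open>G\<close> reaches any point of the orbit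
  below and keeps the index. This supplies surjectivity when cubes are restricted to
  \<open>G\<close>.\<close>

lemma orbit_pr_eq:
  assumes "k \<in> fst (pr L)" "L \<in> Char H"
  shows "\<exists>M\<in>Char H. res M = k \<and> pr M = pr L"
proof -
  obtain x where x: "x \<in> classes G" "k = act (res L) (rel_class G x)" and k: "(res L, k) \<in> orbit_rel G"
    using assms(1) by (auto simp: pr_def orbit_rel_def)
  let ?M = "act L (rel_class H x)"
  have "?M \<in> Char H" using assms(2) rel_class_classes by (rule Char_act)
  moreover have M: "res ?M = k" "alex ?M = alex L"
    using x by (simp_all add: res_act_G alex_act classes_v0)
  moreover have "pr ?M = pr L" using equiv_class_eq[OF orbit_equiv k] M by (simp add: pr_def)
  ultimately show ?thesis by blast
qed

lemma cube_vertex_Char: "L \<in> Char H \<Longrightarrow> cube_vertex H L I \<in> Char H"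
  unfolding cube_vertex_def by (rule Char_act[OF _ rel_class_classes])

text \<open>Moves in the directions of \<open>G\<close> do not leave the fiber; only the direction
  \<open>v0\<close> changes the index.\<close>

lemma pr_cube_vertex:
  assumes "L \<in> Char H" "I \<subseteq> verts G"
  shows "pr (cube_vertex H L I) = pr L"
proof -
  have "(res L, res (cube_vertex H L I)) \<in> orbit_rel G"
  proof -
    have "res (cube_vertex H L I) = act (res L) (rel_class G (\<lambda>u. \<Sum>v\<in>I. vertex v u))"
      unfolding res_cube_vertex[OF assms(2)] by (simp only: cube_vertex_def)
    then show ?thesis
      using res_Char[OF assms(1)] res_Char[OF cube_vertex_Char[OF assms(1)]] indicator_G[OF assms(2)]
      unfolding orbit_rel_def by blast
  qed
  from equiv_class_eq[OF orbit_equiv this] show ?thesis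
    by (simp add: pr_def alex_cube_vertex[OF assms(2)])
qed

definition vtype :: "'v set \<Rightarrow> vertex_type" where
  "vtype E = (if v0 \<in> E then type_a else type_b)"

lemma vtype_simps [simp]: "vtype E = type_a \<longleftrightarrow> v0 \<in> E" "vtype E = type_b \<longleftrightarrow> v0 \<notin> E"
  by (simp_all add: vtype_def)

definition index_of :: "'v cube \<Rightarrow> ('v \<Rightarrow> int) set index_obj" where
  "index_of c = (fst (pr (fst c)), snd (pr (fst c)), vtype (snd c))"

lemma index_of_eq: "index_of (L, E) = (\<tt>, i, z) \<longleftrightarrow> pr L = (\<tt>, i) \<and> vtype E = z"
  by (auto simp: index_of_def prod_eq_iff)

text \<open>Covers both faces transverse to \<open>v0\<close>: a zero shift gives the near face,
  used by \<lambda>, and the shift \<open>V\<close> gives the far face, used by \<rho>.\<close>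

definition drop_v0 :: "('v \<Rightarrow> int) \<Rightarrow> 'v cube \<Rightarrow> 'v cube" where
  "drop_v0 S c = (act (fst c) S, snd c - {v0})"

lemma drop_v0_Pair [simp]: "drop_v0 S (L, E) = (act L S, E - {v0})"
  by (simp add: drop_v0_def)

lemma act_zero [simp]: "act L (\<lambda>_. 0) = L"
  by (simp add: act_def)

fun transport_cube :: "('v \<Rightarrow> int) set index_arr \<Rightarrow> 'v cube \<Rightarrow> 'v cube" where
  "transport_cube (Identity c) = (\<lambda>x. x)"
| "transport_cube (Lam \<tt> i) = drop_v0 (\<lambda>_. 0)"
| "transport_cube (Rho \<tt> i) = drop_v0 V"

definition res_cube :: "'v cube \<Rightarrow> 'v cube" where
  "res_cube c = (res (fst c), snd c - {v0})"

lemma res_cube_Pair [simp]: "res_cube (L, E) = (res L, E - {v0})"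
  by (simp add: res_cube_def)

end

locale plumbed_surgery = plumbed_knot Gv0 v0 n
  for Gv0 :: "'v wgraph" and v0 :: 'v and n :: int +
  fixes \<ss> :: "(('v \<Rightarrow> int) set \<times> rat) set"
  assumes \<ss>: "\<ss> \<in> surgery_classes Gv0 v0 n"
begin

lemma \<ss>_pairs: "\<ss> \<subseteq> pr ` Char H"
  and \<ss>_closed: "(\<tt>, i) \<in> \<ss> \<Longrightarrow> (add_knot Gv0 v0 \<tt>, i + r) \<in> \<ss>"
proof -
  let ?R = "surgery_step Gv0 v0 n \<union> (surgery_step Gv0 v0 n)\<inverse>"
  obtain p where p: "p \<in> pr ` Char H" "\<ss> = ?R\<^sup>* `` {p}"
    using \<ss> unfolding surgery_classes_def surgery_pairs_eq by (rule quotientE)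
  have step: "q' \<in> pr ` Char H" if st: "(q, q') \<in> ?R" "q \<in> pr ` Char H" for q q'
  proof (cases "(q, q') \<in> surgery_step Gv0 v0 n")
    case True
    obtain L where L: "L \<in> Char H" "q = pr L" using st(2) by blast
    then have "q' = pr (act L V)" using True by (auto simp: surgery_step_def pr_act_V r_def prod_eq_iff)
    then show ?thesis using L(1) Char_act_V by blast
  next
    case False
    \<comment> \<open>A reversed step ends at the source of a forward one, which
      \<open>surgery_step\<close> requires to be a pair.\<close>
    then show ?thesis using st(1) by (auto simp: surgery_step_def surgery_pairs_eq)
  qed
  have "q \<in> pr ` Char H" if "(p, q) \<in> ?R\<^sup>*" for q
    using that by induction (use p(1) step in blast)+
  then show sub: "\<ss> \<subseteq> pr ` Char H" using p(2) by blast
  assume ti: "(\<tt>, i) \<in> \<ss>"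
  then have "((\<tt>, i), (add_knot Gv0 v0 \<tt>, i + r)) \<in> ?R"
    using sub by (auto simp: surgery_step_def r_def surgery_pairs_eq)
  then show "(add_knot Gv0 v0 \<tt>, i + r) \<in> \<ss>"
    using ti p(2) by (auto intro: rtrancl_into_rtrancl)
qed

definition "\<LL> = surgery_Char Gv0 v0 n \<ss>"

lemma \<ss>_Spinc: "(\<tt>, i) \<in> \<ss> \<Longrightarrow> \<tt> \<in> Spinc G"
  using \<ss>_pairs res_Char by (force simp: pr_def Spinc_def intro: quotientI)

lemma \<LL>_iff: "L \<in> \<LL> \<longleftrightarrow> L \<in> Char H \<and> pr L \<in> \<ss>"
proof -
  have "pr L = (\<tt>, i) \<longleftrightarrow> res L \<in> \<tt> \<and> alex L = i" if "(\<tt>, i) \<in> \<ss>" "L \<in> Char H" for \<tt> i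
    using mem_orbit_iff[OF \<ss>_Spinc[OF that(1)] res_Char[OF that(2)]] by (auto simp: pr_def)
  moreover have "L \<in> \<LL> \<longleftrightarrow> L \<in> Char H \<and> (\<exists>\<tt> i. (\<tt>, i) \<in> \<ss> \<and> res L \<in> \<tt> \<and> alex L = i)"
    by (auto simp: \<LL>_def surgery_Char_def H_def G_def res_def alex_def)
  ultimately show ?thesis by (metis surj_pair)
qed

section \<open>Cubes fibered over the surgery index category\<close>

definition "D = cube_cat H \<LL>"
definition "C = surgery_cat Gv0 v0 n \<ss>"

lemma thin_D: "thin D"
  unfolding D_def by (rule thin_cube_cat[OF finH])

abbreviation fiber :: "('v \<Rightarrow> int) set index_obj \<Rightarrow> ('v cube, 'v cube \<times> 'v cube) cat" where
  "fiber c \<equiv> full_subcat D (\<lambda>d. index_of d = c)"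

lemma Obj_fiber: "(L, E) \<in> Obj (fiber (\<tt>, i, z)) \<longleftrightarrow>
    L \<in> \<LL> \<and> pr L = (\<tt>, i) \<and> E \<subseteq> verts H \<and> vtype E = z"
  by (auto simp: Obj_full_subcat D_def Obj_cube_cat index_of_eq)

lemma Arr_D: "((L, E), (L', E')) \<in> Arr D \<longleftrightarrow>
    L \<in> \<LL> \<and> E \<subseteq> verts H \<and> L' \<in> \<LL> \<and> E' \<subseteq> E \<and> (\<exists>J\<subseteq>E - E'. L' = cube_vertex H L J)"
  by (simp add: D_def Arr_cube_cat)

lemma Arr_fiber: "(a, b) \<in> Arr (fiber c) \<longleftrightarrow> (a, b) \<in> Arr D \<and> index_of a = c \<and> index_of b = c"
  using thin_D by (rule Arr_full_subcat)

lemma Obj_C: "(\<tt>, i, z) \<in> Obj C \<longleftrightarrow> (\<tt>, i) \<in> \<ss>"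
  by (simp add: C_def surgery_cat_def index_cat_def Let_def)

lemma Arr_C: "f \<in> Arr C \<longleftrightarrow> (case f of Identity c \<Rightarrow> c \<in> Obj C | Lam \<tt> i \<Rightarrow> (\<tt>, i) \<in> \<ss> | Rho \<tt> i \<Rightarrow> (\<tt>, i) \<in> \<ss>)"
  by (cases f) (auto simp: C_def surgery_cat_def index_cat_def Let_def)

lemma C_simps:
  "Dom C (Identity c) = c" "Dom C (Lam \<tt> i) = (\<tt>, i, type_a)" "Dom C (Rho \<tt> i) = (\<tt>, i, type_a)"
  "Cod C (Identity c) = c" "Cod C (Lam \<tt> i) = (\<tt>, i, type_b)"
  "Cod C (Rho \<tt> i) = (add_knot Gv0 v0 \<tt>, i + r, type_b)" "Ident C = Identity"
  "Comp C g f = (case f of Identity c \<Rightarrow> g | _ \<Rightarrow> f)"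
  by (simp_all add: C_def surgery_cat_def index_cat_def Let_def r_def)

text \<open>The inverse reinserts \<open>v0\<close> and subtracts the shift. Faces correspond
  because both cubes contain \<open>v0\<close>, so removing it leaves \<open>E - E'\<close>
  unchanged, and translation commutes with taking cube vertices.\<close>

lemma thin_iso_drop_v0:
  assumes S: "\<And>L. act L S \<in> \<LL> \<and> pr (act L S) = p' \<longleftrightarrow> L \<in> \<LL> \<and> pr L = p"
  shows "thin_iso (drop_v0 S) (fiber (fst p, snd p, type_a)) (fiber (fst p', snd p', type_b))"
  unfolding thin_iso_def
proof (intro conjI ballI)
  let ?A = "fiber (fst p, snd p, type_a)" and ?B = "fiber (fst p', snd p', type_b)"
  show "bij_betw (drop_v0 S) (Obj ?A) (Obj ?B)"
  proof (rule bij_betw_byWitness[where f' = "\<lambda>(L, E). (act L (\<lambda>v. - S v), insert v0 E)"])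
    show "drop_v0 S ` Obj ?A \<subseteq> Obj ?B"
    proof (rule image_subsetI)
      fix c assume c: "c \<in> Obj ?A"
      obtain L E where LE: "c = (L, E)" by (cases c)
      have "L \<in> \<LL>" "pr L = p" "E \<subseteq> verts H" using c by (simp_all add: LE Obj_fiber)
      then show "drop_v0 S c \<in> Obj ?B" using S[of L] by (auto simp: LE Obj_fiber)
    qed
    show "(\<lambda>(L, E). (act L (\<lambda>v. - S v), insert v0 E)) ` Obj ?B \<subseteq> Obj ?A"
    proof (rule image_subsetI)
      fix c assume c: "c \<in> Obj ?B"
      obtain L E where LE: "c = (L, E)" by (cases c)
      have "L \<in> \<LL>" "pr L = p'" "E \<subseteq> verts H" using c by (simp_all add: LE Obj_fiber)
      then show "(case c of (L, E) \<Rightarrow> (act L (\<lambda>v. - S v), insert v0 E)) \<in> Obj ?A"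
        using S[of "act L (\<lambda>v. - S v)"] by (simp add: LE Obj_fiber vH)
    qed
  qed (auto simp: Obj_fiber)
  fix a b assume "a \<in> Obj ?A" "b \<in> Obj ?A"
  then obtain L E L' E' where ab: "a = (L, E)" "b = (L', E')"
    "L \<in> \<LL>" "pr L = p" "E \<subseteq> verts H" "v0 \<in> E" "L' \<in> \<LL>" "pr L' = p" "E' \<subseteq> verts H" "v0 \<in> E'"
    by (cases a; cases b) (auto simp: Obj_fiber)
  have "E - {v0} - (E' - {v0}) = E - E'" "E' - {v0} \<subseteq> E - {v0} \<longleftrightarrow> E' \<subseteq> E" "E - {v0} \<subseteq> verts H"
    using ab by blast+
  then show "(drop_v0 S a, drop_v0 S b) \<in> Arr ?B \<longleftrightarrow> (a, b) \<in> Arr ?A"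
    using ab S[of L] S[of L'] by (simp add: Arr_fiber Arr_D index_of_eq cube_vertex_act)
qed

text \<open>For the direction from right to left in the index, \<open>add_knot\<close> must be
  cancelled: it is the image map of an injective translation, hence injective on sets.\<close>

lemma act_V_\<LL>:
  assumes "(\<tt>, i) \<in> \<ss>"
  shows "act L V \<in> \<LL> \<and> pr (act L V) = (add_knot Gv0 v0 \<tt>, i + r) \<longleftrightarrow> L \<in> \<LL> \<and> pr L = (\<tt>, i)"
proof (cases "L \<in> Char H")
  case True
  have "inj (\<lambda>k. act k (knot_class Gv0 v0))" by (simp add: inj_def)
  then have "add_knot Gv0 v0 (fst (pr L)) = add_knot Gv0 v0 \<tt> \<longleftrightarrow> fst (pr L) = \<tt>"
    unfolding add_knot_def by (rule inj_image_eq_iff)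
  then show ?thesis
    using True assms \<ss>_closed[OF assms] by (auto simp: \<LL>_iff Char_act_V pr_act_V prod_eq_iff)
qed (simp add: \<LL>_iff Char_act_V)

lemma thin_iso_transport:
  "f \<in> Arr C \<Longrightarrow> thin_iso (transport_cube f) (fiber (Dom C f)) (fiber (Cod C f))"
proof (cases f)
  case (Identity c)
  then show ?thesis by (simp add: thin_iso_def C_simps bij_betw_def)
next
  case (Lam \<tt> i)
  then show ?thesis using thin_iso_drop_v0[of "\<lambda>_. 0" "(\<tt>, i)" "(\<tt>, i)"] by (simp add: C_simps)
next
  case (Rho \<tt> i)
  assume "f \<in> Arr C"
  then have "(\<tt>, i) \<in> \<ss>" using Rho by (simp add: Arr_C)
  then show ?thesis
    using Rho thin_iso_drop_v0[of V "(add_knot Gv0 v0 \<tt>, i + r)" "(\<tt>, i)", OF act_V_\<LL>]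
    by (simp add: C_simps)
qed

text \<open>Passing to a transverse face after a face fixes one more coordinate, at 0 for the zero
  shift and at 1 for \<open>V\<close>; the set of coordinates at 1 is accordingly \<open>J\<close>
  or \<open>insert v0 J\<close>.\<close>

lemma push_drop:
  assumes "((L, E), (L', E')) \<in> Arr D" "v0 \<in> E'" "act L' S \<in> \<LL>"
    and "S = (\<lambda>_. 0) \<or> S = V"
  shows "((L, E), (act L' S, E' - {v0})) \<in> Arr D"
proof -
  obtain J where J: "L \<in> \<LL>" "E \<subseteq> verts H" "E' \<subseteq> E" "J \<subseteq> E - E'" "L' = cube_vertex H L J"
    using assms(1) by (auto simp: Arr_D)
  have "J \<subseteq> verts G" using J(2,3,4) assms(2) unfolding vH by blast
  then have V: "act L' V = cube_vertex H L (insert v0 J)" by (simp add: J(5) cube_vertex_insert_v0)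
  have J0: "insert v0 J \<subseteq> E - (E' - {v0})" using J(3,4) assms(2) by blast
  from assms(4) have "\<exists>J'\<subseteq>E - (E' - {v0}). act L' S = cube_vertex H L J'"
  proof
    assume "S = (\<lambda>_. 0)"
    then show ?thesis using J0 J(5) by (intro exI[of _ J]) simp
  next
    assume "S = V"
    then show ?thesis using J0 V by (intro exI[of _ "insert v0 J"]) simp
  qed
  moreover have "E' - {v0} \<subseteq> E" using J(3) by blast
  ultimately show ?thesis using J(1,2) assms(3) unfolding Arr_D by blast
qed

lemma category_C: "category C"
  unfolding C_def surgery_cat_def using \<ss>_closed[unfolded r_def] by (rule category_index_cat)

text \<open>If the face keeps or never had the direction \<open>v0\<close>, it stays in one fiber
  and the index arrow is an identity. Otherwise \<open>v0\<close> is put back into the face to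
  obtain a cube of the same fiber, and whether \<open>v0\<close> lies in \<open>J\<close> decides
  between \<rho> and \<lambda>.\<close>

lemma factor_D:
  assumes "(x, y') \<in> Arr D"
  shows "\<exists>f y. f \<in> Arr C \<and> Dom C f = index_of x \<and> (x, y) \<in> Arr D \<and> index_of y = index_of x \<and>
    transport_cube f y = y'"
proof -
  obtain L E L' E' where xy: "x = (L, E)" "y' = (L', E')" by (cases x; cases y')
  obtain J where J: "L \<in> \<LL>" "E \<subseteq> verts H" "L' \<in> \<LL>" "E' \<subseteq> E" "J \<subseteq> E - E'" "L' = cube_vertex H L J"
    using assms by (auto simp: xy Arr_D)
  obtain \<tt> i where ti: "pr L = (\<tt>, i)" by (cases "pr L")
  have L: "L \<in> Char H" "(\<tt>, i) \<in> \<ss>" using J(1) ti by (simp_all add: \<LL>_iff)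
  have sub: "J - {v0} \<subseteq> verts G" using J(2,4,5) unfolding vH by blast
  show ?thesis
  proof (cases "v0 \<in> E \<longleftrightarrow> v0 \<in> E'")
    case True
    then have "J \<subseteq> verts G" using J(2,4,5) unfolding vH by blast
    then have "index_of y' = index_of x"
      using True pr_cube_vertex[OF L(1)] J(6) by (simp add: xy index_of_def vtype_def)
    then show ?thesis
      using assms L(2) by (intro exI[of _ "Identity (index_of x)"] exI[of _ y'])
        (simp add: Arr_C C_simps xy index_of_def ti Obj_C)
  next
    case False
    then have v0: "v0 \<in> E" "v0 \<notin> E'" using J(4) by blast+
    show ?thesis
    proof (cases "v0 \<in> J")
      case True
      \<comment> \<open>The displacement in the directions of \<open>G\<close> is made first; the
        remaining step by \<open>V\<close> is then the transport along \<rho>.\<close>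
      let ?M = "cube_vertex H L (J - {v0})"
      have M: "pr ?M = pr L" "?M \<in> \<LL>"
        using pr_cube_vertex[OF L(1) sub] cube_vertex_Char[OF L(1)] L(2) ti by (auto simp: \<LL>_iff)
      have "act ?M V = L'"
        using cube_vertex_insert_v0[OF sub, of L] True J(6) by (simp add: insert_absorb)
      moreover have "((L, E), (?M, insert v0 E')) \<in> Arr D"
        unfolding Arr_D using J(1,2,4,5) v0 M(2) by (intro conjI exI[of _ "J - {v0}"]) auto
      ultimately show ?thesis
        using L(2) v0 M(1) by (intro exI[of _ "Rho \<tt> i"] exI[of _ "(?M, insert v0 E')"])
          (simp add: xy Arr_C C_simps index_of_def vtype_def ti)
    next
      case False
      then have "J \<subseteq> verts G" using sub by auto
      then have "pr L' = pr L" using pr_cube_vertex[OF L(1)] J(6) by simp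
      moreover have "((L, E), (L', insert v0 E')) \<in> Arr D"
        unfolding Arr_D using J v0 False by (intro conjI exI[of _ J]) auto
      ultimately show ?thesis
        using L(2) v0 by (intro exI[of _ "Lam \<tt> i"] exI[of _ "(L', insert v0 E')"])
          (simp add: xy Arr_C C_simps index_of_def vtype_def ti)
    qed
  qed
qed

sublocale F: fibered_thin C D index_of transport_cube
proof
  show "category C" by (rule category_C)
  show "thin D" by (rule thin_D)
  show "index_of d \<in> Obj C" if "d \<in> Obj D" for d
    using that by (cases d) (auto simp: D_def Obj_cube_cat \<LL>_iff index_of_def Obj_C)
  show "f \<in> Arr C \<Longrightarrow> thin_iso (transport_cube f) (fiber (Dom C f)) (fiber (Cod C f))" for f
    by (rule thin_iso_transport)
  show "transport_cube (Ident C (index_of d)) d = d" for d by (simp add: C_simps)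
  show "transport_cube (Comp C g f) d = transport_cube g (transport_cube f d)"
    if "f \<in> Arr C" "g \<in> Arr C" "Cod C f = Dom C g" for f g d
    using that by (cases f; cases g) (auto simp: C_simps)
  show "(x, transport_cube f y) \<in> Arr D"
    if f: "f \<in> Arr C" and xy: "(x, y) \<in> Arr D" "index_of x = Dom C f" "index_of y = Dom C f" for f x y
  proof (cases f)
    case (Identity c)
    then show ?thesis using xy by simp
  next
    case (Lam \<tt> i)
    then show ?thesis
      using xy push_drop[of _ _ _ _ "\<lambda>_. 0"] by (cases x; cases y) (auto simp: C_simps index_of_eq Arr_D)
  next
    case (Rho \<tt> i)
    obtain L E L' E' where xy': "x = (L, E)" "y = (L', E')" by (cases x; cases y)
    have "(\<tt>, i) \<in> \<ss>" using f Rho by (simp add: Arr_C)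
    moreover have "L' \<in> \<LL>" using xy xy' by (simp add: Arr_D)
    ultimately show ?thesis
      using xy Rho act_V_\<LL>[of \<tt> i L'] push_drop[of L E L' E' V]
      by (simp add: xy' C_simps index_of_eq)
  qed
  show "\<exists>f y. f \<in> Arr C \<and> Dom C f = index_of x \<and> (x, y) \<in> Arr D \<and> index_of y = index_of x \<and>
    transport_cube f y = y'" if "(x, y') \<in> Arr D" for x y'
    using that by (rule factor_D)
  \<comment> \<open>The only competitors are \<lambda> and \<rho> from the same object, and their
    targets have different second components since r is not zero.\<close>
  show "f = g" if "f \<in> Arr C" "g \<in> Arr C" "Dom C f = Dom C g" "Cod C f = Cod C g" for f g
    using that r_neg by (cases f; cases g) (auto simp: C_simps)
qed

lemma hU_mono_D: "(a, b) \<in> Arr D \<Longrightarrow> hU H a \<le> hU H b"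
  unfolding D_def by (rule hU_mono[OF finH])

section \<open>The two diagrams and the isomorphism between them\<close>

lemma TB_Ob:
  assumes "c \<in> Obj C"
  shows "Ob (TB Gv0 v0 n \<ss>) c = hocolim (fiber c) (point_diagram (hU H))"
proof -
  obtain \<tt> i z where c: "c = (\<tt>, i, z)" by (cases c)
  let ?P = "\<lambda>(L, E). (case z of type_a \<Rightarrow> v0 \<in> E | type_b \<Rightarrow> v0 \<notin> E) \<and> res L \<in> \<tt> \<and> alex L = i"
  have t: "\<tt> \<in> Spinc G" using assms \<ss>_Spinc by (simp add: c Obj_C)
  have "full_subcat D ?P = fiber c"
  proof (rule full_subcat_cong[OF thinD(1)[OF thin_D]])
    fix d assume d: "d \<in> Obj D"
    obtain L E where LE: "d = (L, E)" by (cases d)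
    have "L \<in> Char H" using d by (simp add: LE D_def Obj_cube_cat \<LL>_iff)
    then have "res L \<in> \<tt> \<and> alex L = i \<longleftrightarrow> pr L = (\<tt>, i)"
      using mem_orbit_iff[OF t res_Char] by (auto simp: pr_def)
    then show "?P d \<longleftrightarrow> index_of d = c" by (cases z) (auto simp: LE c index_of_eq)
  qed
  then show ?thesis
    by (simp add: TB_def Let_def c D_def \<LL>_def H_def res_def G_def alex_def)
qed

lemma TB_Mor: "Mor (TB Gv0 v0 n \<ss>) f m s = induced (transport_cube f) m s"
proof (cases f)
  case (Identity c)
  then show ?thesis by (simp add: TB_def Let_def induced_ident)
next
  case (Lam \<tt> i)
  have "drop_v0 (\<lambda>_. 0) = (\<lambda>(L, E). (L, E - {v0}))" by auto
  then show ?thesis using Lam by (simp add: TB_def Let_def)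
next
  case (Rho \<tt> i)
  have "drop_v0 V = (\<lambda>(L, E). (act L V, E - {v0}))" by auto
  then show ?thesis using Rho by (simp add: TB_def Let_def V_def H_def)
qed

definition height_XD :: "rat \<Rightarrow> vertex_type \<Rightarrow> 'v cube \<Rightarrow> rat" where
  "height_XD i z c =
     (case z of type_a \<Rightarrow> min (hU G c) (hV Gv0 v0 c + 2 * i) | type_b \<Rightarrow> hU G c) + gr r i"

lemma XD_Ob: "Ob (XD r (CFK Gv0 v0)) (\<tt>, i, z) = hocolim (cube_cat G \<tt>) (point_diagram (height_XD i z))"
  by (cases z) (simp_all add: XD_def CFK_def Let_def shift_def A_pull_def p1_def G_def[symmetric]
      map_height_hocolim_point height_XD_def[abs_def])

lemma XD_Mor:
  "Mor (XD r (CFK Gv0 v0)) (Identity c) m s = s"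
  "Mor (XD r (CFK Gv0 v0)) (Lam \<tt> i) m s = s"
  "Mor (XD r (CFK Gv0 v0)) (Rho \<tt> i) m s = induced (flip_cube Gv0 v0) m s"
  by (simp_all add: XD_def CFK_def Let_def eta1_def eta2_def)

text \<open>Injectivity is \<open>Char_eqI\<close> and surjectivity is \<open>orbit_pr_eq\<close>;
  the vertex type \<open>z\<close> tells whether \<open>v0\<close> has to be restored. Two cubes in
  one fiber both contain \<open>v0\<close> or both omit it, so the displacement of a face involves
  only vertices of \<open>G\<close> and is visible after restriction.\<close>

lemma thin_iso_res_cube:
  assumes "(\<tt>, i) \<in> \<ss>"
  shows "thin_iso res_cube (fiber (\<tt>, i, z)) (cube_cat G \<tt>)"
  unfolding thin_iso_def
proof (intro conjI ballI)
  let ?A = "fiber (\<tt>, i, z)"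
  have drop: "E = E'" if "E - {v0} = E' - {v0}" "vtype E = vtype E'" for E E'
    using that by (auto simp: vtype_def split: if_splits)
  have eqI: "L = L'" if "L \<in> Char H" "L' \<in> Char H" "res L = res L'" "alex L = alex L'" for L L'
    using that(3,4) by (rule Char_eqI[rotated 2]) (rule that(1,2)[THEN Char_classes])+
  have alex: "alex L = i" if "pr L = (\<tt>, i)" for L using that by (simp add: pr_def)
  have mem: "res L \<in> \<tt>" if "pr L = (\<tt>, i)" "L \<in> Char H" for L
    using that mem_orbit_iff[OF \<ss>_Spinc[OF assms] res_Char[OF that(2)]] by (simp add: pr_def)
  show "bij_betw res_cube (Obj ?A) (Obj (cube_cat G \<tt>))"
  proof (rule bij_betw_imageI)
    show "inj_on res_cube (Obj ?A)"
    proof (rule inj_onI)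
      fix a b assume "a \<in> Obj ?A" "b \<in> Obj ?A" and eq: "res_cube a = res_cube b"
      moreover obtain L E L' E' where ab: "a = (L, E)" "b = (L', E')" by (cases a; cases b)
      ultimately have "L \<in> Char H" "L' \<in> Char H" "alex L = alex L'" "vtype E = vtype E'"
        by (simp_all add: Obj_fiber \<LL>_iff alex)
      then show "a = b" using eq drop eqI by (simp add: ab)
    qed
    show "res_cube ` Obj ?A = Obj (cube_cat G \<tt>)"
    proof (intro equalityI subsetI)
      fix c assume "c \<in> res_cube ` Obj ?A"
      then obtain L E where "c = res_cube (L, E)" "L \<in> \<LL>" "pr L = (\<tt>, i)" "E \<subseteq> insert v0 (verts G)"
        using vH by (force simp: Obj_fiber)
      then show "c \<in> Obj (cube_cat G \<tt>)" using mem by (auto simp: Obj_cube_cat \<LL>_iff)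
    next
      fix c assume c: "c \<in> Obj (cube_cat G \<tt>)"
      obtain k E where kE: "c = (k, E)" by (cases c)
      have k: "k \<in> \<tt>" "E \<subseteq> verts G" using c by (simp_all add: kE Obj_cube_cat)
      obtain L where L: "L \<in> Char H" "pr L = (\<tt>, i)" using \<ss>_pairs assms by (metis imageE subsetD)
      obtain M where M: "M \<in> Char H" "res M = k" "pr M = (\<tt>, i)"
        using orbit_pr_eq[of k L] k(1) L by auto
      define E' where "E' = (if z = type_a then insert v0 E else E)"
      have "v0 \<notin> E" using k(2) v0G by blast
      then have "E' - {v0} = E" "vtype E' = z" "E' \<subseteq> verts H"
        using k(2) by (auto simp: E'_def vtype_def vH split: vertex_type.splits) (metis vertex_type.exhaust)
      then have "(M, E') \<in> Obj ?A" "c = res_cube (M, E')"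
        using M assms by (simp_all add: Obj_fiber \<LL>_iff kE)
      then show "c \<in> res_cube ` Obj ?A" by (rule rev_image_eqI)
    qed
  qed
  fix a b assume "a \<in> Obj ?A" "b \<in> Obj ?A"
  moreover obtain L E L' E' where ab: "a = (L, E)" "b = (L', E')" by (cases a; cases b)
  ultimately have LE: "L \<in> \<LL>" "pr L = (\<tt>, i)" "E \<subseteq> verts H" "vtype E = z"
    and LE': "L' \<in> \<LL>" "pr L' = (\<tt>, i)" "E' \<subseteq> verts H" "vtype E' = z" by (simp_all add: Obj_fiber)
  have Ch: "L \<in> Char H" "L' \<in> Char H" using LE(1) LE'(1) by (simp_all add: \<LL>_iff)
  have iff: "v0 \<in> E \<longleftrightarrow> v0 \<in> E'" using LE(4) LE'(4) by (auto simp: vtype_def split: if_splits)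
  have sub: "E' - {v0} \<subseteq> E - {v0} \<longleftrightarrow> E' \<subseteq> E" "E - {v0} - (E' - {v0}) = E - E'" using iff by blast+
  have EG: "E - {v0} \<subseteq> verts G" "E - E' \<subseteq> verts G" if "E' \<subseteq> E"
    using LE(3) iff that unfolding vH by blast+
  \<comment> \<open>Both classes upstairs have index i, so equality of their restrictions already
    implies their equality.\<close>
  have cv: "res L' = cube_vertex G (res L) J \<longleftrightarrow> L' = cube_vertex H L J" if J: "J \<subseteq> verts G" for J
  proof
    assume "res L' = cube_vertex G (res L) J"
    then show "L' = cube_vertex H L J"
      using J LE(2) LE'(2)
      by (intro eqI[OF Ch(2) cube_vertex_Char[OF Ch(1)]]) (simp_all add: res_cube_vertex alex_cube_vertex alex)
  qed (simp add: res_cube_vertex J)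
  have J: "(\<exists>J\<subseteq>E - E'. res L' = cube_vertex G (res L) J) \<longleftrightarrow> (\<exists>J\<subseteq>E - E'. L' = cube_vertex H L J)"
    if "E' \<subseteq> E" using cv subset_trans[OF _ EG(2)[OF that]] by (intro ex_cong1 conj_cong refl) blast
  show "(res_cube a, res_cube b) \<in> Arr (cube_cat G \<tt>) \<longleftrightarrow> (a, b) \<in> Arr ?A"
  proof (cases "E' \<subseteq> E")
    case True
    then show ?thesis
      using LE LE' mem[OF LE(2) Ch(1)] mem[OF LE'(2) Ch(2)] EG(1) J
      by (simp add: ab Arr_cube_cat Arr_fiber Arr_D index_of_eq sub)
  next
    case False
    then show ?thesis by (simp add: ab Arr_cube_cat Arr_fiber Arr_D sub)
  qed
qed

lemma height_XD_res_cube: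
  assumes "c \<in> Obj (fiber (\<tt>, i, z))"
  shows "height_XD i z (res_cube c) = hU H c"
proof -
  obtain L E where LE: "c = (L, E)" by (cases c)
  have *: "pr L = (\<tt>, i)" "E \<subseteq> verts H" "vtype E = z" using assms by (simp_all add: LE Obj_fiber)
  then have i: "alex L = i" "E - {v0} \<subseteq> verts G" unfolding vH by (auto simp: pr_def)
  show ?thesis
  proof (cases z)
    case type_a
    then have "insert v0 (E - {v0}) = E" using *(3) by auto
    then show ?thesis using hU_with_v0[OF i(2), of L] i(1) type_a by (simp add: LE height_XD_def)
  next
    case type_b
    then have "E - {v0} = E" using *(3) by auto
    then show ?thesis using hU_without_v0[OF i(2), of L] i(1) type_b by (simp add: LE height_XD_def)
  qed
qed

lemma filtered_iso_res_cube:
  assumes "(\<tt>, i) \<in> \<ss>"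
  shows "filtered_iso (hocolim (fiber (\<tt>, i, z)) (point_diagram (hU H)))
    (hocolim (cube_cat G \<tt>) (point_diagram (height_XD i z))) (induced res_cube)"
  using height_XD_res_cube
  by (intro filtered_iso_induced thin_full_subcat thin_D thin_cube_cat finG thin_iso_res_cube assms)
    (auto simp: Arr_fiber hU_mono_D)

lemma filtered_diagram_TB: "filtered_diagram C (TB Gv0 v0 n \<ss>)"
  unfolding C_def surgery_cat_def
proof (rule filtered_diagram_index_cat)
  have mor: "filtered_map (Ob (TB Gv0 v0 n \<ss>) (Dom C f)) (Ob (TB Gv0 v0 n \<ss>) (Cod C f)) (Mor (TB Gv0 v0 n \<ss>) f)"
    if f: "f \<in> Arr C" for f
  proof -
    note I = thin_isoD[OF thin_iso_transport[OF f]]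
    have "Mor (TB Gv0 v0 n \<ss>) f = induced (transport_cube f)" by (simp add: fun_eq_iff TB_Mor)
    moreover have "filtered_map (hocolim (fiber (Dom C f)) (point_diagram (hU H)))
        (hocolim (fiber (Cod C f)) (point_diagram (hU H))) (induced (transport_cube f))"
    proof (rule filtered_map_induced[OF F.thin_fiber F.thin_fiber I(2)])
      show "(transport_cube f a, transport_cube f b) \<in> Arr (fiber (Cod C f))"
        if "(a, b) \<in> Arr (fiber (Dom C f))" for a b
        using that I(4)[of a b] thinD(6,7)[OF F.thin_fiber that] by blast
      \<comment> \<open>Pushing the identity arrow of \<open>c\<close> along \<open>f\<close>
        exhibits the transported cube as a face of \<open>c\<close>, so its height is at least as
        large.\<close>
      show "hU H c \<le> hU H (transport_cube f c)" if "c \<in> Obj (fiber (Dom C f))" for c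
        using that F.push[OF f, of c c] thinD(8)[OF thin_D]
        by (auto simp: Obj_full_subcat intro: hU_mono_D)
    qed
    ultimately show ?thesis by (simp add: TB_Ob categoryD(1,2)[OF category_C f])
  qed
  show "filtered_map (Ob (TB Gv0 v0 n \<ss>) (\<tt>, i, type_a)) (Ob (TB Gv0 v0 n \<ss>) (\<tt>, i, type_b))
      (Mor (TB Gv0 v0 n \<ss>) (Lam \<tt> i))" if "(\<tt>, i) \<in> \<ss>" for \<tt> i
    using mor[of "Lam \<tt> i"] that by (simp add: Arr_C C_simps)
  show "filtered_map (Ob (TB Gv0 v0 n \<ss>) (\<tt>, i, type_a))
      (Ob (TB Gv0 v0 n \<ss>) (add_knot Gv0 v0 \<tt>, i + Seifert_framing Gv0 v0 n, type_b))
      (Mor (TB Gv0 v0 n \<ss>) (Rho \<tt> i))" if "(\<tt>, i) \<in> \<ss>" for \<tt> i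
    using mor[of "Rho \<tt> i"] that by (simp add: Arr_C C_simps r_def)
  show "filtered_sset (Ob (TB Gv0 v0 n \<ss>) (\<tt>, i, z))" if "(\<tt>, i) \<in> \<ss>" for \<tt> i z
    using filtered_isoD(1)[OF filtered_iso_res_cube[OF that]] that by (simp add: TB_Ob Obj_C)
  show "(add_knot Gv0 v0 \<tt>, i + Seifert_framing Gv0 v0 n) \<in> \<ss>" if "(\<tt>, i) \<in> \<ss>" for \<tt> i
    using \<ss>_closed[OF that] by (simp add: r_def)
  show "Mor (TB Gv0 v0 n \<ss>) (Identity c) m x = x" for c m x
    by (simp add: TB_Mor induced_ident)
qed

lemma filtered_diagram_XD: "filtered_diagram C (XD r (CFK Gv0 v0))"
  unfolding C_def surgery_cat_def
proof (rule filtered_diagram_index_cat)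
  note T = thin_cube_cat[OF finG]
  show "filtered_sset (Ob (XD r (CFK Gv0 v0)) (\<tt>, i, z))" if "(\<tt>, i) \<in> \<ss>" for \<tt> i z
    using filtered_isoD(2)[OF filtered_iso_res_cube[OF that]] by (simp add: XD_Ob)
  show "Mor (XD r (CFK Gv0 v0)) (Identity c) m x = x" for c m x
    by (simp add: XD_Mor)
  show "(add_knot Gv0 v0 \<tt>, i + Seifert_framing Gv0 v0 n) \<in> \<ss>" if "(\<tt>, i) \<in> \<ss>" for \<tt> i
    using \<ss>_closed[OF that] by (simp add: r_def)
  show "filtered_map (Ob (XD r (CFK Gv0 v0)) (\<tt>, i, type_a)) (Ob (XD r (CFK Gv0 v0)) (\<tt>, i, type_b))
      (Mor (XD r (CFK Gv0 v0)) (Lam \<tt> i))" for \<tt> i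
  proof -
    have "Mor (XD r (CFK Gv0 v0)) (Lam \<tt> i) = induced (\<lambda>c. c)"
      by (simp add: fun_eq_iff XD_Mor induced_ident)
    then show ?thesis
      unfolding XD_Ob by (auto intro!: filtered_map_induced T simp: height_XD_def)
  qed
  show "filtered_map (Ob (XD r (CFK Gv0 v0)) (\<tt>, i, type_a))
      (Ob (XD r (CFK Gv0 v0)) (add_knot Gv0 v0 \<tt>, i + Seifert_framing Gv0 v0 n, type_b))
      (Mor (XD r (CFK Gv0 v0)) (Rho \<tt> i))" for \<tt> i
  proof -
    have flip: "flip_cube Gv0 v0 (k, E) = (act k K, E)" for k E by (simp add: flip_cube_def K_def)
    have "filtered_map (hocolim (cube_cat G \<tt>) (point_diagram (height_XD i type_a)))
      (hocolim (cube_cat G (add_knot Gv0 v0 \<tt>)) (point_diagram (height_XD (i + r) type_b)))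
      (induced (flip_cube Gv0 v0))"
    proof (rule filtered_map_induced[OF T T])
      fix c assume "c \<in> Obj (cube_cat G \<tt>)"
      then show "flip_cube Gv0 v0 c \<in> Obj (cube_cat G (add_knot Gv0 v0 \<tt>))"
        by (cases c) (auto simp: Obj_cube_cat flip add_knot_def K_def)
      \<comment> \<open>The minimum is at most its second entry, and adding gr(i) to that entry
        gives exactly the right-hand side, the summand 2i being absorbed into gr(i + r).\<close>
      show "height_XD i type_a c \<le> height_XD (i + r) type_b (flip_cube Gv0 v0 c)"
        by (simp add: height_XD_def gr_add hV_def G_def)
    next
      fix a b assume ab: "(a, b) \<in> Arr (cube_cat G \<tt>)"
      obtain k E k' E' where abe: "a = (k, E)" "b = (k', E')" by (cases a; cases b)
      show "(flip_cube Gv0 v0 a, flip_cube Gv0 v0 b) \<in> Arr (cube_cat G (add_knot Gv0 v0 \<tt>))"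
        using ab by (simp add: abe Arr_cube_cat flip cube_vertex_act add_knot_def K_def)
    qed
    moreover have "Mor (XD r (CFK Gv0 v0)) (Rho \<tt> i) = induced (flip_cube Gv0 v0)"
      by (simp add: fun_eq_iff XD_Mor)
    ultimately show ?thesis unfolding XD_Ob r_def[symmetric] by simp
  qed
qed

text \<open>One map of cubes serves at every object, and naturality already holds on cubes: the face
  for \<lambda> has the same restriction and the same directions in \<open>G\<close>, while
  translation by \<open>V\<close> restricts to the flip.\<close>

lemma diagram_iso_TB_XD:
  "diagram_iso C (TB Gv0 v0 n \<ss>) (XD r (CFK Gv0 v0)) (\<lambda>_. induced res_cube)"
  unfolding diagram_iso_def
proof (intro conjI ballI allI filtered_diagram_TB filtered_diagram_XD)
  fix c assume c: "c \<in> Obj C"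
  obtain \<tt> i z where tiz: "c = (\<tt>, i, z)" by (cases c)
  show "filtered_iso (Ob (TB Gv0 v0 n \<ss>) c) (Ob (XD r (CFK Gv0 v0)) c) (induced res_cube)"
    using filtered_iso_res_cube[of \<tt> i z] c unfolding TB_Ob[OF c] by (simp add: tiz XD_Ob Obj_C)
next
  fix f m s
  have lam: "(\<lambda>c. res_cube (drop_v0 (\<lambda>_. 0) c)) = res_cube"
    by (auto simp: fun_eq_iff)
  have rho: "(\<lambda>c. res_cube (drop_v0 V c)) = (\<lambda>c. flip_cube Gv0 v0 (res_cube c))"
    by (auto simp: fun_eq_iff flip_cube_def res_act_V K_def)
  show "induced res_cube m (Mor (TB Gv0 v0 n \<ss>) f m s)
      = Mor (XD r (CFK Gv0 v0)) f m (induced res_cube m s)"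
    by (cases f) (simp_all add: TB_Mor XD_Mor induced_ident induced_induced lam rho)
qed

lemma filtered_iso_TB_CF: "\<exists>\<Theta>. filtered_iso (hocolim C (TB Gv0 v0 n \<ss>)) (CF H \<LL>) \<Theta>"
  unfolding CF_def D_def[symmetric]
  by (rule exI, rule F.filtered_iso_hocolim_fibers[OF filtered_diagram_TB TB_Ob _ hU_mono_D])
    (simp_all add: TB_Mor induced_def)

end

theorem proposition7p2:
  fixes Gv0 :: "'v wgraph" and v0 :: 'v and n :: int
    and r :: rat and \<ss> :: "(('v \<Rightarrow> int) set \<times> rat) set"
  assumes "forest Gv0"
    and "only_unweighted_vertex Gv0 v0"
    and "negative_definite (set_weight Gv0 v0 n)"
    and "r = Seifert_framing Gv0 v0 n"
    and "\<ss> \<in> surgery_classes Gv0 v0 n"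
  shows "(\<exists>\<Phi>. diagram_iso (surgery_cat Gv0 v0 n \<ss>) (TB Gv0 v0 n \<ss>) (XD r (CFK Gv0 v0)) \<Phi>) \<and>
    (\<exists>\<Psi>. filtered_iso (hocolim (surgery_cat Gv0 v0 n \<ss>) (XD r (CFK Gv0 v0)))
       (CF (set_weight Gv0 v0 n) (surgery_Char Gv0 v0 n \<ss>)) \<Psi>)"
proof -
  interpret plumbed_surgery Gv0 v0 n \<ss>
    using assms by unfold_locales
  note iso = diagram_iso_TB_XD[unfolded C_def r_def, folded assms(4)]
  obtain \<Theta> where \<Theta>: "filtered_iso (hocolim (surgery_cat Gv0 v0 n \<ss>) (TB Gv0 v0 n \<ss>))
      (CF (set_weight Gv0 v0 n) (surgery_Char Gv0 v0 n \<ss>)) \<Theta>"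
    using filtered_iso_TB_CF unfolding C_def H_def \<LL>_def by blast
  obtain g where "filtered_iso (hocolim (surgery_cat Gv0 v0 n \<ss>) (XD r (CFK Gv0 v0)))
      (hocolim (surgery_cat Gv0 v0 n \<ss>) (TB Gv0 v0 n \<ss>)) g"
    using filtered_iso_sym[OF filtered_iso_hocolim[OF iso]] by blast
  from filtered_iso_trans[OF this \<Theta>] iso show ?thesis by blast
qed

end
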